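(* For every $\varepsilon>0$, as $x\to\infty$, $$S_{\mathbb{1}_{\mathbb{P}}}(x) = C_{\mathbb{1}_{\mathbb{P}}}\, x + O_{\varepsilon}(x^{9/19+\varepsilon}), \qquad S_{\mathbb{1}_{\mathbb{P}_{\rm ower}}}(x) = C_{\mathbb{1}_{\mathbb{P}_{\rm ower}}}\, x + O_{\varepsilon}(x^{9/19+\varepsilon}),$$ where the implied constants depend only on $\varepsilon$.
   Context: For a real number $t$, $[t]$ denotes its integer part. Let $\mathbb{P}$ be the set of primes and $\mathbb{P}_{\rm ower}$ the set of prime powers $p^\nu$ ($p$ prime, $\nu\geqslant 1$), with characteristic functions $\mathbb{1}_{\mathbb{P}}$ and $\mathbb{1}_{\mathbb{P}_{\rm ower}}$. Define $S_{\mathbb{1}_{\mathbb{P}}}(x) := \sum_{n\leqslant x} \mathbb{1}_{\mathbb{P}}([x/n])$ and $S_{\mathbb{1}_{\mathbb{P}_{\rm ower}}}(x) := \sum_{n\leqslant x} \mathbb{1}_{\mathbb{P}_{\rm ower}}([x/n])$, sums over positive integers $n$. The constants are $C_{\mathbb{1}_{\mathbb{P}}} := \sum_{p} \frac{1}{p(p+1)}$ (sum over primes) and $C_{\mathbb{1}_{\mathbb{P}_{\rm ower}}} := \sum_{p,\,\nu\geqslant 1} \frac{1}{p^{\nu}(p^{\nu}+1)}$. *)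

theory Defs
  imports
    "HOL-Analysis.Analysis"
    "HOL-Library.Landau_Symbols"
    "HOL-Number_Theory.Prime_Powers"
begin

definition prime_ind :: "nat \<Rightarrow> real" where
  "prime_ind = indicator {p. prime p}"

definition primepow_ind :: "nat \<Rightarrow> real" where
  "primepow_ind = indicator {q. primepow q}"

definition floor_sum :: "(nat \<Rightarrow> real) \<Rightarrow> real \<Rightarrow> real" where
  "floor_sum f x = (\<Sum>n | n \<ge> 1 \<and> real n \<le> x. f (nat \<lfloor>x / real n\<rfloor>))"

definition C_prime :: real where
  "C_prime = (\<Sum>\<^sub>\<infinity>p\<in>{p::nat. prime p}. 1 / (real p * (real p + 1)))"

definition C_primepow :: real where
  "C_primepow =
     (\<Sum>\<^sub>\<infinity>(p, \<nu>)\<in>{(p::nat, \<nu>::nat). prime p \<and> \<nu> \<ge> 1}. 1 / (real p ^ \<nu> * (real p ^ \<nu> + 1)))"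

text \<open>
  An infinite sum over a set is 0 by convention when it does not converge. The next facts show
  that the index set of \<open>floor_sum\<close> is finite and that the two series converge, so none of the
  definitions above takes a default value.
\<close>

lemma finite_floor_sum_index: "finite {n::nat. n \<ge> 1 \<and> real n \<le> x}"
  by (rule finite_subset[of _ "{..nat \<lfloor>x\<rfloor>}"]) (auto simp: le_nat_floor)

lemma summable_on_inverse_pronic:
  "(\<lambda>n::nat. 1 / (real n * (real n + 1))) summable_on A"
proof -
  have "summable (\<lambda>n::nat. 1 / real n ^ 2)"
    using inverse_power_summable[of 2, where 'a = real] by (simp add: inverse_eq_divide)
  then have "summable (\<lambda>n::nat. 1 / (real n * (real n + 1)))"
  proof (rule summable_comparison_test')
    fix n :: nat
    show "norm (1 / (real n * (real n + 1))) \<le> 1 / real n ^ 2"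
    proof (cases "n = 0")
      case False
      then have "1 / (real n * (real n + 1)) \<le> 1 / (real n * real n)"
        by (intro divide_left_mono mult_left_mono mult_pos_pos) simp_all
      then show ?thesis
        by (simp add: power2_eq_square)
    qed simp
  qed
  then have "(\<lambda>n::nat. 1 / (real n * (real n + 1))) summable_on UNIV"
    by (intro norm_summable_imp_summable_on) simp
  then show ?thesis
    by (rule summable_on_subset) simp
qed

lemma summable_on_C_prime:
  "(\<lambda>p. 1 / (real p * (real p + 1))) summable_on {p::nat. prime p}"
  by (rule summable_on_inverse_pronic)

lemma summable_on_C_primepow:
  "(\<lambda>(p, \<nu>). 1 / (real p ^ \<nu> * (real p ^ \<nu> + 1)))
     summable_on {(p::nat, \<nu>::nat). prime p \<and> \<nu> \<ge> 1}" (is "_ summable_on ?A")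
proof -
  let ?h = "\<lambda>(p::nat, \<nu>::nat). p ^ \<nu>"
  have "inj_on ?h ?A"
  proof (rule inj_onI, clarify)
    fix p a q b :: nat
    assume "prime p" "a \<ge> 1" "prime q" "b \<ge> 1" "p ^ a = q ^ b"
    then show "p = q \<and> a = b"
      using prime_power_inj''[of p q a b] by simp
  qed
  from summable_on_reindex[OF this, of "\<lambda>n. 1 / (real n * (real n + 1))"]
  have "((\<lambda>n. 1 / (real n * (real n + 1))) \<circ> ?h) summable_on ?A"
    using summable_on_inverse_pronic by simp
  then show ?thesis
    by (simp add: o_def case_prod_unfold)
qed

end

(*
  Put x = Y^19. Integers n with [x/n] > Y^10 contribute O(Y^9). The others are counted according to
  the value d = [x/n], attained [x/d] - [x/(d+1)] times; this gives the main term and the sums of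
  1_P(d) psi(x/d) and 1_P(d) psi(x/(d+1)), psi(t) = t - [t] - 1/2, over d <= Y^10. For d in (D, 2D]
  with Y^9 <= D <= Y^10, psi is replaced by a divided difference of the periodic second Bernoulli
  polynomial, whose Fourier series converges absolutely, at the cost of O(Y^9); frequencies h up to
  (D/Y^9)^2 <= Y^2 matter. Vaughan's identity with parameters of size Y^2 splits the sums of
  Lambda(d) e(hx/(d+delta)) into type I sums, bounded by van der Corput's second derivative test, and
  type II sums. In the latter the pairs (h,m) are grouped by the value of h/m, Cauchy's inequality is
  applied in the longer variable n, and the inner sum of e((h1/m1 - h2/m2) x/n) is bounded again by
  the second derivative test; averaging over h makes this nontrivial for m ~ n ~ D^(1/2).
*)
theory Submission
  imports
    Defs
    "HOL-Computational_Algebra.Squarefree"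
begin

section \<open>Van der Corput's second derivative test\<close>

text \<open>The exponent is fixed by the type II estimate. Let E be the error aimed at, D <= x/E, D
  = M N up to a constant, M <= D^(1/2), and group h/m into bins of width b. After Cauchy's
  inequality the pairs with h1 m2 = h2 m1 contribute H^2 N^2 / b, so b = N^2/E^2 makes them
  harmless. The other pairs then contribute about H^2 D M (x N)^(1/2) / E, which is at most H^2 E^2
  when D^3 M x <= E^6. The worst case D = x/E, M = D^(1/2) reads x^(9/4) <= E^(19/4), that is E =
  x^(9/19). The length H of the frequency range cancels. There are about H/(M b) bins. For H = 1 and
  D = Y^10 this is M/Y^2, which dictates the size Y^2 of the parameters in Vaughan's identity: a
  shorter variable m would leave less than one bin. The type I sums, over m up to about Y^4, then
  exceed H Y^9 by a factor (H Y^9/D)^(1/2) when H > D/Y^9. The decay 1/h^2 of the Fourier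
  coefficients in that range pays for it. Logarithms and divisor functions are all absorbed by
  x^epsilon.\<close>

definition expi :: "real \<Rightarrow> complex" where "expi t = cis (2 * pi * t)"

lemma norm_expi [simp]: "norm (expi t) = 1"
  by (simp add: expi_def)

lemma expi_add: "expi (s + t) = expi s * expi t"
  by (simp add: expi_def cis_mult ring_distribs)

lemma expi_minus: "expi (- t) = cnj (expi t)"
  by (simp add: expi_def cis_cnj)

lemma expi_diff: "expi (s - t) = expi s * cnj (expi t)"
  using expi_add[of s "-t"] by (simp add: expi_minus)

lemma expi_add_int: "expi (t + of_int k) = expi t"
  using cis_multiple_2pi[of "of_int k"] by (simp add: expi_add) (simp add: expi_def)

lemma sin_pi_ge:
  assumes "0 \<le> t" "t \<le> 1/2"
  shows "2 * t \<le> sin (pi * t)"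
proof -
  have "concave_on {0..pi/2} sin"
    by (rule f''_le0_imp_concave[where f' = cos and f'' = "\<lambda>x. - sin x"])
       (auto intro!: derivative_eq_intros sin_ge_zero)
  from concave_onD[OF this, of "2 * t" 0 "pi/2"] show ?thesis
    using assms by (simp add: mult_ac)
qed

lemma expi_double_angle: "expi t = Complex (1 - 2 * (sin (pi * t))^2) (2 * sin (pi * t) * cos (pi * t))"
  using cos_double_sin[of "pi * t"] sin_double[of "pi * t"]
  by (simp add: expi_def complex_eq_iff mult_ac)

text \<open>The point is that the real part is constant, so that only a cotangent, which is
  monotone, varies in the Kusmin-Landau argument.\<close>

lemma inverse_one_minus_expi:
  assumes "0 < t" "t < 1"
  shows "1 / (1 - expi t) = Complex (1/2) (cot (pi * t) / 2)"
proof -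
  have s: "sin (pi * t) > 0"
    using assms by (intro sin_gt_zero) auto
  have ss: "sin (pi * t) * sin (pi * t) = 1 - cos (pi * t) * cos (pi * t)"
    using sin_cos_squared_add3[of "pi * t"] by linarith
  have "(1 - expi t) * Complex (1/2) (cot (pi * t) / 2) = 1"
    unfolding expi_double_angle using s
    by (simp add: complex_eq_iff cot_def field_simps power2_eq_square; use ss in linarith)
  moreover from this have "1 - expi t \<noteq> 0" by auto
  ultimately show ?thesis by (simp add: field_simps)
qed

text \<open>Each term is \<open>expi (f n) = (expi (f n) - expi (f (Suc n))) * w n\<close> with w n
  = 1/(1 - e(d n)). Abel summation leaves the total variation of \<open>w\<close>. Its real part is
  1/2 and its imaginary part decreases because the differences \<open>d n\<close> increase, so the
  variation telescopes.\<close>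

lemma kusmin_landau:
  fixes f :: "nat \<Rightarrow> real" and \<theta> :: real and k :: int
  defines "d \<equiv> \<lambda>n. f (Suc n) - f n"
  assumes \<theta>: "0 < \<theta>" "\<theta> \<le> 1/2"
    and mono: "\<And>n. Suc n < N \<Longrightarrow> d n \<le> d (Suc n)"
    and bounds: "\<And>n. n < N \<Longrightarrow> of_int k + \<theta> \<le> d n \<and> d n \<le> of_int k + 1 - \<theta>"
  shows "norm (\<Sum>n<N. expi (f n)) \<le> 1 / \<theta>"
proof (cases "N = 0")
  case True
  then show ?thesis using \<theta> by simp
next
  case False
  define u where "u n = d n - of_int k" for n
  define c where "c n = cot (pi * u n) / 2" for n
  define w where "w n = Complex (1/2) (c n)" for n
  let ?V = "\<lambda>b. (\<Sum>n<Suc b. expi (f n)) + expi (f (Suc b)) * w b"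
  have u: "\<theta> \<le> u n" "u n \<le> 1 - \<theta>" if "n < N" for n
    using bounds[OF that] by (simp_all add: u_def)
  have s: "sin (pi * u n) \<ge> 2 * \<theta>" if "n < N" for n
  proof (cases "u n \<le> 1/2")
    case True
    then show ?thesis using sin_pi_ge[of "u n"] u[OF that] \<theta> by auto
  next
    case False
    have "sin (pi * u n) = sin (pi * (1 - u n))"
      by (simp add: right_diff_distrib sin_diff)
    then show ?thesis using sin_pi_ge[of "1 - u n"] u[OF that] \<theta> False by auto
  qed
  have w: "expi (f n) = (expi (f n) - expi (f (Suc n))) * w n" if "n < N" for n
  proof -
    have "expi (d n) = expi (u n)"
      using expi_add_int[of "u n" k] by (simp add: u_def)
    then have "expi (f (Suc n)) = expi (f n) * expi (u n)"
      using expi_add[of "f n" "d n"] by (simp add: d_def)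
    then have "(expi (f n) - expi (f (Suc n))) * w n = expi (f n) * ((1 - expi (u n)) * w n)"
      by (simp add: algebra_simps)
    moreover have "(1 - expi (u n)) * w n = 1"
    proof -
      have "w n = 1 / (1 - expi (u n))"
        using inverse_one_minus_expi[of "u n"] u[OF that] \<theta> by (simp add: w_def c_def)
      moreover have "w n \<noteq> 0" by (simp add: w_def complex_eq_iff)
      ultimately show ?thesis by auto
    qed
    ultimately show ?thesis by simp
  qed
  have c_mono: "c (Suc n) \<le> c n" if "Suc n < N" for n
  proof -
    have s0: "sin (pi * u n) > 0" "sin (pi * u (Suc n)) > 0"
      using s[of n] s[of "Suc n"] that \<theta> by auto
    have "u n \<le> u (Suc n)" "0 < u n" "u (Suc n) < 1"
      using mono[OF that] u[of n] u[of "Suc n"] that \<theta> by (auto simp: u_def)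
    then have "sin (pi * u (Suc n) - pi * u n) \<ge> 0"
      by (intro sin_ge_zero) (auto simp: right_diff_distrib [symmetric])
    then have "cot (pi * u (Suc n)) \<le> cot (pi * u n)"
      using s0 by (simp add: cot_def field_simps sin_diff)
    then show ?thesis by (simp add: c_def)
  qed
  have w_norm: "norm (w n) \<le> 1 / (4 * \<theta>)" if "n < N" for n
  proof -
    have "(norm (w n))^2 = 1/4 + (cot (pi * u n))^2 / 4"
      by (simp add: w_def cmod_def c_def power_divide)
    also have "... = (1 / (2 * sin (pi * u n)))^2"
      using s[OF that] \<theta> sin_cos_squared_add[of "pi * u n"] by (simp add: cot_def field_simps power2_eq_square)
    finally have "norm (w n) = 1 / (2 * sin (pi * u n))"
      using s[OF that] \<theta> by (subst (asm) power2_eq_iff_nonneg) auto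
    also have "... \<le> 1 / (2 * (2 * \<theta>))"
      using s[OF that] \<theta> by (intro divide_left_mono mult_left_mono mult_pos_pos) auto
    finally show ?thesis by simp
  qed
  have c_abs: "\<bar>c n\<bar> \<le> 1 / (4 * \<theta>)" if "n < N" for n
    using w_norm[OF that] abs_Im_le_cmod[of "w n"] by (simp add: w_def)
  \<comment> \<open>Induction over the partial sums completed by their boundary term: each step adds
    \<open>norm (w (Suc b) - w b)\<close>, which is exactly \<open>c b - c (Suc b)\<close>.\<close>
  have main: "norm (?V b) \<le> norm (w 0) + (c 0 - c b)"
    if "b < N" for b
    using that
  proof (induction b)
    case 0
    have "expi (f 0) + expi (f (Suc 0)) * w 0 = expi (f 0) * w 0"
      using w[OF 0] by (simp add: algebra_simps)
    then show ?case by (simp add: norm_mult)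
  next
    case (Suc b)
    have "(\<Sum>n<Suc (Suc b). expi (f n)) + expi (f (Suc (Suc b))) * w (Suc b) =
        (?V b) + expi (f (Suc b)) * (w (Suc b) - w b)"
      using w[OF Suc.prems] by (simp add: algebra_simps)
    also have "norm ... \<le> norm (?V b) + norm (w (Suc b) - w b)"
      by (rule order.trans[OF norm_triangle_ineq]) (simp add: norm_mult)
    also have "norm (w (Suc b) - w b) = c b - c (Suc b)"
      using c_mono[OF Suc.prems] by (simp add: w_def cmod_def)
    finally show ?case using Suc by simp
  qed
  obtain b where b: "N = Suc b" using False by (cases N) auto
  have "norm (\<Sum>n<N. expi (f n)) =
      norm ((?V b) - expi (f (Suc b)) * w b)"
    by (simp add: b)
  also have "... \<le> norm (?V b) + norm (w b)"
    by (rule order.trans[OF norm_triangle_ineq4]) (simp add: norm_mult)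
  also have "... \<le> norm (w 0) + (c 0 - c b) + norm (w b)"
    using main[of b] b by simp
  \<comment> \<open>Each of \<open>norm (w 0)\<close>, \<open>c 0\<close>, \<open>- c b\<close> and
    \<open>norm (w b)\<close> is at most 1/(4 theta).\<close>
  also have "... \<le> 4 * (1 / (4 * \<theta>))"
    using w_norm[of 0] w_norm[of b] c_abs[of 0] c_abs[of b] b by (simp add: abs_if split: if_splits)
  finally show ?thesis by simp
qed

lemma convex_nat_set_eq_interval:
  fixes G :: "nat set"
  assumes "finite G" "G \<noteq> {}"
    and convex: "\<And>i j k. i \<in> G \<Longrightarrow> k \<in> G \<Longrightarrow> i \<le> j \<Longrightarrow> j \<le> k \<Longrightarrow> j \<in> G"
  shows "G = {Min G..<Suc (Max G)}"
proof
  show "G \<subseteq> {Min G..<Suc (Max G)}"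
    using assms(1) by (auto simp: less_Suc_eq_le)
  show "{Min G..<Suc (Max G)} \<subseteq> G"
    using convex[OF Min_in[OF assms(1,2)] Max_in[OF assms(1,2)]] by (auto simp: less_Suc_eq_le)
qed

text \<open>Counts the indices whose first difference lies in a short window, given that first
  differences grow at rate at least \<open>lam\<close>.\<close>

lemma card_le_of_spread:
  fixes G :: "nat set" and d :: "nat \<Rightarrow> real"
  assumes "finite G" "lam > 0" "w \<ge> 0"
    and spread: "\<And>i j. i \<in> G \<Longrightarrow> j \<in> G \<Longrightarrow> i \<le> j \<Longrightarrow> lam * real (j - i) \<le> w"
  shows "real (card G) \<le> w / lam + 1"
proof (cases "G = {}")
  case True
  then show ?thesis using assms by simp
next
  case False
  have "card G \<le> card {Min G..Max G}"
    using assms(1) by (intro card_mono) auto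
  then have "card G \<le> Max G - Min G + 1" by simp
  then have "real (card G) \<le> real (Max G - Min G) + 1" by linarith
  moreover have "lam * real (Max G - Min G) \<le> w"
    using assms(1) False by (intro spread) auto
  ultimately have "lam * (real (card G) - 1) \<le> w"
    using assms(2) by (smt (verit) mult_left_mono)
  then show ?thesis using assms(2) by (simp add: field_simps)
qed

text \<open>
  The indices are grouped by the integer part of the first difference plus \<open>\<surd>\<lambda>\<close>: on the part of a
  group that stays \<open>\<surd>\<lambda>\<close> away from integers the Kusmin--Landau bound applies,
  and the rest of the group has \<open>O(1/\<surd>\<lambda>)\<close> elements.
\<close>

lemma van_der_corput_aux:
  fixes f :: "nat \<Rightarrow> real"
  assumes lam: "lam > 0" and C: "C \<ge> 1"
    and f: "\<And>n. n < N \<Longrightarrow> lam \<le> f (n + 2) - 2 * f (n + 1) + f n \<and> f (n + 2) - 2 * f (n + 1) + f n \<le> C * lam"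
  shows "norm (\<Sum>n<N. expi (f n)) \<le> 4 * C * real N * sqrt lam + 12 / sqrt lam"
\<comment> \<open>For \<open>lam >= 1/4\<close> the first term of the bound exceeds the trivial
  bound N. Otherwise \<open>sqrt lam < 1/2\<close>, as the Kusmin-Landau bound requires.\<close>
proof (cases "lam \<ge> 1/4 \<or> N = 0")
  case True
  have "norm (\<Sum>n<N. expi (f n)) \<le> (\<Sum>n<N. 1)" by (rule sum_norm_le) simp
  also have "... \<le> 4 * C * real N * sqrt lam"
  proof (cases "N = 0")
    case False
    then have "sqrt (1/4) \<le> sqrt lam" using True by (intro real_sqrt_le_mono) simp
    then have "1 * 1 \<le> C * (4 * sqrt lam)" using C by (intro mult_mono) (auto simp: real_sqrt_divide)
    then have "1 * real N \<le> C * (4 * sqrt lam) * real N" by (intro mult_right_mono) auto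
    then show ?thesis by (simp add: mult_ac)
  qed simp
  also have "... \<le> 4 * C * real N * sqrt lam + 12 / sqrt lam" using lam by simp
  finally show ?thesis .
next
  case False
  define \<theta> where "\<theta> = sqrt lam"
  have \<theta>2: "\<theta> * \<theta> = lam" using lam by (simp add: \<theta>_def)
  have \<theta>: "0 < \<theta>" "\<theta> < 1/2"
  proof -
    show "0 < \<theta>" using lam by (simp add: \<theta>_def)
    have "sqrt lam < sqrt (1/4)" using False by (intro real_sqrt_less_mono) auto
    then show "\<theta> < 1/2" by (simp add: real_sqrt_divide \<theta>_def)
  qed
  define d where "d n = f (Suc n) - f n" for n
  have d: "lam \<le> d (Suc n) - d n" "d (Suc n) - d n \<le> C * lam" if "n < N" for n
    using f[OF that] by (simp_all add: d_def)
  have dlow: "d i + lam * real (j - i) \<le> d j" if "i \<le> j" "j \<le> N" for i j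
    using that
  proof (induction j rule: dec_induct)
    case (step j)
    then show ?case using d[of j] by (simp add: Suc_diff_le algebra_simps)
  qed simp
  have dmono: "d i \<le> d j" if "i \<le> j" "j \<le> N" for i j
    using dlow[OF that] lam by (smt (verit) mult_nonneg_nonneg of_nat_0_le_iff)
  have dup: "d j \<le> d 0 + C * lam * real j" if "j \<le> N" for j
    using that
  proof (induction j)
    case (Suc j)
    then show ?case using d[of j] by (simp add: algebra_simps)
  qed simp
  \<comment> \<open>The shift by theta puts the whole dangerous window [k - theta, k + theta) around
    the integer k into the group of k, at its beginning. The remainder of the group is then at
    distance at least theta from both k and k + 1.\<close>
  define \<kappa> where "\<kappa> n = \<lfloor>d n + \<theta>\<rfloor>" for n
  define K where "K = \<kappa> ` {..<N}"
  have "card K \<le> card {\<lfloor>d 0 + \<theta>\<rfloor>..\<lfloor>d 0 + \<theta> + C * lam * real N\<rfloor>}"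
  proof (rule card_mono)
    show "K \<subseteq> {\<lfloor>d 0 + \<theta>\<rfloor>..\<lfloor>d 0 + \<theta> + C * lam * real N\<rfloor>}"
    proof
      fix k assume "k \<in> K"
      then obtain n where n: "k = \<kappa> n" "n \<in> {..<N}" by (auto simp: K_def)
      have "C * lam * real n \<le> C * lam * real N"
        using n C lam by (intro mult_left_mono) auto
      then show "k \<in> {\<lfloor>d 0 + \<theta>\<rfloor>..\<lfloor>d 0 + \<theta> + C * lam * real N\<rfloor>}"
        using n dmono[of 0 n] dup[of n] by (auto simp: \<kappa>_def intro!: floor_mono)
    qed
  qed simp
  then have "real (card K) \<le> real (nat (\<lfloor>d 0 + \<theta> + C * lam * real N\<rfloor> - \<lfloor>d 0 + \<theta>\<rfloor> + 1))"
    by simp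
  also have "... \<le> C * lam * real N + 2"
  proof -
    have "0 \<le> C * lam * real N" using C lam by simp
    then have "\<lfloor>d 0 + \<theta>\<rfloor> \<le> \<lfloor>d 0 + \<theta> + C * lam * real N\<rfloor>" by (intro floor_mono) auto
    then show ?thesis by (simp add: of_nat_nat) linarith
  qed
  finally have cardK: "real (card K) \<le> C * lam * real N + 2" .
  have block: "norm (\<Sum>n | n < N \<and> \<kappa> n = k. expi (f n)) \<le> 4 / \<theta>" for k
  proof -
    define G where "G = {n. n < N \<and> \<kappa> n = k \<and> d n \<le> of_int k + 1 - \<theta> \<and> of_int k + \<theta> \<le> d n}"
    define B where "B = {n. n < N \<and> \<kappa> n = k \<and> d n < of_int k + \<theta>}"
    have \<kappa>D: "of_int k - \<theta> \<le> d n" "d n < of_int k + 1 - \<theta>" if "\<kappa> n = k" for n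
      using that by (simp_all add: \<kappa>_def floor_eq_iff)
    have fin: "finite G" "finite B" by (simp_all add: G_def B_def)
    have eq: "{n. n < N \<and> \<kappa> n = k} = G \<union> B"
      using \<kappa>D by (auto simp: G_def B_def less_imp_le)
    have disj: "G \<inter> B = {}" by (auto simp: G_def B_def)
    have sumB: "norm (\<Sum>n\<in>B. expi (f n)) \<le> 2 * \<theta> / lam + 1"
    proof -
      have "norm (\<Sum>n\<in>B. expi (f n)) \<le> (\<Sum>n\<in>B. 1)"
        by (rule order.trans[OF norm_sum]) simp
      also have "... = real (card B)" by simp
      also have "... \<le> 2 * \<theta> / lam + 1"
      proof (rule card_le_of_spread)
        fix i j assume "i \<in> B" "j \<in> B" "i \<le> j"
        then show "lam * real (j - i) \<le> 2 * \<theta>"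
          using dlow[of i j] \<kappa>D(1)[of i] by (auto simp: B_def)
      qed (use fin lam \<theta> in auto)
      finally show ?thesis .
    qed
    have sumG: "norm (\<Sum>n\<in>G. expi (f n)) \<le> 1 / \<theta>"
    proof (cases "G = {}")
      case True
      then show ?thesis using \<theta> by simp
    next
      case False
      define a where "a = Min G"
      define b where "b = Suc (Max G) - a"
      have GG: "G = {Min G..<Suc (Max G)}"
      proof (rule convex_nat_set_eq_interval[OF fin(1) False])
        fix i j l assume ijl: "i \<in> G" "l \<in> G" "i \<le> j" "j \<le> l"
        then have "d i \<le> d j" "d j \<le> d l" using dmono[of i j] dmono[of j l] by (auto simp: G_def)
        then show "j \<in> G" using ijl \<theta> by (auto simp: G_def \<kappa>_def floor_eq_iff)
      qed
      have le: "Min G \<le> Max G" using fin False by simp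
      have G: "G = {a..<a + b}" using GG le by (simp add: a_def b_def)
      have "(\<Sum>n\<in>G. expi (f n)) = (\<Sum>n<b. expi (f (n + a)))"
        using sum.shift_bounds_nat_ivl[of "\<lambda>n. expi (f n)" 0 a b] by (simp add: G add.commute lessThan_atLeast0)
      also have "norm ... \<le> 1 / \<theta>"
      proof (rule kusmin_landau)
        fix n assume "Suc n < b"
        then have "a + Suc n \<in> G" by (simp add: G)
        then have "a + Suc n < N" by (simp add: G_def)
        then show "f (Suc n + a) - f (n + a) \<le> f (Suc (Suc n) + a) - f (Suc n + a)"
          using dmono[of "n + a" "Suc n + a"] by (simp add: d_def add.commute)
      next
        fix n assume "n < b"
        then have "n + a \<in> G" by (simp add: G)
        then show "of_int k + \<theta> \<le> f (Suc n + a) - f (n + a) \<and> f (Suc n + a) - f (n + a) \<le> of_int k + 1 - \<theta>"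
          by (simp add: G_def d_def)
      qed (use \<theta> in auto)
      finally show ?thesis .
    qed
    have "norm (\<Sum>n | n < N \<and> \<kappa> n = k. expi (f n)) \<le> norm (\<Sum>n\<in>G. expi (f n)) + norm (\<Sum>n\<in>B. expi (f n))"
      unfolding eq by (subst sum.union_disjoint) (use fin disj norm_triangle_ineq in auto)
    also have "... \<le> 1 / \<theta> + (2 * \<theta> / lam + 1)"
      using sumG sumB by (rule add_mono)
    also have "... \<le> 4 / \<theta>"
    proof -
      have "2 * \<theta> / lam = 2 / \<theta>" using \<theta> by (simp add: \<theta>2 [symmetric])
      moreover have "1 \<le> 1 / \<theta>" using \<theta> by simp
      ultimately show ?thesis by simp
    qed
    finally show ?thesis .
  qed
  have "(\<Sum>n<N. expi (f n)) = (\<Sum>k\<in>K. \<Sum>n | n \<in> {..<N} \<and> \<kappa> n = k. expi (f n))"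
    by (rule sum.group [symmetric]) (auto simp: K_def)
  also have "norm ... \<le> (\<Sum>k\<in>K. 4 / \<theta>)"
    by (rule sum_norm_le) (use block in simp)
  also have "... = real (card K) * (4 / \<theta>)" by simp
  also have "... \<le> (C * lam * real N + 2) * (4 / \<theta>)"
    using cardK \<theta> by (intro mult_right_mono) auto
  also have "... = 4 * C * real N * \<theta> + 8 / \<theta>"
    using \<theta> by (simp add: \<theta>2 [symmetric] field_simps)
  also have "... \<le> 4 * C * real N * \<theta> + 12 / \<theta>"
    using \<theta> by (intro add_left_mono divide_right_mono) auto
  finally show ?thesis by (simp add: \<theta>_def)
qed

text \<open>A phase with negative second differences reduces to the positive case by complex
  conjugation, which preserves the norm.\<close>

lemma van_der_corput:
  fixes f :: "nat \<Rightarrow> real"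
  assumes lam: "lam > 0" and C: "C \<ge> 1" and s: "s = 1 \<or> s = -1"
    and f: "\<And>n. a \<le> n \<Longrightarrow> n < b \<Longrightarrow>
      lam \<le> s * (f (n + 2) - 2 * f (n + 1) + f n) \<and> s * (f (n + 2) - 2 * f (n + 1) + f n) \<le> C * lam"
  shows "norm (\<Sum>n\<in>{a..<b}. expi (f n)) \<le> 4 * C * real (b - a) * sqrt lam + 12 / sqrt lam"
proof (cases "a \<le> b")
  case True
  have *: "(\<Sum>n\<in>{a..<b}. expi (f n)) = (\<Sum>n<b-a. expi (f (n + a)))"
    using sum.shift_bounds_nat_ivl[of "\<lambda>n. expi (f n)" 0 a "b - a"] True
    by (simp add: lessThan_atLeast0)
  have "norm (\<Sum>n\<in>{a..<b}. expi (f n)) = norm (\<Sum>n<b-a. expi (s * f (n + a)))"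
  proof (cases "s = 1")
    case False
    then have "(\<Sum>n<b-a. expi (s * f (n + a))) = cnj (\<Sum>n\<in>{a..<b}. expi (f n))"
      using s by (simp add: * expi_minus)
    then show ?thesis by (simp only: complex_mod_cnj)
  qed (simp add: *)
  also have "... \<le> 4 * C * real (b - a) * sqrt lam + 12 / sqrt lam"
  proof (rule van_der_corput_aux[OF lam C])
    fix n assume "n < b - a"
    then show "lam \<le> s * f (n + 2 + a) - 2 * (s * f (n + 1 + a)) + s * f (n + a) \<and>
         s * f (n + 2 + a) - 2 * (s * f (n + 1 + a)) + s * f (n + a) \<le> C * lam"
      using f[of "n + a"] by (simp add: algebra_simps)
  qed
  finally show ?thesis .
next
  case False
  then show ?thesis using lam by simp
qed

section \<open>Fourier expansion of the sawtooth function\<close>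

text \<open>The term \<open>n = 0\<close> vanishes because 1/0 = 0, so on the closed unit disc this
  is the classical dilogarithm Li_2.\<close>

definition dilog :: "complex \<Rightarrow> complex" where
  "dilog z = (\<Sum>n. (1 / of_nat n ^ 2) * z ^ n)"

lemma summable_inverse_squares: "summable (\<lambda>n. 1 / real n ^ 2)"
  using inverse_power_summable[of 2, where 'a = real] by (simp add: inverse_eq_divide)

lemma summable_dilog: "norm z \<le> 1 \<Longrightarrow> summable (\<lambda>n. (1 / of_nat n ^ 2) * z ^ n :: complex)"
  by (rule summable_comparison_test'[OF summable_inverse_squares])
     (auto simp: norm_mult norm_power norm_divide intro!: divide_right_mono power_le_one)

text \<open>Continuity up to the boundary carries identities from the interior, where termwise
  differentiation is available, to the unit circle.\<close>

lemma continuous_on_dilog: "continuous_on (cball 0 1) dilog"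
proof -
  have "uniform_limit (cball 0 1) (\<lambda>N z. \<Sum>n<N. (1 / of_nat n ^ 2) * z ^ n :: complex) dilog sequentially"
    unfolding dilog_def
    by (rule Weierstrass_m_test[OF _ summable_inverse_squares])
       (auto simp: norm_mult norm_power norm_divide intro!: divide_right_mono power_le_one)
  moreover have "continuous_on (cball 0 1) (\<lambda>z. \<Sum>n<N. (1 / of_nat n ^ 2) * z ^ n :: complex)" for N
    by (intro continuous_on_sum continuous_on_mult continuous_on_const continuous_on_power continuous_on_id)
  ultimately show ?thesis
    by (intro uniform_limit_theorem[OF always_eventually]) auto
qed

text \<open>Termwise differentiation turns z Li_2'(z) into the logarithmic series. Keeping the
  factor z on the left makes the centre of the disc no exception.\<close>

lemma dilog_has_field_derivative:
  assumes "norm z < 1"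
  shows "\<exists>D. (dilog has_field_derivative D) (at z) \<and> z * D = - Ln (1 - z)"
proof -
  have "(dilog has_field_derivative (\<Sum>n. diffs (\<lambda>n. 1 / of_nat n ^ 2) n * z ^ n)) (at z)"
    unfolding dilog_def
    by (rule termdiffs_strong'[where K = 1]) (use assms summable_dilog in auto)
  moreover have "z * (\<Sum>n. diffs (\<lambda>n. 1 / of_nat n ^ 2) n * z ^ n) = - Ln (1 - z)"
  proof -
    have d: "diffs (\<lambda>n. 1 / of_nat n ^ 2 :: complex) n = 1 / of_nat (Suc n)" for n
      by (simp add: diffs_def power2_eq_square del: of_nat_Suc)
    have "(\<lambda>n. - ((- (- z)) ^ n) / of_nat n) sums ln (1 + - z)"
      using assms by (intro Ln_series') auto
    then have "(\<lambda>n. z ^ n / of_nat n) sums - ln (1 - z)"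
      using sums_minus by fastforce
    then have *: "(\<lambda>n. z * (z ^ n / of_nat (Suc n))) sums - ln (1 - z)"
      using sums_Suc_iff[of "\<lambda>n. z ^ n / of_nat n" "- ln (1 - z)"] by simp
    have "summable (\<lambda>n. z ^ n / of_nat (Suc n))"
      by (rule summable_comparison_test'[of "\<lambda>n. norm z ^ n"])
         (use assms in \<open>auto simp: norm_divide norm_power divide_simps mult_le_cancel_left1
            intro!: summable_geometric simp del: of_nat_Suc\<close>)
    from suminf_mult[OF this, of z] sums_unique[OF *] show ?thesis
      by (simp add: d)
  qed
  ultimately show ?thesis by blast
qed

lemma one_minus_expi_polar: "1 - expi u = of_real (2 * sin (pi * u)) * exp (\<i> * of_real (pi * (u - 1/2)))"
proof -
  have "cos (pi * (u - 1/2)) = sin (pi * u)" "sin (pi * (u - 1/2)) = - cos (pi * u)"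
    by (simp_all add: right_diff_distrib cos_diff sin_diff)
  then show ?thesis
    unfolding expi_double_angle by (simp add: complex_eq_iff Re_exp Im_exp power2_eq_square)
qed

lemma Im_Ln_one_minus_expi:
  assumes "0 < u" "u < 1"
  shows "Im (Ln (1 - expi u)) = pi * (u - 1/2)"
proof -
  have s: "sin (pi * u) > 0"
    using assms by (intro sin_gt_zero) auto
  have "Arg (1 - expi u) = pi * (u - 1/2)"
  proof (rule Arg_unique)
    show "of_real (2 * sin (pi * u)) * exp (\<i> * of_real (pi * (u - 1/2))) = 1 - expi u"
      by (rule one_minus_expi_polar [symmetric])
    have "pi * (-1/2) < pi * (u - 1/2)" "pi * (u - 1/2) < pi * (1/2)"
      using assms by (intro mult_strict_left_mono; simp)+
    then show "- pi < pi * (u - 1/2)" "pi * (u - 1/2) \<le> pi"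
      using pi_gt_zero by linarith+
  qed (use s in simp)
  moreover have "1 - expi u \<noteq> 0"
    using s unfolding one_minus_expi_polar by simp
  ultimately show ?thesis by (simp add: Arg_eq_Im_Ln)
qed

lemma expi_eq_exp: "expi u = exp (of_real u * (2 * of_real pi * \<i>))"
  by (simp add: expi_def cis_conv_exp mult_ac)

lemma continuous_on_expi [continuous_intros]: "continuous_on A f \<Longrightarrow> continuous_on A (\<lambda>x. expi (f x))"
  unfolding expi_eq_exp by (intro continuous_intros)

lemma DERIV_Re_dilog_circle:
  assumes "0 \<le> r" "r < 1"
  shows "((\<lambda>u. Re (dilog (of_real r * expi u))) has_real_derivative
            2 * pi * Im (Ln (1 - of_real r * expi u))) (at u)"
proof -
  let ?c = "2 * of_real pi * \<i>"
  define z where "z = of_real r * expi u"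
  have "norm z < 1" using assms by (simp add: z_def norm_mult)
  then obtain D where D: "(dilog has_field_derivative D) (at z)" "z * D = - Ln (1 - z)"
    using dilog_has_field_derivative by blast
  define g where "g w = of_real r * exp (w * ?c)" for w
  have g: "g (of_real v) = of_real r * expi v" for v by (simp add: g_def expi_eq_exp)
  have "(g has_field_derivative z * ?c) (at (of_real u))"
    unfolding g_def z_def expi_eq_exp by (auto intro!: derivative_eq_intros)
  moreover have "(dilog has_field_derivative D) (at (g (of_real u)))"
    using D(1) by (simp add: g z_def)
  ultimately have "((\<lambda>w. dilog (g w)) has_field_derivative D * (z * ?c)) (at (of_real u))"
    by (rule DERIV_chain2[rotated])
  then have "((\<lambda>v. dilog (g (of_real v))) has_vector_derivative D * (z * ?c)) (at u)"
    by (rule has_vector_derivative_real_field)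
  then have "((\<lambda>v. Re (dilog (g (of_real v)))) has_field_derivative Re (D * (z * ?c))) (at u)"
    by (rule has_field_derivative_Re)
  moreover have "D * (z * ?c) = - Ln (1 - z) * ?c"
    unfolding D(2) [symmetric] by (simp only: mult_ac)
  ultimately have "((\<lambda>v. Re (dilog (of_real r * expi v))) has_field_derivative
      Re (- Ln (1 - z) * ?c)) (at u)"
    by (simp only: g)
  moreover have "Re (- Ln (1 - z) * ?c) = 2 * pi * Im (Ln (1 - z))"
    by simp
  ultimately show ?thesis by (simp only: z_def)
qed

text \<open>
  Inside the unit disc the derivative along the circle of radius \<open>r\<close> is the argument of
  \<open>1 - r e(u)\<close>, which converges to \<open>\<pi> (u - 1/2)\<close> uniformly on compact subintervals as \<open>r\<close> tends to 1.
\<close>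

lemma Re_dilog_circle_diff:
  assumes "0 < s" "s < t" "t < 1"
  shows "Re (dilog (expi t)) - Re (dilog (expi s)) = pi^2 * ((t^2 - t) - (s^2 - s))"
proof -
  define F where "F = (\<lambda>(r, u). Im (Ln (1 - of_real r * expi u)))"
  define K where "K = {0..1::real} \<times> {s..t}"
  \<comment> \<open>The argument of \<open>Ln\<close> avoids the branch cut even for r = 1, because
    u stays away from the integers. Hence \<open>F\<close> is continuous on a compact set that
    includes the boundary r = 1.\<close>
  have nonneg: "1 - of_real r * expi u \<notin> \<real>\<^sub>\<le>\<^sub>0" if "(r, u) \<in> K" for r u
  proof
    assume "1 - of_real r * expi u \<in> \<real>\<^sub>\<le>\<^sub>0"
    then have *: "r * cos (2 * pi * u) \<ge> 1"
      by (auto simp: complex_nonpos_Reals_iff expi_def)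
    have "cos (2 * pi * u) = 1 - 2 * (sin (pi * u))^2"
      using cos_double_sin[of "pi * u"] by (simp add: mult_ac)
    moreover have "sin (pi * u) > 0"
      using assms that by (intro sin_gt_zero) (auto simp: K_def)
    ultimately have "cos (2 * pi * u) < 1" by simp
    moreover have "0 \<le> r" "r \<le> 1" using that by (auto simp: K_def)
    ultimately have "r * cos (2 * pi * u) < 1"
    proof (cases "r = 1")
      case False
      then have "r < 1" using \<open>r \<le> 1\<close> by simp
      moreover have "r * cos (2 * pi * u) \<le> r * 1"
        using \<open>0 \<le> r\<close> by (intro mult_left_mono) auto
      ultimately show ?thesis by simp
    qed (use \<open>cos (2 * pi * u) < 1\<close> in simp)
    with * show False by simp
  qed
  have "continuous_on K F"
    unfolding F_def case_prod_unfold
    by (intro continuous_intros) (use nonneg in auto)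
  moreover have "compact K" unfolding K_def by (intro compact_Times) auto
  ultimately have uc: "uniformly_continuous_on K F"
    by (rule compact_uniformly_continuous)
  define c where "c = pi^2 * ((t^2 - t) - (s^2 - s))"
  \<comment> \<open>\<open>g r\<close> is the defect of the claimed identity on the circle of radius
    r. It is continuous up to r = 1 and is shown to tend to 0 there.\<close>
  define g where "g r = Re (dilog (of_real r * expi t)) - Re (dilog (of_real r * expi s)) - c" for r
  have "continuous_on {0..1} g"
    unfolding g_def
    by (intro continuous_intros continuous_on_compose2[OF continuous_on_dilog])
       (auto simp: norm_mult)
  then have "(g \<longlongrightarrow> g 1) (at 1 within {0..1})"
    by (simp add: continuous_on_def)
  then have lim1: "(g \<longlongrightarrow> g 1) (at_left 1)"
    by (simp add: at_within_Icc_at_left)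
  have lim0: "(g \<longlongrightarrow> 0) (at_left 1)"
  proof (rule tendstoI)
    fix e :: real assume e: "e > 0"
    define e' where "e' = e / (4 * pi * (t - s))"
    have e': "e' > 0" using e assms by (simp add: e'_def)
    from uc e' obtain d where d: "d > 0"
      "\<And>p q. p \<in> K \<Longrightarrow> q \<in> K \<Longrightarrow> dist q p < d \<Longrightarrow> dist (F q) (F p) < e'"
      unfolding uniformly_continuous_on_def by metis
    have ev: "eventually (\<lambda>r::real. r \<in> {max 0 (1 - d)<..<1}) (at_left 1)"
      by (rule eventually_at_left_real) (use d in auto)
    show "eventually (\<lambda>r. dist (g r) 0 < e) (at_left 1)"
      using ev
    proof eventually_elim
      case (elim r)
      then have r: "0 \<le> r" "r < 1" "1 - r < d" by auto
      define h where "h u = Re (dilog (of_real r * expi u)) - pi^2 * (u^2 - u)" for u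
      \<comment> \<open>The mean value theorem reduces \<open>g r\<close> to the distance between
        the derivative at radius r and its limit at a single point z, which uniform continuity of
        \<open>F\<close> controls.\<close>
      have "\<exists>z>s. z < t \<and> h t - h s = (t - s) * (2 * pi * Im (Ln (1 - of_real r * expi z)) - pi^2 * (2 * z - 1))"
      proof (rule MVT2[OF assms(2)])
        fix u
        have "((\<lambda>u. pi^2 * (u^2 - u)) has_real_derivative pi^2 * (2 * u - 1)) (at u)"
          by (auto intro!: derivative_eq_intros)
        then show "(h has_real_derivative 2 * pi * Im (Ln (1 - of_real r * expi u)) - pi^2 * (2 * u - 1)) (at u)"
          unfolding h_def by (intro DERIV_diff DERIV_Re_dilog_circle r(1,2))
      qed
      then obtain z where z: "s < z" "z < t"
        "h t - h s = (t - s) * (2 * pi * Im (Ln (1 - of_real r * expi z)) - pi^2 * (2 * z - 1))"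
        by blast
      have "dist (F (r, z)) (F (1, z)) < e'"
        by (rule d) (use r z in \<open>auto simp: K_def dist_Pair_Pair dist_real_def\<close>)
      then have "\<bar>Im (Ln (1 - of_real r * expi z)) - pi * (z - 1/2)\<bar> < e'"
        using Im_Ln_one_minus_expi[of z] z assms by (simp add: F_def dist_real_def)
      moreover have "g r = 2 * pi * (t - s) * (Im (Ln (1 - of_real r * expi z)) - pi * (z - 1/2))"
        using z(3) by (simp add: g_def h_def c_def algebra_simps power2_eq_square)
      ultimately have "\<bar>g r\<bar> \<le> 2 * pi * (t - s) * e'"
        using assms by (simp add: abs_mult mult_left_mono)
      also have "... = e / 2" using assms by (simp add: e'_def field_simps)
      also have "... < e" using e by simp
      finally show ?case by simp
    qed
  qed
  have "g 1 = 0"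
    by (rule tendsto_unique[OF _ lim1 lim0]) simp
  then show ?thesis by (simp add: g_def c_def)
qed

text \<open>The difference of both sides is constant on the open interval, continuity extends this
  to the end points, and t = 0 fixes the constant. The value of Li_2(1) is never computed.\<close>

lemma Re_dilog_circle:
  assumes "0 \<le> t" "t \<le> 1"
  shows "Re (dilog (expi t)) = pi^2 * (t^2 - t) + Re (dilog 1)"
proof -
  define h where "h u = Re (dilog (expi u)) - pi^2 * (u^2 - u)" for u
  have cont: "continuous_on (closure {0<..<1}) h"
    unfolding h_def by (intro continuous_intros continuous_on_compose2[OF continuous_on_dilog]) auto
  have const: "h u = h (1/2)" if "u \<in> {0<..<1}" for u
  proof (cases "u = 1/2")
    case False
    then show ?thesis
      using Re_dilog_circle_diff[of u "1/2"] Re_dilog_circle_diff[of "1/2" u] that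
      by (cases "u < 1/2") (auto simp: h_def algebra_simps)
  qed (rule arg_cong[of _ _ h])
  have "h u = h (1/2)" if "u \<in> {0..1}" for u
    by (rule continuous_constant_on_closure[OF cont const]) (use that in auto)
  from this[of t] this[of 0] assms have "h t = h 0" by auto
  then show ?thesis by (simp add: h_def expi_def)
qed

text \<open>\<open>(frac t)^2 - frac t\<close> is the periodic second Bernoulli polynomial without
  its constant term 1/6. Taking a difference cancels \<open>Re (dilog 1)\<close>.\<close>

lemma frac_square_diff_Fourier:
  "(\<lambda>n. Re (expi (real n * t) - expi (real n * s)) / real n ^ 2)
     sums (pi^2 * (((frac t)^2 - frac t) - ((frac s)^2 - frac s)))"
proof -
  have *: "(\<lambda>n. Re (expi (real n * t)) / real n ^ 2) sums (pi^2 * ((frac t)^2 - frac t) + Re (dilog 1))" for t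
  proof -
    have e: "expi t = expi (frac t)"
      using expi_add_int[of "frac t" "\<lfloor>t\<rfloor>"] by (simp add: frac_def)
    have pow: "expi t ^ n = expi (real n * t)" for n
      by (simp only: expi_def Complex.DeMoivre mult_ac)
    have "(\<lambda>n. (1 / of_nat n ^ 2) * expi t ^ n) sums dilog (expi t)"
      unfolding dilog_def by (intro summable_sums summable_dilog) simp
    then have "(\<lambda>n. Re ((1 / of_nat n ^ 2) * expi t ^ n)) sums Re (dilog (expi t))"
      by (rule sums_Re)
    moreover have "Re ((1 / of_nat n ^ 2) * expi t ^ n) = Re (expi (real n * t)) / real n ^ 2" for n
    proof -
      have "(1 / of_nat n ^ 2) * expi t ^ n = expi (real n * t) / of_real (real n ^ 2)"
        by (simp add: pow)
      then show ?thesis by (simp only: Re_divide_of_real)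
    qed
    ultimately have "(\<lambda>n. Re (expi (real n * t)) / real n ^ 2) sums Re (dilog (expi t))"
      by (simp only:)
    then show ?thesis
      using Re_dilog_circle[of "frac t"] by (simp add: e [symmetric] frac_ge_0 frac_lt_1 less_imp_le)
  qed
  show ?thesis
    using sums_diff[OF *[of t] *[of s]] by (simp add: diff_divide_distrib right_diff_distrib)
qed

definition saw :: "real \<Rightarrow> real" where "saw t = frac t - 1/2"

text \<open>The function \<open>(frac t)^2 - frac t\<close> has derivative 2 \<open>saw\<close>, so
  the quotient is the mean of \<open>saw\<close> over the interval from t - delta to t. As
  \<open>saw\<close> rises with slope 1 and jumps only downwards,
  \<open>saw t <= saw (t - s) + s\<close>, and averaging over s costs delta/2.\<close>

lemma saw_le:
  assumes "0 < \<delta>" "\<delta> \<le> 1"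
  shows "saw t \<le> (((frac t)^2 - frac t) - ((frac (t - \<delta>))^2 - frac (t - \<delta>))) / (2 * \<delta>) + \<delta> / 2"
proof (cases "\<delta> \<le> frac t")
  case True
  have fr: "frac (t - \<delta>) = frac t - \<delta>"
    using True assms frac_lt_1[of t] by (subst frac_unique_iff) (auto simp: frac_def)
  have "(frac t)^2 - frac t - ((frac t - \<delta>)^2 - (frac t - \<delta>)) = (2 * \<delta>) * (saw t - \<delta> / 2)"
    by (simp add: saw_def algebra_simps power2_eq_square)
  then show ?thesis using assms unfolding fr by simp
next
  case False
  have "t - \<delta> - (frac t - \<delta> + 1) = of_int (\<lfloor>t\<rfloor> - 1)" by (simp add: frac_def)
  moreover have "0 \<le> frac t - \<delta> + 1" using assms frac_ge_0[of t] by linarith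
  ultimately have fr: "frac (t - \<delta>) = frac t - \<delta> + 1"
    using False by (subst frac_unique_iff) (auto simp del: of_int_diff)
  have "(2 * \<delta>) * (saw t - \<delta> / 2) \<le> (2 * \<delta>) * (saw t - \<delta> / 2) + 2 * (\<delta> - frac t)" using False by simp
  also have "... = (frac t)^2 - frac t - ((frac t - \<delta> + 1)^2 - (frac t - \<delta> + 1))"
    by (simp add: saw_def algebra_simps power2_eq_square)
  finally show ?thesis using assms unfolding fr by (simp add: field_simps)
qed

text \<open>The same argument with the mean over the interval from t to t + delta.\<close>

lemma saw_ge:
  assumes "0 < \<delta>" "\<delta> \<le> 1"
  shows "(((frac (t + \<delta>))^2 - frac (t + \<delta>)) - ((frac t)^2 - frac t)) / (2 * \<delta>) - \<delta> / 2 \<le> saw t"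
proof (cases "frac t + \<delta> < 1")
  case True
  have fr: "frac (t + \<delta>) = frac t + \<delta>"
    using True assms frac_ge_0[of t] by (subst frac_unique_iff) (auto simp: frac_def)
  have "(frac t + \<delta>)^2 - (frac t + \<delta>) - ((frac t)^2 - frac t) = (2 * \<delta>) * (saw t + \<delta> / 2)"
    by (simp add: saw_def algebra_simps power2_eq_square)
  then show ?thesis using assms unfolding fr by simp
next
  case False
  have "t + \<delta> - (frac t + \<delta> - 1) = of_int (\<lfloor>t\<rfloor> + 1)" by (simp add: frac_def)
  moreover have "frac t + \<delta> - 1 < 1" using assms frac_lt_1[of t] by linarith
  ultimately have fr: "frac (t + \<delta>) = frac t + \<delta> - 1"
    using False by (subst frac_unique_iff) (auto simp del: of_int_add)
  have "(frac t + \<delta> - 1)^2 - (frac t + \<delta> - 1) - ((frac t)^2 - frac t) =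
      (2 * \<delta>) * (saw t + \<delta> / 2) - 2 * (frac t + \<delta> - 1)"
    by (simp add: saw_def algebra_simps power2_eq_square)
  also have "... \<le> (2 * \<delta>) * (saw t + \<delta> / 2)" using False by simp
  finally show ?thesis using assms unfolding fr by (simp add: field_simps)
qed

lemma norm_expi_minus_one_le: "norm (expi t - 1) \<le> 2 * pi * \<bar>t\<bar>"
proof -
  have "expi t = exp (\<i> * of_real (2 * pi * t))" by (simp add: expi_def cis_conv_exp)
  then have "norm (expi t - 1) = 2 * \<bar>sin (2 * pi * t / 2)\<bar>"
    using dist_exp_i_1[of "2 * pi * t"] by simp
  also have "... \<le> 2 * \<bar>2 * pi * t / 2\<bar>"
    using abs_sin_x_le_abs_x[of "2 * pi * t / 2"] by linarith
  finally show ?thesis by (simp add: abs_mult)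
qed

lemma inverse_square_tail:
  assumes "H > 0"
  shows "summable (\<lambda>n. 1 / real (n + Suc H) ^ 2)" "(\<Sum>n. 1 / real (n + Suc H) ^ 2) \<le> 1 / real H"
proof -
  have "(\<lambda>n. 1 / real (n + H)) \<longlonglongrightarrow> 0"
    using LIMSEQ_ignore_initial_segment[OF lim_1_over_n, of H] by simp
  from telescope_sums'[OF this] have t: "(\<lambda>n. 1 / real (n + H) - 1 / real (Suc n + H)) sums (1 / real H)"
    by simp
  show s: "summable (\<lambda>n. 1 / real (n + Suc H) ^ 2)"
    using summable_inverse_squares by (subst summable_iff_shift[of "\<lambda>n. 1 / real n ^ 2"])
  have "(\<Sum>n. 1 / real (n + Suc H) ^ 2) \<le> (\<Sum>n. 1 / real (n + H) - 1 / real (Suc n + H))"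
  proof (rule suminf_le[OF _ s sums_summable[OF t]])
    fix n
    define a where "a = real (n + H)"
    have a: "0 < a" using assms by (simp add: a_def)
    have "1 / (a + 1)^2 \<le> 1 / (a * (a + 1))"
      using a by (intro divide_left_mono) (auto simp: power2_eq_square)
    also have "... = 1 / a - 1 / (a + 1)" using a by (simp add: field_simps)
    finally show "1 / real (n + Suc H) ^ 2 \<le> 1 / real (n + H) - 1 / real (Suc n + H)"
      by (simp add: a_def add_ac)
  qed
  also have "... = 1 / real H" using t by (rule sums_unique [symmetric])
  finally show "(\<Sum>n. 1 / real (n + Suc H) ^ 2) \<le> 1 / real H" .
qed

text \<open>At frequency h the coefficient is (1 - e(-h delta))/h^2 up to the factor pi^2. Its
  numerator is at most 2 and at most 2 pi h |delta|, whence the minimum. Frequencies beyond H are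
  estimated trivially. The sign of delta is left free so that forward and backward differences are
  both covered.\<close>

lemma frac_square_diff_bound:
  fixes w u :: "'a \<Rightarrow> real"
  assumes fin: "finite S" and w: "\<And>d. d \<in> S \<Longrightarrow> w d \<ge> 0" and \<delta>: "\<bar>\<delta>\<bar> \<le> 1" "\<delta> \<noteq> 0" and H: "H > 0"
  defines "b \<equiv> \<lambda>t. (frac t)^2 - frac t"
  shows "\<bar>\<Sum>d\<in>S. w d * (b (u d) - b (u d - \<delta>))\<bar> / (2 * \<bar>\<delta>\<bar>) \<le>
      (\<Sum>d\<in>S. w d) / (\<bar>\<delta>\<bar> * real H) +
      (\<Sum>h=1..H. min (1 / real h) (1 / (\<bar>\<delta>\<bar> * real h ^ 2)) * norm (\<Sum>d\<in>S. of_real (w d) * expi (real h * u d)))"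
proof -
  let ?a = "\<lambda>n::nat. 1 - expi (- (real n * \<delta>))"
  let ?g = "\<lambda>h::nat. min (1 / real h) (1 / (\<bar>\<delta>\<bar> * real h ^ 2))"
  let ?B = "(\<Sum>d\<in>S. w d * (b (u d) - b (u d - \<delta>)))"
  define W where "W = (\<Sum>d\<in>S. w d)"
  define E where "E h = (\<Sum>d\<in>S. of_real (w d) * expi (real h * u d))" for h
  have W: "W \<ge> 0" unfolding W_def by (intro sum_nonneg w)
  define T where "T n = (\<Sum>d\<in>S. w d * (Re (expi (real n * u d) - expi (real n * (u d - \<delta>))) / real n ^ 2))" for n
  have "T sums (\<Sum>d\<in>S. w d * (pi^2 * (b (u d) - b (u d - \<delta>))))"
    unfolding T_def b_def by (intro sums_sum sums_mult frac_square_diff_Fourier)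
  also have "(\<Sum>d\<in>S. w d * (pi^2 * (b (u d) - b (u d - \<delta>)))) = pi^2 * ?B"
    by (simp add: sum_distrib_left mult_ac)
  finally have T_sums: "T sums (pi^2 * ?B)" .
  have T_eq: "T n = Re (?a n * E n) / real n ^ 2" for n
  proof -
    have "?a n * E n =
        (\<Sum>d\<in>S. of_real (w d) * (expi (real n * u d) - expi (real n * (u d - \<delta>))))"
      by (simp add: E_def sum_distrib_left algebra_simps expi_diff expi_minus sum_subtractf)
    then show ?thesis by (simp add: T_def sum_divide_distrib)
  qed
  have T_le: "\<bar>T n\<bar> \<le> norm (?a n) * norm (E n) / real n ^ 2" for n
    unfolding T_eq abs_divide norm_mult [symmetric] power_abs abs_of_nat
    by (rule divide_right_mono[OF abs_Re_le_cmod]) simp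
  have two: "norm (?a n) \<le> 2" for n
    using norm_triangle_ineq4[of 1 "expi (- (real n * \<delta>))"] by simp
  have lin: "norm (?a n) \<le> 2 * pi * (real n * \<bar>\<delta>\<bar>)" for n
    using norm_expi_minus_one_le[of "- (real n * \<delta>)"] by (simp add: norm_minus_commute abs_mult)
  have EW: "norm (E n) \<le> W" for n
    unfolding E_def W_def by (rule order.trans[OF norm_sum]) (simp add: norm_mult w)
  have T_W: "\<bar>T n\<bar> \<le> 2 * W * (1 / real n ^ 2)" for n
  proof -
    have "norm (?a n) * norm (E n) / real n ^ 2 \<le> 2 * W / real n ^ 2"
      by (intro divide_right_mono mult_mono two EW) auto
    then show ?thesis using T_le[of n] by simp
  qed
  have pp: "pi \<le> pi^2" "1 \<le> pi^2"
    using pi_gt3 power_increasing[of 1 2 pi] one_le_power[of pi 2] by auto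
  have head: "\<bar>T h\<bar> \<le> 2 * \<bar>\<delta>\<bar> * pi^2 * (?g h * norm (E h))" if "h \<ge> 1" for h
  proof -
    have "norm (?a h) / real h ^ 2 \<le> 2 * \<bar>\<delta>\<bar> * pi^2 * (1 / real h)"
    proof -
      have "norm (?a h) / real h ^ 2 \<le> 2 * pi * (real h * \<bar>\<delta>\<bar>) / real h ^ 2"
        by (intro divide_right_mono lin) auto
      also have "... = 2 * \<bar>\<delta>\<bar> * pi * (1 / real h)" using that by (simp add: power2_eq_square field_simps)
      also have "... \<le> 2 * \<bar>\<delta>\<bar> * pi^2 * (1 / real h)"
        by (intro mult_right_mono mult_left_mono pp) auto
      finally show ?thesis .
    qed
    moreover have "norm (?a h) / real h ^ 2 \<le> 2 * \<bar>\<delta>\<bar> * pi^2 * (1 / (\<bar>\<delta>\<bar> * real h ^ 2))"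
    proof -
      have "norm (?a h) / real h ^ 2 \<le> 2 * pi^2 / real h ^ 2"
        using two[of h] pp by (intro divide_right_mono) auto
      then show ?thesis using \<delta> by simp
    qed
    ultimately have *: "norm (?a h) / real h ^ 2 \<le> 2 * \<bar>\<delta>\<bar> * pi^2 * ?g h"
      by (simp add: min_def)
    have "\<bar>T h\<bar> \<le> norm (?a h) / real h ^ 2 * norm (E h)"
      using T_le[of h] by simp
    also have "... \<le> 2 * \<bar>\<delta>\<bar> * pi^2 * ?g h * norm (E h)"
      by (intro mult_right_mono *) auto
    finally show ?thesis by (simp add: mult_ac)
  qed
  have sumT: "summable T" using T_sums by (rule sums_summable)
  have "pi^2 * ?B = suminf T"
    using T_sums by (rule sums_unique)
  also have "... = (\<Sum>n. T (n + Suc H)) + (\<Sum>n<Suc H. T n)"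
    by (rule suminf_split_initial_segment[OF sumT])
  also have "(\<Sum>n<Suc H. T n) = (\<Sum>h=1..H. T h)"
  proof -
    have "T 0 = 0" by (simp add: T_def)
    moreover have "{..<Suc H} = insert 0 {1..H}" by auto
    ultimately show ?thesis by simp
  qed
  finally have eq: "pi^2 * ?B = (\<Sum>n. T (n + Suc H)) + (\<Sum>h=1..H. T h)" .
  have "norm (\<Sum>n. T (n + Suc H)) \<le> (\<Sum>n. 2 * W * (1 / real (n + Suc H) ^ 2))"
    by (rule norm_suminf_le, simp only: real_norm_def T_W) (intro summable_mult inverse_square_tail H)
  also have "... = 2 * W * (\<Sum>n. 1 / real (n + Suc H) ^ 2)"
    by (intro suminf_mult inverse_square_tail H)
  also have "... \<le> 2 * W * (1 / real H)"
    using inverse_square_tail(2)[OF H] W by (intro mult_left_mono) auto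
  also have "... \<le> pi^2 * (2 * W * (1 / real H))"
    using W mult_right_mono[OF pp(2), of "2 * W * (1 / real H)"] by simp
  finally have tail: "\<bar>\<Sum>n. T (n + Suc H)\<bar> \<le> pi^2 * (2 * W * (1 / real H))" by simp
  define Q where "Q = (\<Sum>h=1..H. ?g h * norm (E h))"
  have "\<bar>\<Sum>h=1..H. T h\<bar> \<le> (\<Sum>h=1..H. 2 * \<bar>\<delta>\<bar> * pi^2 * (?g h * norm (E h)))"
    by (rule order.trans[OF sum_abs]) (intro sum_mono head, auto)
  also have "... = 2 * \<bar>\<delta>\<bar> * pi^2 * Q"
    by (simp add: Q_def sum_distrib_left)
  finally have hd: "\<bar>\<Sum>h=1..H. T h\<bar> \<le> 2 * \<bar>\<delta>\<bar> * pi^2 * Q" .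
  have "pi^2 * \<bar>?B\<bar> = \<bar>pi^2 * ?B\<bar>"
    by (simp add: abs_mult)
  also have "... \<le> pi^2 * (2 * W * (1 / real H)) + 2 * \<bar>\<delta>\<bar> * pi^2 * Q"
    unfolding eq using tail hd by linarith
  also have "... = pi^2 * (2 * W / real H + 2 * \<bar>\<delta>\<bar> * Q)"
    by (simp add: algebra_simps)
  finally have "\<bar>?B\<bar> \<le> 2 * W / real H + 2 * \<bar>\<delta>\<bar> * Q"
    by (subst (asm) mult_le_cancel_left_pos) auto
  then have "\<bar>?B\<bar> / (2 * \<bar>\<delta>\<bar>) \<le> (2 * W / real H + 2 * \<bar>\<delta>\<bar> * Q) / (2 * \<bar>\<delta>\<bar>)"
    by (intro divide_right_mono) auto
  also have "... = W / (\<bar>\<delta>\<bar> * real H) + Q"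
    using \<delta> H by (simp add: field_simps)
  finally show ?thesis by (simp add: W_def Q_def E_def)
qed

text \<open>Nonnegative weights allow the pointwise one-sided comparisons to be summed. In the proof
  s = 1 gives the upper bound from a backward difference and s = -1 the lower bound from a forward
  one.\<close>

lemma sum_saw_bound:
  fixes w u :: "'a \<Rightarrow> real"
  assumes fin: "finite S" and w: "\<And>d. d \<in> S \<Longrightarrow> w d \<ge> 0" and \<delta>: "0 < \<delta>" "\<delta> \<le> 1" and H: "H > 0"
  shows "\<bar>\<Sum>d\<in>S. w d * saw (u d)\<bar> \<le> (\<Sum>d\<in>S. w d) * (\<delta> + 1 / (\<delta> * real H)) +
      (\<Sum>h=1..H. min (1 / real h) (1 / (\<delta> * real h ^ 2)) * norm (\<Sum>d\<in>S. of_real (w d) * expi (real h * u d)))"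
proof -
  define b where "b t = (frac t)^2 - frac t" for t :: real
  define W where "W = (\<Sum>d\<in>S. w d)"
  define R where "R = (\<Sum>h=1..H. min (1 / real h) (1 / (\<delta> * real h ^ 2)) * norm (\<Sum>d\<in>S. of_real (w d) * expi (real h * u d)))"
  have W: "W \<ge> 0" unfolding W_def by (intro sum_nonneg w)
  have "s * (\<Sum>d\<in>S. w d * saw (u d)) \<le> W / (\<delta> * real H) + R + W * \<delta> / 2" if s: "s = 1 \<or> s = -1" for s
  proof -
    have abs: "\<bar>s * \<delta>\<bar> = \<delta>" "s * \<delta> \<noteq> 0" using s \<delta> by auto
    have le: "s * saw t \<le> (b t - b (t - s * \<delta>)) / (2 * \<delta>) + \<delta> / 2" for t
      using saw_le[OF \<delta>, of t] saw_ge[OF \<delta>, of t] s by (auto simp: b_def diff_divide_distrib)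
    have "s * (\<Sum>d\<in>S. w d * saw (u d)) = (\<Sum>d\<in>S. w d * (s * saw (u d)))"
      by (simp add: sum_distrib_left mult_ac)
    also have "... \<le> (\<Sum>d\<in>S. w d * ((b (u d) - b (u d - s * \<delta>)) / (2 * \<delta>) + \<delta> / 2))"
      by (intro sum_mono mult_left_mono le w)
    also have "... = (\<Sum>d\<in>S. w d * (b (u d) - b (u d - s * \<delta>))) / (2 * \<delta>) + W * \<delta> / 2"
      by (simp add: W_def distrib_left sum.distrib sum_divide_distrib sum_distrib_right)
    also have "... \<le> \<bar>\<Sum>d\<in>S. w d * (b (u d) - b (u d - s * \<delta>))\<bar> / (2 * \<delta>) + W * \<delta> / 2"
      using \<delta> by (intro add_right_mono divide_right_mono) auto
    also have "... \<le> W / (\<delta> * real H) + R + W * \<delta> / 2"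
      using frac_square_diff_bound[where w = w and u = u and \<delta> = "s * \<delta>", OF fin w _ _ H] \<delta> abs
      by (simp add: b_def W_def R_def)
    finally show ?thesis .
  qed
  from this[of 1] this[of "-1"]
  have "\<bar>\<Sum>d\<in>S. w d * saw (u d)\<bar> \<le> W / (\<delta> * real H) + R + W * \<delta> / 2" by linarith
  also have "... \<le> W * (\<delta> + 1 / (\<delta> * real H)) + R"
    using W \<delta> by (simp add: algebra_simps)
  finally show ?thesis by (simp add: W_def R_def)
qed

section \<open>Vaughan's identity and the divisor bound\<close>

definition moebius_fun :: "nat \<Rightarrow> real" where
  "moebius_fun n = (if squarefree n then (-1) ^ card (prime_factors n) else 0)"

lemma abs_moebius_fun_le: "\<bar>moebius_fun n\<bar> \<le> 1"
  by (simp add: moebius_fun_def)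

lemma moebius_fun_1 [simp]: "moebius_fun (Suc 0) = 1"
  by (simp add: moebius_fun_def)

lemma moebius_fun_prime_mult:
  assumes "prime p" "\<not> p dvd d" "squarefree d"
  shows "moebius_fun (p * d) = - moebius_fun d"
proof -
  have cop: "coprime p d" using assms by (simp add: prime_imp_coprime)
  have "d \<noteq> 0" using assms(2) by (intro notI) simp
  then have "prime_factors (p * d) = insert p (prime_factors d)"
    using assms by (auto simp: prime_factors_product prime_prime_factors)
  moreover have "p \<notin> prime_factors d" using assms by auto
  moreover have "squarefree (p * d)"
    using squarefree_mult_coprime[of p d] squarefree_prime[of p] assms cop by simp
  ultimately show ?thesis using assms by (simp add: moebius_fun_def)
qed

text \<open>A prime p dividing n pairs every squarefree divisor d prime to p with p d, and the two
  values cancel. All other divisors fail to be squarefree.\<close>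

lemma sum_moebius_fun:
  assumes "n > 0"
  shows "(\<Sum>d | d dvd n. moebius_fun d) = (if n = 1 then 1 else 0)"
proof (cases "n = 1")
  case False
  then obtain p where p: "prime p" "p dvd n"
    by (metis prime_factor_nat)
  define A where "A = {d. d dvd n \<and> squarefree d \<and> \<not> p dvd d}"
  have fin: "finite {d. d dvd n}" using assms by simp
  then have finA: "finite A" by (rule rev_finite_subset) (auto simp: A_def)
  have "(\<Sum>d | d dvd n. moebius_fun d) = (\<Sum>d\<in>A \<union> (*) p ` A. moebius_fun d)"
  proof (rule sum.mono_neutral_right[OF fin])
    show "A \<union> (*) p ` A \<subseteq> {d. d dvd n}"
    proof
      fix d assume "d \<in> A \<union> (*) p ` A"
      then show "d \<in> {d. d dvd n}"
      proof
        assume "d \<in> (*) p ` A"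
        then obtain e where e: "d = p * e" "e dvd n" "\<not> p dvd e" by (auto simp: A_def)
        have "coprime p e" using e p by (simp add: prime_imp_coprime)
        then show ?thesis using e p by (simp add: divides_mult)
      qed (simp add: A_def)
    qed
    show "\<forall>d\<in>{d. d dvd n} - (A \<union> (*) p ` A). moebius_fun d = 0"
    proof
      fix d assume d: "d \<in> {d. d dvd n} - (A \<union> (*) p ` A)"
      show "moebius_fun d = 0"
      proof (rule ccontr)
        assume "moebius_fun d \<noteq> 0"
        then have sq: "squarefree d" by (auto simp: moebius_fun_def split: if_splits)
        then have "p dvd d" using d by (auto simp: A_def)
        then obtain e where e: "d = p * e" by auto
        have "\<not> p dvd e"
        proof
          assume "p dvd e"
          then have "p ^ 2 dvd d" using e by (auto simp: power2_eq_square)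
          then show False using sq p(1) by (auto dest: squarefreeD)
        qed
        moreover have "squarefree e" using sq e by (auto intro: squarefree_mono[of e d])
        moreover have "e dvd n" using d e by (auto dest: dvd_mult_right)
        ultimately have "e \<in> A" by (simp add: A_def)
        then show False using d e by auto
      qed
    qed
  qed
  also have "... = (\<Sum>d\<in>A. moebius_fun d) + (\<Sum>d\<in>(*) p ` A. moebius_fun d)"
    by (rule sum.union_disjoint) (use finA in \<open>auto simp: A_def\<close>)
  also have "(\<Sum>d\<in>(*) p ` A. moebius_fun d) = (\<Sum>d\<in>A. moebius_fun (p * d))"
    using p(1) by (subst sum.reindex) (auto simp: inj_on_def)
  also have "... = (\<Sum>d\<in>A. - moebius_fun d)"
    using p by (intro sum.cong) (auto simp: A_def moebius_fun_prime_mult)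
  finally show ?thesis using False by (simp add: sum_negf)
qed simp

section \<open>Vaughan's identity\<close>

definition vaughan_coeff1 :: "nat \<Rightarrow> nat \<Rightarrow> nat \<Rightarrow> real" where
  "vaughan_coeff1 U V m = (\<Sum>b | b dvd m \<and> b \<le> U \<and> m div b \<le> V. moebius_fun b * mangoldt (m div b))"

definition vaughan_coeff2 :: "nat \<Rightarrow> nat \<Rightarrow> real" where
  "vaughan_coeff2 U k = (\<Sum>b | b dvd k \<and> b > U. moebius_fun b)"

text \<open>Without the Moebius factor and the truncations the sum is that of
  \<open>mangoldt\<close> over all divisors, which equals \<open>ln m\<close>.\<close>

lemma abs_vaughan_coeff1_le:
  assumes "m > 0"
  shows "\<bar>vaughan_coeff1 U V m\<bar> \<le> ln (real m)"
proof -
  have "\<bar>vaughan_coeff1 U V m\<bar> \<le> (\<Sum>b | b dvd m \<and> b \<le> U \<and> m div b \<le> V. \<bar>moebius_fun b * mangoldt (m div b)\<bar>)"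
    unfolding vaughan_coeff1_def by (rule sum_abs)
  also have "... \<le> (\<Sum>b | b dvd m \<and> b \<le> U \<and> m div b \<le> V. mangoldt (m div b))"
    using abs_moebius_fun_le by (intro sum_mono) (auto simp: abs_mult mangoldt_nonneg intro!: mult_left_le_one_le)
  also have "... \<le> (\<Sum>b | b dvd m. mangoldt (m div b))"
    using assms by (intro sum_mono2) (auto simp: mangoldt_nonneg)
  also have "... = (\<Sum>b | b dvd m. mangoldt b)"
    using assms by (intro sum.reindex_bij_witness[of _ "\<lambda>b. m div b" "\<lambda>b. m div b"]) auto
  also have "... = ln (real m)" using mangoldt_sum[of m, where 'a = real] assms by simp
  finally show ?thesis .
qed

lemma abs_vaughan_coeff2_le:
  assumes "k > 0"
  shows "\<bar>vaughan_coeff2 U k\<bar> \<le> real (card {d. d dvd k})"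
proof -
  have "\<bar>vaughan_coeff2 U k\<bar> \<le> (\<Sum>b | b dvd k \<and> b > U. 1)"
    unfolding vaughan_coeff2_def by (rule order.trans[OF sum_abs]) (intro sum_mono abs_moebius_fun_le)
  also have "... = real (card {b. b dvd k \<and> b > U})" by simp
  also have "... \<le> real (card {d. d dvd k})"
    using assms by (intro of_nat_mono card_mono) auto
  finally show ?thesis .
qed

lemma vaughan_coeff2_eq_0: "0 < k \<Longrightarrow> k \<le> U \<Longrightarrow> vaughan_coeff2 U k = 0"
  unfolding vaughan_coeff2_def by (rule sum.neutral) (auto dest: dvd_imp_le)

lemma dvd_div_iff:
  assumes "d > (0::nat)"
  shows "b dvd d \<and> c dvd d div b \<longleftrightarrow> b * c dvd d"
proof (cases "b dvd d")
  case True
  then have "b \<noteq> 0" using assms by (intro notI) simp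
  then show ?thesis using True dvd_div_iff_mult[of b d c] by (simp only: mult.commute simp_thms)
next
  case False
  then show ?thesis using dvd_mult_left[of b c d] by blast
qed

text \<open>Three readings of one sum over b c dividing d: with b outside, with c outside, or with
  the product m = b c outside. Each term of Vaughan's identity is obtained from one of them.\<close>

lemma sum_dvd_pairs:
  assumes "d > (0::nat)"
  shows "(\<Sum>(b, c) | b * c dvd d \<and> P b \<and> Q c. f b c :: 'a :: comm_monoid_add) =
     (\<Sum>b | b dvd d \<and> P b. \<Sum>c | c dvd d div b \<and> Q c. f b c)" (is "_ = ?B")
    and "(\<Sum>(b, c) | b * c dvd d \<and> P b \<and> Q c. f b c) =
     (\<Sum>c | c dvd d \<and> Q c. \<Sum>b | b dvd d div c \<and> P b. f b c)" (is "_ = ?C")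
    and "(\<Sum>(b, c) | b * c dvd d \<and> P b \<and> Q c. f b c) =
     (\<Sum>m | m dvd d. \<Sum>b | b dvd m \<and> P b \<and> Q (m div b). f b (m div b))" (is "?A = ?D")
proof -
  have fin: "finite {b. b dvd d' \<and> R b}" if "d' > 0" for d' :: nat and R
    by (rule finite_subset[OF _ finite_divisors_nat[OF that]]) auto
  have pos: "d div b > 0" if "b dvd d" for b
    using that assms by (auto simp: dvd_def)
  have "?B =
      (\<Sum>(b, c)\<in>(SIGMA b:{b. b dvd d \<and> P b}. {c. c dvd d div b \<and> Q c}). f b c)"
    by (rule sum.Sigma) (use fin pos assms in auto)
  also have "(SIGMA b:{b. b dvd d \<and> P b}. {c. c dvd d div b \<and> Q c}) = {(b, c). b * c dvd d \<and> P b \<and> Q c}"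
    using dvd_div_iff[OF assms] by auto
  finally show "?A = ?B" ..
  have "?C =
      (\<Sum>(c, b)\<in>(SIGMA c:{c. c dvd d \<and> Q c}. {b. b dvd d div c \<and> P b}). f b c)"
    by (rule sum.Sigma) (use fin pos assms in auto)
  also have "... = ?A"
  proof -
    have "c dvd d \<and> b dvd d div c \<longleftrightarrow> b * c dvd d" for b c
      using dvd_div_iff[OF assms, of c b] by (simp only: mult.commute)
    then show ?thesis
      by (intro sum.reindex_bij_witness[of _ "\<lambda>(b, c). (c, b)" "\<lambda>(c, b). (b, c)"]) auto
  qed
  finally show "?A = ?C" ..
  have "?D =
      (\<Sum>(m, b)\<in>(SIGMA m:{m. m dvd d}. {b. b dvd m \<and> P b \<and> Q (m div b)}). f b (m div b))"
  proof (rule sum.Sigma)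
    show "finite {m. m dvd d}" using assms by simp
    show "\<forall>m\<in>{m. m dvd d}. finite {b. b dvd m \<and> P b \<and> Q (m div b)}"
      using assms fin by (auto intro!: fin dest: dvd_pos_nat)
  qed
  also have "... = ?A"
  proof (rule sum.reindex_bij_witness[of _ "\<lambda>(b, c). (b * c, b)" "\<lambda>(m, b). (b, m div b)"])
    fix x assume "x \<in> {(b, c). b * c dvd d \<and> P b \<and> Q c}"
    then obtain b c where x: "x = (b, c)" "b * c dvd d" "P b" "Q c" by auto
    then have "b > 0" using assms by (intro Nat.gr0I) auto
    then show "(case (case x of (b, c) \<Rightarrow> (b * c, b)) of (m, b) \<Rightarrow> (b, m div b)) = x"
      "(case x of (b, c) \<Rightarrow> (b * c, b)) \<in> (SIGMA m:{m. m dvd d}. {b. b dvd m \<and> P b \<and> Q (m div b)})"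
      using x by auto
  qed auto
  finally show "?A = ?D" ..
qed

text \<open>Let \<open>S P Q\<close> sum mu(b) Lambda(c) over b c dividing d with \<open>P b\<close>
  and \<open>Q c\<close>. For c > V and all b it equals Lambda(d), because the sum over b leaves
  only c = d, and d > V. Splitting b at U, the part with b <= U and c > V is rewritten as the part
  with all c minus the part with c <= V.\<close>

lemma vaughan_pointwise:
  assumes "d > V"
  shows "mangoldt d = (\<Sum>b | b dvd d \<and> b \<le> U. moebius_fun b * ln (real (d div b)))
     - (\<Sum>m | m dvd d \<and> m \<le> U * V. vaughan_coeff1 U V m)
     + (\<Sum>c | c dvd d \<and> c > V. mangoldt c * vaughan_coeff2 U (d div c))"
proof -
  define S where "S P Q = (\<Sum>(b, c) | b * c dvd d \<and> P b \<and> Q c. moebius_fun b * mangoldt c)"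
    for P Q :: "nat \<Rightarrow> bool"
  have d: "d > 0" using assms by simp
  have finT: "finite {(b, c). b * c dvd d \<and> R b c}" for R :: "nat \<Rightarrow> nat \<Rightarrow> bool"
    by (rule finite_subset[of _ "{..d} \<times> {..d}"])
       (use d in \<open>auto dest: dvd_mult_left dvd_mult_right dvd_imp_le\<close>)
  have divpos: "d div b > 0" if "b dvd d" for b
    using that d by (auto simp: dvd_def)
  have add1: "S P Q = S (\<lambda>b. P b \<and> b \<le> U) Q + S (\<lambda>b. P b \<and> b > U) Q" for P Q
    unfolding S_def by (subst sum.union_disjoint [symmetric]) (auto intro!: finT sum.cong)
  have add2: "S P Q = S P (\<lambda>c. Q c \<and> c \<le> V) + S P (\<lambda>c. Q c \<and> c > V)" for P Q
    unfolding S_def by (subst sum.union_disjoint [symmetric]) (auto intro!: finT sum.cong)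
  have A: "S (\<lambda>_. True) (\<lambda>c. c > V) = mangoldt d"
  proof -
    have "S (\<lambda>_. True) (\<lambda>c. c > V) = (\<Sum>c | c dvd d \<and> c > V. mangoldt c * (\<Sum>b | b dvd d div c. moebius_fun b))"
      unfolding S_def by (subst sum_dvd_pairs(2)[OF d]) (simp add: sum_distrib_left mult.commute)
    also have "... = (\<Sum>c | c dvd d \<and> c > V. if c = d then mangoldt c else 0)"
    proof (intro sum.cong refl)
      fix c assume "c \<in> {c. c dvd d \<and> V < c}"
      then have "d div c > 0" "d div c = 1 \<longleftrightarrow> c = d" using divpos d by (auto simp: dvd_def)
      then show "mangoldt c * (\<Sum>b | b dvd d div c. moebius_fun b) = (if c = d then mangoldt c else 0)"
        by (simp add: sum_moebius_fun)
    qed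
    also have "... = mangoldt d"
      using assms d by (subst sum.delta) auto
    finally show ?thesis .
  qed
  have B: "S (\<lambda>b. b \<le> U) (\<lambda>_. True) = (\<Sum>b | b dvd d \<and> b \<le> U. moebius_fun b * ln (real (d div b)))"
    unfolding S_def using divpos mangoldt_sum[where 'a = real]
    by (subst sum_dvd_pairs(1)[OF d]) (auto simp: sum_distrib_left [symmetric] intro!: sum.cong)
  have C: "S (\<lambda>b. b > U) (\<lambda>c. c > V) = (\<Sum>c | c dvd d \<and> c > V. mangoldt c * vaughan_coeff2 U (d div c))"
    unfolding S_def vaughan_coeff2_def
    by (subst sum_dvd_pairs(2)[OF d]) (simp add: sum_distrib_left mult.commute)
  have E: "S (\<lambda>b. b \<le> U) (\<lambda>c. c \<le> V) = (\<Sum>m | m dvd d \<and> m \<le> U * V. vaughan_coeff1 U V m)"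
  proof -
    have "S (\<lambda>b. b \<le> U) (\<lambda>c. c \<le> V) = (\<Sum>m | m dvd d. vaughan_coeff1 U V m)"
      unfolding S_def vaughan_coeff1_def by (subst sum_dvd_pairs(3)[OF d]) simp
    also have "... = (\<Sum>m | m dvd d \<and> m \<le> U * V. vaughan_coeff1 U V m)"
    proof (rule sum.mono_neutral_right)
      show "\<forall>m\<in>{m. m dvd d} - {m. m dvd d \<and> m \<le> U * V}. vaughan_coeff1 U V m = 0"
      proof
        fix m assume m: "m \<in> {m. m dvd d} - {m. m dvd d \<and> m \<le> U * V}"
        have False if "b dvd m" "b \<le> U" "m div b \<le> V" for b
        proof -
          have "m = b * (m div b)" using that by simp
          also have "... \<le> U * V" using that by (intro mult_mono) auto
          finally show False using m by auto
        qed
        then show "vaughan_coeff1 U V m = 0"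
          unfolding vaughan_coeff1_def by (intro sum.neutral) auto
      qed
    qed (use d in auto)
    finally show ?thesis .
  qed
  have "mangoldt d = S (\<lambda>b. b \<le> U) (\<lambda>c. c > V) + S (\<lambda>b. b > U) (\<lambda>c. c > V)"
    using add1[of "\<lambda>_. True" "\<lambda>c. c > V"] A by simp
  moreover have "S (\<lambda>b. b \<le> U) (\<lambda>_. True) = S (\<lambda>b. b \<le> U) (\<lambda>c. c \<le> V) + S (\<lambda>b. b \<le> U) (\<lambda>c. c > V)"
    using add2[of "\<lambda>b. b \<le> U" "\<lambda>_. True"] by simp
  ultimately show ?thesis using B C E by linarith
qed

lemma sum_divisors_swap:
  fixes f :: "nat \<Rightarrow> nat \<Rightarrow> 'a :: comm_monoid_add"
  assumes "finite S" "0 \<notin> S" "\<And>m d. d \<in> S \<Longrightarrow> m dvd d \<Longrightarrow> P m \<Longrightarrow> m \<in> A" "finite A" "\<And>m. m \<in> A \<Longrightarrow> P m \<and> m > 0"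
  shows "(\<Sum>d\<in>S. \<Sum>m | m dvd d \<and> P m. f m (d div m)) = (\<Sum>m\<in>A. \<Sum>k | m * k \<in> S. f m k)"
proof -
  have fin: "finite {k. m * k \<in> S}" if "m > 0" for m
    using finite_vimageI[OF assms(1), of "(*) m"] that by (simp add: inj_on_def vimage_def)
  have fin2: "finite {m. m dvd d \<and> P m}" if "d \<in> S" for d
    by (rule finite_subset[OF _ finite_divisors_nat[of d]]) (use that assms(2) in \<open>auto intro: Nat.gr0I\<close>)
  have "(\<Sum>d\<in>S. \<Sum>m | m dvd d \<and> P m. f m (d div m)) =
      (\<Sum>(d, m)\<in>(SIGMA d:S. {m. m dvd d \<and> P m}). f m (d div m))"
    by (rule sum.Sigma) (use assms(1) fin2 in auto)
  also have "... = (\<Sum>(m, k)\<in>(SIGMA m:A. {k. m * k \<in> S}). f m k)"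
  proof (rule sum.reindex_bij_witness[of _ "\<lambda>(m, k). (m * k, m)" "\<lambda>(d, m). (m, d div m)"])
    fix x assume "x \<in> (SIGMA m:A. {k. m * k \<in> S})"
    then obtain m k where x: "x = (m, k)" "m \<in> A" "m * k \<in> S" by auto
    then show "(case (case x of (m, k) \<Rightarrow> (m * k, m)) of (d, m) \<Rightarrow> (m, d div m)) = x"
      "(case x of (m, k) \<Rightarrow> (m * k, m)) \<in> (SIGMA d:S. {m. m dvd d \<and> P m})"
      using assms(5)[of m] by auto
  qed (use assms(3) in auto)
  also have "... = (\<Sum>m\<in>A. \<Sum>k | m * k \<in> S. f m k)"
    by (rule sum.Sigma [symmetric]) (use assms(4,5) fin in auto)
  finally show ?thesis .
qed

lemma vaughan:
  fixes F :: "nat \<Rightarrow> complex"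
  assumes S: "S \<subseteq> {V<..M}"
  shows "(\<Sum>d\<in>S. mangoldt d * F d) =
      (\<Sum>b\<in>{1..U}. of_real (moebius_fun b) * (\<Sum>k | b * k \<in> S. of_real (ln (real k)) * F (b * k)))
    - (\<Sum>m\<in>{1..U*V}. of_real (vaughan_coeff1 U V m) * (\<Sum>k | m * k \<in> S. F (m * k)))
    + (\<Sum>c\<in>{V<..M}. mangoldt c * (\<Sum>k | c * k \<in> S. of_real (vaughan_coeff2 U k) * F (c * k)))"
proof -
  let ?r = "\<lambda>d. \<Sum>b | b dvd d \<and> b \<le> U. of_real (moebius_fun b * ln (real (d div b))) * F (b * (d div b))"
  let ?s = "\<lambda>d. \<Sum>m | m dvd d \<and> m \<le> U * V. of_real (vaughan_coeff1 U V m) * F (m * (d div m))"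
  let ?t = "\<lambda>d. \<Sum>c | c dvd d \<and> c > V. of_real (mangoldt c * vaughan_coeff2 U (d div c)) * F (c * (d div c))"
  have fin: "finite S" using S by (rule finite_subset) simp
  have S0: "0 \<notin> S" using S by auto
  have "(\<Sum>d\<in>S. mangoldt d * F d) = (\<Sum>d\<in>S. ?r d - ?s d + ?t d)"
  proof (rule sum.cong)
    fix d assume "d \<in> S"
    then have "d > V" using S by auto
    have F: "(\<Sum>b | b dvd d \<and> P b. of_real (g b) * F (b * (d div b))) = of_real (\<Sum>b | b dvd d \<and> P b. g b) * F d" for P g
      by (simp add: sum_distrib_right)
    show "mangoldt d * F d = ?r d - ?s d + ?t d"
    proof -
      have "(mangoldt d :: complex) = of_real (mangoldt d)" by simp
      also have "... = of_real (\<Sum>b | b dvd d \<and> b \<le> U. moebius_fun b * ln (real (d div b)))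
          - of_real (\<Sum>m | m dvd d \<and> m \<le> U * V. vaughan_coeff1 U V m)
          + of_real (\<Sum>c | c dvd d \<and> c > V. mangoldt c * vaughan_coeff2 U (d div c))"
        by (simp only: vaughan_pointwise[OF \<open>d > V\<close>, of U] of_real_add of_real_diff)
      finally show ?thesis
        unfolding F by (simp only: left_diff_distrib distrib_right)
    qed
  qed simp
  also have "... = (\<Sum>d\<in>S. ?r d) - (\<Sum>d\<in>S. ?s d) + (\<Sum>d\<in>S. ?t d)"
    by (simp only: sum.distrib sum_subtractf)
  also have "(\<Sum>d\<in>S. ?r d) =
      (\<Sum>b\<in>{1..U}. \<Sum>k | b * k \<in> S. of_real (moebius_fun b * ln (real k)) * F (b * k))"
    by (rule sum_divisors_swap[OF fin S0]) (use S0 in \<open>auto simp: Suc_le_eq intro!: Nat.gr0I\<close>)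
  also have "(\<Sum>d\<in>S. ?s d) =
      (\<Sum>m\<in>{1..U*V}. \<Sum>k | m * k \<in> S. of_real (vaughan_coeff1 U V m) * F (m * k))"
    by (rule sum_divisors_swap[OF fin S0]) (use S0 in \<open>auto simp: Suc_le_eq intro!: Nat.gr0I\<close>)
  also have "(\<Sum>d\<in>S. ?t d) =
      (\<Sum>c\<in>{V<..M}. \<Sum>k | c * k \<in> S. of_real (mangoldt c * vaughan_coeff2 U k) * F (c * k))"
  proof (rule sum_divisors_swap[OF fin S0])
    fix m d assume "d \<in> S" "m dvd d" "V < m"
    moreover from this have "m \<le> d" "d \<le> M"
      using S dvd_imp_le[of m d] by auto
    ultimately show "m \<in> {V<..M}" by auto
  qed auto
  finally show ?thesis by (simp add: sum_distrib_left mult_ac)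
qed

section \<open>The bound O(n^eta) for the number of divisors\<close>

lemma card_divisors_prime_power_mult_le:
  fixes m :: nat
  assumes "prime p" "m > 0"
  shows "card {d. d dvd p ^ a * m} \<le> (a + 1) * card {d. d dvd m}"
proof -
  have "{d. d dvd p ^ a * m} \<subseteq> (\<lambda>(i, e). p ^ i * e) ` ({..a} \<times> {d. d dvd m})"
  proof
    fix d assume "d \<in> {d. d dvd p ^ a * m}"
    then obtain b c where "d = b * c" "b dvd p ^ a" "c dvd m"
      using division_decomp[of d "p ^ a" m] by auto
    moreover from this obtain i where "b = p ^ i" "i \<le> a"
      using divides_primepow_nat[OF assms(1)] by auto
    ultimately show "d \<in> (\<lambda>(i, e). p ^ i * e) ` ({..a} \<times> {d. d dvd m})" by force
  qed
  then have "card {d. d dvd p ^ a * m} \<le> card ({..a} \<times> {d. d dvd m})"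
    using assms by (intro surj_card_le) auto
  then show ?thesis by (simp add: card_cartesian_product)
qed

text \<open>One prime power p^a is split off at a time, contributing a + 1. This is at most p^(eta
  a) as soon as p^eta >= 2. The finitely many primes below that threshold cost one bounded factor
  each.\<close>

lemma divisor_bound:
  fixes \<eta> :: real
  assumes "\<eta> > 0"
  obtains C where "C \<ge> 1" "\<And>n. n > 0 \<Longrightarrow> real (card {d. d dvd n}) \<le> C * real n powr \<eta>"
proof -
  define P where "P = nat \<lceil>2 powr (1 / \<eta>)\<rceil>"
  \<comment> \<open>With this choice a <= K eta a ln 2, hence a + 1 <= K (1 + eta a ln 2) <= K
    2^(eta a).\<close>
  define K where "K = max 1 (1 / (\<eta> * ln 2))"
  have K: "K \<ge> 1" by (simp add: K_def)
  define S where "S n = {p. prime p \<and> p dvd n \<and> p < P}" for n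
  have finS: "finite (S n)" for n unfolding S_def by (rule finite_subset[of _ "{..<P}"]) auto
  have small: "real a + 1 \<le> K * real p powr (\<eta> * real a)" if "p \<ge> 2" for p a :: nat
  proof -
    have "1 + \<eta> * real a * ln 2 \<le> exp (\<eta> * real a * ln 2)" by (rule exp_ge_add_one_self)
    also have "... = 2 powr (\<eta> * real a)" by (simp add: powr_def)
    also have "... \<le> real p powr (\<eta> * real a)" using that assms by (intro powr_mono2) auto
    finally have *: "1 + \<eta> * real a * ln 2 \<le> real p powr (\<eta> * real a)" .
    have "real a \<le> K * (\<eta> * real a * ln 2)"
    proof -
      have "1 / (\<eta> * ln 2) * (\<eta> * real a * ln 2) \<le> K * (\<eta> * real a * ln 2)"
        using assms by (intro mult_right_mono) (auto simp: K_def)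
      then show ?thesis using assms by simp
    qed
    then have "real a + 1 \<le> K * (1 + \<eta> * real a * ln 2)" using K by (simp add: algebra_simps)
    also have "... \<le> K * real p powr (\<eta> * real a)" using * K by (intro mult_left_mono) auto
    finally show ?thesis .
  qed
  have large: "real a + 1 \<le> real p powr (\<eta> * real a)" if "p \<ge> P" for p a :: nat
  proof -
    have "2 powr (1 / \<eta>) \<le> real p" using that unfolding P_def by linarith
    then have "(2 powr (1 / \<eta>)) powr \<eta> \<le> real p powr \<eta>" using assms by (intro powr_mono2) auto
    then have "2 \<le> real p powr \<eta>" using assms by (simp add: powr_powr)
    then have "2 ^ a \<le> (real p powr \<eta>) ^ a" by (intro power_mono) auto
    also have "(real p powr \<eta>) ^ a = real p powr (\<eta> * real a)"
      using powr_realpow[of "real p powr \<eta>" a] \<open>2 \<le> real p powr \<eta>\<close> by (simp only: powr_powr)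
    finally have "2 ^ a \<le> real p powr (\<eta> * real a)" .
    moreover have "real (a + 1) \<le> real (2 ^ a)"
      using less_exp[of a] by (intro of_nat_mono) (simp add: Suc_le_eq)
    ultimately show ?thesis by simp
  qed
  \<comment> \<open>The exponent counts the small primes dividing n. It grows only when such a prime
    is split off and never exceeds \<open>P\<close>, which turns the power of K into a
    constant.\<close>
  have main: "real (card {d. d dvd n}) \<le> K ^ card (S n) * real n powr \<eta>" if "n > 0" for n
    using that
  proof (induction n rule: less_induct)
    case (less n)
    show ?case
    proof (cases "n = 1")
      case True
      then show ?thesis using K by simp
    next
      case False
      then obtain p where p: "prime p" "p dvd n" by (metis prime_factor_nat)
      define a where "a = multiplicity p n"
      obtain m where m: "n = p ^ a * m" "\<not> p dvd m"
        using multiplicity_decompose'[of n p] less.prems p prime_gt_1_nat[of p] by (auto simp: a_def)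
      have a: "a > 0" using m p by (intro Nat.gr0I) auto
      have m0: "m > 0" using m less.prems by (intro Nat.gr0I) auto
      have "p ^ a > 1" using one_less_power[of p a] a p prime_gt_1_nat[of p] by simp
      then have mn: "m < n" using m m0 by simp
      have p2: "p \<ge> 2" using p by (simp add: prime_ge_2_nat)
      have S: "S m \<subseteq> S n" using m by (auto simp: S_def)
      have IH: "real (card {d. d dvd m}) \<le> K ^ card (S m) * real m powr \<eta>"
        using less.IH[OF mn m0] .
      have key: "real (a + 1) * K ^ card (S m) \<le> K ^ card (S n) * real p powr (\<eta> * real a)"
      proof (cases "p < P")
        case True
        then have "p \<in> S n" "p \<notin> S m" using p m by (auto simp: S_def)
        then have "card (S m) < card (S n)" using S finS by (intro psubset_card_mono) auto
        then have "K * K ^ card (S m) \<le> K ^ card (S n)"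
          using power_increasing[of "Suc (card (S m))" "card (S n)" K] K by simp
        then have "(K * real p powr (\<eta> * real a)) * K ^ card (S m) \<le> K ^ card (S n) * real p powr (\<eta> * real a)"
          by (metis mult.assoc mult.commute mult_right_mono powr_ge_zero)
        moreover have "real (a + 1) * K ^ card (S m) \<le> (K * real p powr (\<eta> * real a)) * K ^ card (S m)"
          using small[OF p2, of a] K by (intro mult_right_mono) auto
        ultimately show ?thesis by linarith
      next
        case False
        have "K ^ card (S m) \<le> K ^ card (S n)"
          using card_mono[OF finS S] K by (intro power_increasing) auto
        then have "K ^ card (S m) * real (a + 1) \<le> K ^ card (S n) * real p powr (\<eta> * real a)"
          using large[of p a] False K by (intro mult_mono) auto
        then show ?thesis by (simp add: mult_ac)
      qed
      have "real (card {d. d dvd n}) \<le> real ((a + 1) * card {d. d dvd m})"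
        unfolding of_nat_le_iff m(1) by (rule card_divisors_prime_power_mult_le[OF p(1) m0])
      also have "... \<le> real (a + 1) * (K ^ card (S m) * real m powr \<eta>)"
        unfolding of_nat_mult by (intro mult_left_mono IH) simp
      also have "... = real (a + 1) * K ^ card (S m) * real m powr \<eta>" by simp
      also have "... \<le> K ^ card (S n) * real p powr (\<eta> * real a) * real m powr \<eta>"
        using key by (intro mult_right_mono) auto
      also have "real p powr (\<eta> * real a) = real (p ^ a) powr \<eta>"
        using p2 by (simp add: powr_powr powr_realpow [symmetric] mult.commute)
      also have "K ^ card (S n) * real (p ^ a) powr \<eta> * real m powr \<eta> = K ^ card (S n) * real n powr \<eta>"
        using m(1) by (simp add: powr_mult)
      finally show ?thesis .
    qed
  qed
  show ?thesis
  proof (rule that[of "K ^ P"])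
    show "1 \<le> K ^ P" using K by simp
    fix n :: nat assume n: "n > 0"
    have "card (S n) \<le> P" using card_mono[of "{..<P}" "S n"] by (auto simp: S_def)
    then have "K ^ card (S n) \<le> K ^ P" using K by (intro power_increasing) auto
    then show "real (card {d. d dvd n}) \<le> K ^ P * real n powr \<eta>"
      using main[OF n] by (meson mult_right_mono order.trans powr_ge_zero)
  qed
qed

section \<open>Type I and type II exponential sums\<close>

text \<open>Abel summation: all initial sums are bounded by B, and the variation of decreasing
  weights telescopes.\<close>

lemma norm_sum_antimono_weights_le:
  fixes z :: "nat \<Rightarrow> complex" and w :: "nat \<Rightarrow> real"
  assumes partial: "\<And>c. c \<le> b \<Longrightarrow> norm (\<Sum>n\<in>{a..<c}. z n) \<le> B"
    and w: "\<And>n. a \<le> n \<Longrightarrow> n < b \<Longrightarrow> 0 \<le> w n \<and> w n \<le> W"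
    and anti: "\<And>n. a \<le> n \<Longrightarrow> Suc n < b \<Longrightarrow> w (Suc n) \<le> w n"
    and W: "W \<ge> 0"
  shows "norm (\<Sum>n\<in>{a..<b}. of_real (w n) * z n) \<le> W * B"
proof (cases "a < b")
  case False
  then show ?thesis using partial[of b] W by simp
next
  case True
  have B: "B \<ge> 0" using order.trans[OF norm_ge_zero partial[of 0]] by simp
  define S where "S c = (\<Sum>n\<in>{a..<c}. z n)" for c
  let ?T = "\<lambda>c. \<Sum>n\<in>{a..<Suc c}. of_real (w n) * z n"
  have main: "norm (?T c - of_real (w c) * S (Suc c)) \<le> (w a - w c) * B" if "a \<le> c" "c < b" for c
    using that
  proof (induction c rule: dec_induct)
    case (step c)
    have "?T (Suc c) - of_real (w (Suc c)) * S (Suc (Suc c)) =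
        (?T c - of_real (w c) * S (Suc c)) + of_real (w c - w (Suc c)) * S (Suc c)"
      using step by (simp add: S_def algebra_simps)
    also have "norm ... \<le> (w a - w c) * B + (w c - w (Suc c)) * B"
      using step anti[of c] partial[of "Suc c"]
      by (intro norm_triangle_mono) (auto simp: S_def norm_mult simp del: of_real_diff intro!: mult_left_mono)
    finally show ?case by (simp add: algebra_simps)
  qed (simp add: S_def)
  obtain c where c: "b = Suc c" "a \<le> c" using True by (cases b) auto
  have "norm (of_real (w c) * S (Suc c)) \<le> w c * B"
    using w[of c] c partial[of b] by (auto simp: S_def norm_mult intro!: mult_left_mono)
  then have "norm ((?T c - of_real (w c) * S (Suc c)) + of_real (w c) * S (Suc c)) \<le> (w a - w c) * B + w c * B"
    using main[of c] c by (intro norm_triangle_mono) auto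
  also have "... \<le> W * B" using w[of a] True B by (simp add: mult_right_mono flip: distrib_right)
  finally show ?thesis by (simp add: c(1))
qed

section \<open>The second derivative test for hyperbolic phases\<close>

lemma second_difference_inverse:
  fixes t :: real
  assumes "t > 0"
  shows "1 / (t + 2) - 2 * (1 / (t + 1)) + 1 / t = 2 / (t * (t + 1) * (t + 2))"
proof -
  have "t \<noteq> 0" "t + 1 \<noteq> 0" "t + 2 \<noteq> 0" using assms by auto
  then show ?thesis by (simp add: divide_simps) (simp add: algebra_simps)
qed

lemma sqrt_square_mult: "a \<ge> 0 \<Longrightarrow> sqrt (a^2 * z) = a * sqrt z"
  by (simp add: real_sqrt_mult)

text \<open>The phase w/t with t of size N has second differences of size w/N^3. The window from
  1/512 to 3 leaves room for a perturbation by a factor 1/2 to 3/2 and for t up to 4 N. It gives C =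
  3 * 512 = 1536, then 24576 = 4 * 1536 * 4, and 300 = 12 * 25 because 512 <= 25^2.\<close>

lemma van_der_corput_dyadic:
  fixes f :: "nat \<Rightarrow> real"
  assumes N: "N \<ge> 1" and w: "w > 0" and s: "s = 1 \<or> s = -1"
    and ab: "\<And>n. a \<le> n \<Longrightarrow> n < b \<Longrightarrow> N \<le> real n \<and> real n \<le> 4 * N"
    and f: "\<And>n. a \<le> n \<Longrightarrow> n < b \<Longrightarrow> w / (512 * N ^ 3) \<le> s * (f (n + 2) - 2 * f (n + 1) + f n) \<and>
      s * (f (n + 2) - 2 * f (n + 1) + f n) \<le> 3 * w / N ^ 3"
  shows "norm (\<Sum>n\<in>{a..<b}. expi (f n)) \<le> 24576 * sqrt (w / N) + 300 * (N * sqrt (N / w))"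
proof -
  define lam where "lam = w / (512 * N ^ 3)"
  have lam: "lam > 0" using w N by (simp add: lam_def)
  have "norm (\<Sum>n\<in>{a..<b}. expi (f n)) \<le> 4 * 1536 * real (b - a) * sqrt lam + 12 / sqrt lam"
    by (rule van_der_corput[OF lam _ s]) (use f N in \<open>auto simp: lam_def\<close>)
  also have "... \<le> 4 * 1536 * (4 * N) * sqrt lam + 12 / sqrt lam"
  proof -
    have "real (b - a) \<le> 4 * N"
    proof (cases "a < b")
      case True
      then have "a \<le> b - 1" "b - 1 < b" by simp_all
      from ab[OF this] have "real (b - 1) \<le> 4 * N" by simp
      moreover have "real a > 0" using ab[of a] True N by linarith
      then have "b - a \<le> b - 1" by simp
      then have "real (b - a) \<le> real (b - 1)" by (rule of_nat_mono)
      ultimately show ?thesis by linarith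
    qed (use N in simp)
    then show ?thesis using lam by (intro add_mono mult_right_mono mult_left_mono) auto
  qed
  also have "... = 24576 * (N * sqrt lam) + 12 * sqrt (1 / lam)" by (simp add: real_sqrt_divide)
  also have "... \<le> 24576 * sqrt (w / N) + 12 * (25 * (N * sqrt (N / w)))"
  proof (intro add_mono mult_left_mono)
    have "N * sqrt lam = sqrt (N^2 * lam)" using N by (simp add: real_sqrt_mult)
    also have "... \<le> sqrt (w / N)"
      using N w by (intro real_sqrt_le_mono) (simp add: lam_def field_simps power2_eq_square power3_eq_cube)
    finally show "N * sqrt lam \<le> sqrt (w / N)" .
    have "sqrt (1 / lam) = sqrt (512 * (N^2 * (N / w)))"
      by (simp add: lam_def power2_eq_square power3_eq_cube)
    also have "... \<le> sqrt (25^2 * (N^2 * (N / w)))"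
      using w N by (intro real_sqrt_le_mono mult_right_mono) auto
    also have "... = 25 * (N * sqrt (N / w))"
      by (subst sqrt_square_mult, simp, subst sqrt_square_mult) (use N in simp_all)
    finally show "sqrt (1 / lam) \<le> 25 * (N * sqrt (N / w))" .
  qed auto
  finally show ?thesis by simp
qed

lemma multiples_interval:
  assumes "m > (0::nat)"
  shows "{k. m * k \<in> {D<..D'}} = {Suc (D div m)..<Suc (D' div m)}"
  using assms by (auto simp: Suc_le_eq div_less_iff_less_mult less_eq_div_iff_mult_less_eq mult.commute less_Suc_eq_le)

lemma multiples_dyadic_range:
  assumes "m > (0::nat)" "m * k \<in> {D<..D'}" "D' \<le> 2 * D"
  shows "real D / real m \<le> real k" "real k \<le> 2 * real D / real m"
proof -
  have "D \<le> m * k" "m * k \<le> 2 * D" using assms by auto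
  then have "real D \<le> real m * real k" "real m * real k \<le> 2 * real D"
    by (metis of_nat_le_iff of_nat_mult, metis of_nat_le_iff of_nat_mult of_nat_numeral)
  then show "real D / real m \<le> real k" "real k \<le> 2 * real D / real m"
    using assms(1) by (simp_all add: field_simps)
qed

lemma hyperbola_phase_eq:
  assumes "m > 0"
  shows "h * (x / (real (m * n) + \<delta>)) = x * (h / real m) * (1 / (real n + \<delta> / real m))"
proof -
  have "real (m * n) + \<delta> = real m * (real n + \<delta> / real m)" using assms by (simp add: field_simps)
  then show ?thesis by simp
qed

text \<open>The phase is u/(k + c) with u = x h/m, on a range of size D/m. As u/(D/m) = x h/D, the
  first term does not depend on m. The upper end \<open>b\<close> is free so that partial summation
  can later insert the weight ln k.\<close>

lemma type_I_bound:
  fixes x \<delta> h :: real and m D D' b :: nat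
  assumes x: "x > 0" and \<delta>: "0 \<le> \<delta>" "\<delta> \<le> 1" and h: "h > 0" and m: "1 \<le> m" "m \<le> D" and D': "D' \<le> 2 * D"
    and b: "b \<le> Suc (D' div m)"
  shows "norm (\<Sum>k\<in>{Suc (D div m)..<b}. expi (h * (x / (real (m * k) + \<delta>)))) \<le>
      24576 * sqrt (x * h / real D) + 300 * (real D / real m) * sqrt (real D / (x * h))"
proof -
  define N where "N = real D / real m"
  have mpos: "real m > 0" "real D > 0" using m by simp_all
  have N: "N \<ge> 1" using m by (simp add: N_def)
  define c where "c = \<delta> / real m"
  have c: "0 \<le> c" "c \<le> 1" using \<delta> m by (auto simp: c_def divide_le_eq)
  define u where "u = x * (h / real m)"
  have u: "u > 0" using h x mpos by (simp add: u_def)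
  have phase: "h * (x / (real (m * k) + \<delta>)) = u * (1 / (real k + c))" for k
    unfolding u_def c_def by (rule hyperbola_phase_eq) (use m in simp)
  have kb: "N \<le> real k" "real k \<le> 2 * N" if "Suc (D div m) \<le> k" "k < b" for k
  proof -
    have m0: "m > 0" using m by simp
    have "k \<in> {k. m * k \<in> {D<..D'}}" unfolding multiples_interval[OF m0] using that b by simp
    then show "N \<le> real k" "real k \<le> 2 * N" using multiples_dyadic_range[OF m0 _ D', of k] by (simp_all add: N_def)
  qed
  have "norm (\<Sum>k\<in>{Suc (D div m)..<b}. expi (u * (1 / (real k + c)))) \<le> 24576 * sqrt (u / N) + 300 * (N * sqrt (N / u))"
  proof (rule van_der_corput_dyadic[OF N u, of 1])
    fix n assume n: "Suc (D div m) \<le> n" "n < b"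
    show "N \<le> real n \<and> real n \<le> 4 * N" using kb[OF n] N by simp
    define t where "t = real n + c"
    have t: "N \<le> t" "t + 2 \<le> 5 * N" "t > 0" using kb[OF n] c N by (auto simp: t_def)
    let ?d = "1 * (u * (1 / (real (n + 2) + c)) - 2 * (u * (1 / (real (n + 1) + c))) + u * (1 / (real n + c)))"
    have eq: "?d = 2 * u / (t * (t + 1) * (t + 2))"
      using arg_cong[OF second_difference_inverse[OF t(3)], of "(*) u"] by (simp add: t_def algebra_simps)
    have "t * (t + 1) * (t + 2) \<le> (5 * N) * (5 * N) * (5 * N)" "N * N * N \<le> t * (t + 1) * (t + 2)"
      using t N by (intro mult_mono; simp)+
    then have P: "N ^ 3 \<le> t * (t + 1) * (t + 2)" "t * (t + 1) * (t + 2) \<le> 1024 * N ^ 3"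
      using N by (simp_all add: power3_eq_cube)
    have "2 * u / (1024 * N ^ 3) \<le> 2 * u / (t * (t + 1) * (t + 2))" "2 * u / (t * (t + 1) * (t + 2)) \<le> 3 * u / N ^ 3"
      using P u t N by (intro frac_le; simp)+
    then show "u / (512 * N ^ 3) \<le> ?d \<and> ?d \<le> 3 * u / N ^ 3"
      unfolding eq by simp
  qed simp
  moreover have "u / N = x * h / real D" "N / u = real D / (x * h)"
    using mpos x h by (simp_all add: u_def N_def)
  ultimately show ?thesis by (simp only: phase) (simp add: N_def)
qed

text \<open>
  After grouping by \<open>key\<close> only pairs with equal keys survive the Cauchy--Schwarz step; this costs a
  factor \<open>card (key ` P)\<close> and gains because such pairs have close frequencies.
\<close>

lemma grouped_Cauchy_Schwarz:
  fixes \<alpha> :: "'p \<Rightarrow> complex" and \<beta> :: "nat \<Rightarrow> complex" and \<phi> :: "'p \<Rightarrow> nat \<Rightarrow> real" and key :: "'p \<Rightarrow> 'k"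
  assumes fin: "finite P" "finite Ns" and I: "\<And>p. p \<in> P \<Longrightarrow> I p \<subseteq> Ns"
    and \<alpha>: "\<And>p. p \<in> P \<Longrightarrow> norm (\<alpha> p) \<le> A" and \<beta>: "\<And>n. n \<in> Ns \<Longrightarrow> norm (\<beta> n) \<le> B"
    and A: "A \<ge> 0" and B: "B \<ge> 0"
  shows "(norm (\<Sum>p\<in>P. \<alpha> p * (\<Sum>n\<in>I p. \<beta> n * expi (\<phi> p n))))^2 \<le>
      A^2 * B^2 * real (card Ns) * real (card (key ` P)) *
      (\<Sum>(p, q) | p \<in> P \<and> q \<in> P \<and> key p = key q. norm (\<Sum>n\<in>I p \<inter> I q. expi (\<phi> p n - \<phi> q n)))"
proof -
  \<comment> \<open>Extension by 0 outside \<open>I p\<close> gives every p the same range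
    \<open>Ns\<close> of n, so that the two sums can be interchanged.\<close>
  let ?e = "\<lambda>n p. if n \<in> I p then \<alpha> p * expi (\<phi> p n) else 0"
  let ?g = "\<lambda>p q n. if n \<in> I p \<inter> I q then \<alpha> p * cnj (\<alpha> q) * expi (\<phi> p n - \<phi> q n) else 0"
  let ?T = "(\<Sum>p\<in>P. \<alpha> p * (\<Sum>n\<in>I p. \<beta> n * expi (\<phi> p n)))"
  define K where "K = key ` P"
  have finK: "finite K" using fin by (simp add: K_def)
  define Z where "Z n k = (\<Sum>p | p \<in> P \<and> key p = k. ?e n p)" for n k
  let ?Z = "(\<Sum>n\<in>Ns. \<Sum>k\<in>K. (norm (Z n k))^2)"
  have "?T =
      (\<Sum>p\<in>P. \<Sum>n\<in>Ns. \<beta> n * ?e n p)"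
  proof (rule sum.cong[OF refl])
    fix p assume p: "p \<in> P"
    have "\<alpha> p * (\<Sum>n\<in>I p. \<beta> n * expi (\<phi> p n)) = (\<Sum>n\<in>I p. \<beta> n * ?e n p)"
      by (simp add: sum_distrib_left mult_ac)
    also have "... = (\<Sum>n\<in>Ns. \<beta> n * ?e n p)"
      using I[OF p] fin by (intro sum.mono_neutral_left) auto
    finally show "\<alpha> p * (\<Sum>n\<in>I p. \<beta> n * expi (\<phi> p n)) = ..." .
  qed
  also have "... = (\<Sum>n\<in>Ns. \<Sum>p\<in>P. \<beta> n * ?e n p)"
    by (rule sum.swap)
  also have "... = (\<Sum>n\<in>Ns. \<beta> n * (\<Sum>k\<in>K. Z n k))"
  proof (rule sum.cong[OF refl])
    fix n
    have "(\<Sum>k\<in>K. Z n k) = (\<Sum>p\<in>P. ?e n p)"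
      unfolding Z_def using sum.group[OF fin(1) finK, of key "\<lambda>p. ?e n p"]
      by (simp add: K_def)
    then show "(\<Sum>p\<in>P. \<beta> n * ?e n p) = \<beta> n * (\<Sum>k\<in>K. Z n k)"
      by (simp only: sum_distrib_left)
  qed
  also have "norm ... \<le> (\<Sum>n\<in>Ns. B * (\<Sum>k\<in>K. norm (Z n k)))"
    by (rule sum_norm_le)
       (auto simp: norm_mult intro!: mult_mono \<beta> B norm_sum)
  also have "... = B * (\<Sum>(n, k)\<in>Ns \<times> K. norm (Z n k))"
    by (simp add: sum_distrib_left sum.cartesian_product case_prod_unfold)
  finally have "norm ?T \<le> B * (\<Sum>(n, k)\<in>Ns \<times> K. norm (Z n k))" .
  then have "(norm ?T)^2 \<le> (B * (\<Sum>(n, k)\<in>Ns \<times> K. norm (Z n k)))^2"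
    by (intro power_mono) auto
  also have "... = B^2 * (\<Sum>x\<in>Ns \<times> K. 1 * norm (Z (fst x) (snd x)))^2"
    by (simp add: power_mult_distrib case_prod_unfold)
  \<comment> \<open>Cauchy's inequality is applied over all pairs (n, k) of a variable and a group,
    so the loss is the number of such pairs.\<close>
  also have "... \<le> B^2 * ((\<Sum>x\<in>Ns \<times> K. 1^2) * (\<Sum>x\<in>Ns \<times> K. (norm (Z (fst x) (snd x)))^2))"
    by (intro mult_left_mono Cauchy_Schwarz_ineq_sum) auto
  also have "... = B^2 * real (card Ns) * real (card K) * ?Z"
    using fin finK by (simp add: card_cartesian_product sum.cartesian_product case_prod_unfold)
  finally have CS: "(norm ?T)^2 \<le>
      B^2 * real (card Ns) * real (card K) * ?Z" .
  \<comment> \<open>Opening the squares couples p with q only inside one group. The coefficients are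
    replaced by their bound while the cancellation in the sum over n is kept.\<close>
  have expand: "?Z \<le>
      A^2 * (\<Sum>(p, q) | p \<in> P \<and> q \<in> P \<and> key p = key q. norm (\<Sum>n\<in>I p \<inter> I q. expi (\<phi> p n - \<phi> q n)))"
  proof -
    define PQ where "PQ k = {p \<in> P. key p = k} \<times> {p \<in> P. key p = k}" for k
    define f where "f = (\<lambda>(p, q). \<Sum>n\<in>I p \<inter> I q. expi (\<phi> p n - \<phi> q n))"
    have "of_real ?Z = (\<Sum>n\<in>Ns. \<Sum>k\<in>K. Z n k * cnj (Z n k))"
      by (simp only: of_real_sum complex_norm_square)
    also have "... = (\<Sum>n\<in>Ns. \<Sum>k\<in>K. \<Sum>(p, q)\<in>PQ k. ?g p q n)"
      unfolding Z_def PQ_def cnj_sum sum_product sum.cartesian_product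
      by (intro sum.cong refl) (auto simp: expi_diff mult_ac intro!: sum.cong)
    also have "... = (\<Sum>k\<in>K. \<Sum>n\<in>Ns. \<Sum>(p, q)\<in>PQ k. ?g p q n)"
      by (rule sum.swap)
    also have "... = (\<Sum>k\<in>K. \<Sum>pq\<in>PQ k. \<Sum>n\<in>Ns. (case pq of (p, q) \<Rightarrow> ?g p q n))"
      by (intro sum.cong refl sum.swap)
    also have "... = (\<Sum>k\<in>K. \<Sum>pq\<in>PQ k. \<alpha> (fst pq) * cnj (\<alpha> (snd pq)) * f pq)"
    proof (intro sum.cong refl, clarify)
      fix k p q assume "(p, q) \<in> PQ k"
      then have pq: "p \<in> P" "q \<in> P" by (auto simp: PQ_def)
      have "(\<Sum>n\<in>Ns. ?g p q n) =
          (\<Sum>n\<in>I p \<inter> I q. \<alpha> p * cnj (\<alpha> q) * expi (\<phi> p n - \<phi> q n))"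
        using I[OF pq(1)] fin by (subst sum.inter_restrict [symmetric]) (auto intro!: sum.cong)
      then show "(\<Sum>n\<in>Ns. ?g p q n) =
          \<alpha> (fst (p, q)) * cnj (\<alpha> (snd (p, q))) * f (p, q)"
        by (simp add: f_def sum_distrib_left)
    qed
    also have "norm ... \<le> (\<Sum>k\<in>K. \<Sum>pq\<in>PQ k. A^2 * norm (f pq))"
    proof (rule order.trans[OF norm_sum], rule sum_mono, rule order.trans[OF norm_sum], rule sum_mono)
      fix k pq assume "pq \<in> PQ k"
      then have "norm (\<alpha> (fst pq)) * norm (\<alpha> (snd pq)) \<le> A * A"
        by (intro mult_mono \<alpha> A) (auto simp: PQ_def)
      then show "norm (\<alpha> (fst pq) * cnj (\<alpha> (snd pq)) * f pq) \<le> A^2 * norm (f pq)"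
        by (simp add: norm_mult power2_eq_square mult_right_mono)
    qed
    also have "... = A^2 * (\<Sum>k\<in>K. \<Sum>pq\<in>PQ k. norm (f pq))"
      by (simp add: sum_distrib_left)
    also have "(\<Sum>k\<in>K. \<Sum>pq\<in>PQ k. norm (f pq)) = (\<Sum>pq\<in>(\<Union>k\<in>K. PQ k). norm (f pq))"
      using fin finK by (intro sum.UNION_disjoint [symmetric]) (auto simp: PQ_def)
    also have "(\<Union>k\<in>K. PQ k) = {(p, q). p \<in> P \<and> q \<in> P \<and> key p = key q}"
      by (auto simp: PQ_def K_def)
    finally have "norm (complex_of_real ?Z) \<le>
        A^2 * (\<Sum>pq\<in>{(p, q). p \<in> P \<and> q \<in> P \<and> key p = key q}. norm (f pq))" .
    then show ?thesis by (simp add: f_def case_prod_unfold norm_of_real del: of_real_sum)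
  qed
  show ?thesis
    using order.trans[OF CS mult_left_mono[OF expand]] by (simp add: K_def mult_ac)
qed

text \<open>\<open>P\<close> is the denominator in the second difference of 1/t. It changes by O(n^2
  |c - c'|) and is at least n^3, so its reciprocal changes by O(|c - c'|/n^4).\<close>

lemma inverse_cubic_diff_le:
  fixes n c c' :: real
  assumes n: "n \<ge> 3" and c: "0 \<le> c" "c \<le> 1" and c': "0 \<le> c'" "c' \<le> 1"
  defines "P \<equiv> \<lambda>t. t * (t + 1) * (t + 2)"
  shows "n ^ 3 \<le> P (n + c)" "P (n + c) \<le> 8 * n ^ 3"
    "\<bar>1 / P (n + c) - 1 / P (n + c')\<bar> \<le> 12 * \<bar>c - c'\<bar> / n ^ 4"
proof -
  have lower: "n ^ 3 \<le> P (n + s)" if "0 \<le> s" for s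
  proof -
    have "n * n * n \<le> P (n + s)" unfolding P_def using that n by (intro mult_mono) auto
    then show ?thesis by (simp add: power3_eq_cube)
  qed
  show "n ^ 3 \<le> P (n + c)" by (rule lower[OF c(1)])
  have "P (n + c) \<le> (2 * n) * (2 * n) * (2 * n)"
    unfolding P_def using c n by (intro mult_mono) auto
  then show "P (n + c) \<le> 8 * n ^ 3" by (simp add: power3_eq_cube)
  have pos: "P (n + c) > 0" "P (n + c') > 0" using n c c' by (auto simp: P_def)
  have "P (n + c') - P (n + c) = (c' - c) * ((n + c') * (n + c' + 1) + (n + c') * (n + c + 2) + (n + c + 1) * (n + c + 2))"
    by (simp add: P_def algebra_simps)
  then have "\<bar>P (n + c') - P (n + c)\<bar> = \<bar>c - c'\<bar> * ((n + c') * (n + c' + 1) + (n + c') * (n + c + 2) + (n + c + 1) * (n + c + 2))"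
    using n c c' by (simp add: abs_mult abs_minus_commute)
  also have "... \<le> \<bar>c - c'\<bar> * ((2 * n) * (2 * n) + (2 * n) * (2 * n) + (2 * n) * (2 * n))"
    using n c c' by (intro mult_left_mono add_mono mult_mono) auto
  also have "... = 12 * \<bar>c - c'\<bar> * n^2" by (simp add: power2_eq_square)
  finally have "\<bar>P (n + c') - P (n + c)\<bar> \<le> 12 * \<bar>c - c'\<bar> * n^2" .
  moreover have "n ^ 3 * n ^ 3 \<le> P (n + c) * P (n + c')"
    using n lower c c' pos by (intro mult_mono) auto
  moreover have "1 / P (n + c) - 1 / P (n + c') = (P (n + c') - P (n + c)) / (P (n + c) * P (n + c'))"
    using pos by (simp add: field_simps)
  ultimately have "\<bar>1 / P (n + c) - 1 / P (n + c')\<bar> \<le> 12 * \<bar>c - c'\<bar> * n^2 / (n ^ 3 * n ^ 3)"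
    using pos n by (simp only: abs_divide abs_of_pos[OF mult_pos_pos[OF pos]]) (intro frac_le; simp)
  also have "... = 12 * \<bar>c - c'\<bar> / n ^ 4"
    using n by (simp add: field_simps power_numeral_reduce)
  finally show "\<bar>1 / P (n + c) - 1 / P (n + c')\<bar> \<le> 12 * \<bar>c - c'\<bar> / n ^ 4" .
qed

text \<open>
  The shift \<open>\<delta>\<close> perturbs the second difference only by a relative amount \<open>O(H/n)\<close>, because
  \<open>|h\<^sub>1 / m\<^sub>1 - h\<^sub>2 / m\<^sub>2| \<ge> 1 / (m\<^sub>1 m\<^sub>2)\<close> unless it vanishes.
\<close>

lemma type_II_pair_bound:
  fixes x \<delta> H M N \<beta> :: real and h1 h2 m1 m2 a b :: nat
  assumes x: "x > 0" and \<delta>: "0 \<le> \<delta>" "\<delta> \<le> 1" and H: "H \<ge> 1" and M: "M \<ge> 1" and N: "N \<ge> 6144 * H"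
    and h: "0 < h1" "0 < h2" "real h1 \<le> 2 * H" "real h2 \<le> 2 * H"
    and m: "M \<le> real m1" "real m1 \<le> 4 * M" "M \<le> real m2" "real m2 \<le> 4 * M"
    and ne: "h1 * m2 \<noteq> h2 * m1" and close: "\<bar>real h1 / real m1 - real h2 / real m2\<bar> \<le> \<beta>"
    and ab: "\<And>n. a \<le> n \<Longrightarrow> n < b \<Longrightarrow> N \<le> real n \<and> real n \<le> 4 * N"
  shows "norm (\<Sum>n\<in>{a..<b}. expi (real h1 * (x / (real (m1 * n) + \<delta>)) - real h2 * (x / (real (m2 * n) + \<delta>)))) \<le>
      24576 * (sqrt (x * \<beta> / N) + N * sqrt (M^2 * N / x))"
proof -
  define v1 v2 where "v1 = real h1 / real m1" and "v2 = real h2 / real m2"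
  define c1 c2 where "c1 = \<delta> / real m1" and "c2 = \<delta> / real m2"
  define w where "w = v1 - v2"
  define P where "P t = t * (t + 1) * (t + 2)" for t :: real
  have mpos: "real m1 > 0" "real m2 > 0" using m M by linarith+
  have Npos: "N > 0" "N \<ge> 6144" using N H by linarith+
  have c: "0 \<le> c1" "c1 \<le> 1 / M" "0 \<le> c2" "c2 \<le> 1 / M"
    using \<delta> m mpos M by (auto simp: c1_def c2_def intro!: frac_le)
  have M1: "1 / M \<le> 1" using M by simp
  have v2: "0 \<le> v2" "v2 \<le> 2 * H / M" using h m M H by (auto simp: v2_def intro!: frac_le)
  have weq: "w = (real h1 * real m2 - real h2 * real m1) / (real m1 * real m2)"
    using mpos by (simp add: w_def v1_def v2_def field_simps)
  have wlow: "1 / (16 * M^2) \<le> \<bar>w\<bar>"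
  proof -
    have "\<bar>int (h1 * m2) - int (h2 * m1)\<bar> \<ge> 1" using ne by linarith
    then have "real_of_int \<bar>int (h1 * m2) - int (h2 * m1)\<bar> \<ge> 1" by linarith
    then have "1 \<le> \<bar>real h1 * real m2 - real h2 * real m1\<bar>" by simp
    moreover have "real m1 * real m2 \<le> (4 * M) * (4 * M)" using m M by (intro mult_mono) auto
    ultimately have "1 / ((4 * M) * (4 * M)) \<le> \<bar>real h1 * real m2 - real h2 * real m1\<bar> / (real m1 * real m2)"
      using mpos by (intro frac_le) auto
    then show ?thesis using mpos by (simp add: weq abs_mult power2_eq_square)
  qed
  then have wpos: "\<bar>w\<bar> > 0" using M by (smt (verit) divide_pos_pos zero_less_power)
  define s where "s = sgn w"
  have s: "s = 1 \<or> s = -1" "s * w = \<bar>w\<bar>" using wpos by (auto simp: s_def sgn_if abs_if)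
  have phase: "real h1 * (x / (real (m1 * n) + \<delta>)) = x * v1 * (1 / (real n + c1))"
    "real h2 * (x / (real (m2 * n) + \<delta>)) = x * v2 * (1 / (real n + c2))" for n
    unfolding v1_def v2_def c1_def c2_def by (rule hyperbola_phase_eq; use mpos in simp)+
  define f where "f n = x * v1 * (1 / (real n + c1)) - x * v2 * (1 / (real n + c2))" for n
  have "norm (\<Sum>n\<in>{a..<b}. expi (real h1 * (x / (real (m1 * n) + \<delta>)) - real h2 * (x / (real (m2 * n) + \<delta>)))) =
      norm (\<Sum>n\<in>{a..<b}. expi (f n))"
    by (simp only: phase f_def)
  also have "... \<le> 24576 * sqrt (x * \<bar>w\<bar> / N) + 300 * (N * sqrt (N / (x * \<bar>w\<bar>)))"
  proof (rule van_der_corput_dyadic[OF _ _ s(1) ab])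
    show "1 \<le> N" "0 < x * \<bar>w\<bar>" using Npos wpos x by auto
  next
    fix n assume n: "a \<le> n" "n < b"
    let ?d = "f (n + 2) - 2 * f (n + 1) + f n"
    define t where "t = real n"
    have t: "N \<le> t" "t \<le> 4 * N" "t \<ge> 3" using ab[OF n] Npos by (auto simp: t_def)
    define g1 g2 where "g1 = 1 / P (t + c1)" and "g2 = 1 / P (t + c2)"
    have P1: "t ^ 3 \<le> P (t + c1)" "P (t + c1) \<le> 8 * t ^ 3"
      using inverse_cubic_diff_le(1,2)[of t c1 c1] c M1 t by (auto simp: P_def)
    have g1: "1 / (8 * t ^ 3) \<le> g1" "g1 \<le> 1 / t ^ 3"
      unfolding g1_def using P1 t by (auto intro!: divide_left_mono mult_pos_pos zero_less_power less_le_trans[OF _ P1(1)])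
    have "\<bar>g1 - g2\<bar> \<le> 12 * \<bar>c1 - c2\<bar> / t ^ 4"
      using inverse_cubic_diff_le(3)[of t c1 c2] c M1 t by (auto simp: P_def g1_def g2_def)
    also have "... \<le> 12 * (1 / M) / t ^ 4"
      using c t by (intro divide_right_mono mult_left_mono) auto
    finally have "v2 * \<bar>g1 - g2\<bar> \<le> (2 * H / M) * (12 * (1 / M) / t ^ 4)"
      using v2 H M by (intro mult_mono) auto
    also have "... = 24 * H / (M^2 * t ^ 4)" by (simp add: power2_eq_square)
    \<comment> \<open>After cancellation this reads 24 * 256 * H <= t, the origin of the constant
      6144.\<close>
    also have "... \<le> 1 / (16 * M^2) * (1 / (8 * t ^ 3)) / 2"
    proof -
      have "6144 * H * (M^2 * t ^ 3) \<le> t * (M^2 * t ^ 3)" using t N by (intro mult_right_mono) auto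
      then show ?thesis using t M by (simp add: field_simps power_numeral_reduce)
    qed
    also have "... \<le> \<bar>w\<bar> * g1 / 2"
      using wlow g1 t by (intro divide_right_mono mult_mono) auto
    finally have pert: "v2 * \<bar>g1 - g2\<bar> \<le> \<bar>w\<bar> * g1 / 2" .
    have fd: "?d = 2 * x * (v1 * g1 - v2 * g2)"
    proof -
      have "?d = x * v1 * (1 / (t + c1 + 2) - 2 * (1 / (t + c1 + 1)) + 1 / (t + c1)) -
          x * v2 * (1 / (t + c2 + 2) - 2 * (1 / (t + c2 + 1)) + 1 / (t + c2))"
        by (simp add: f_def t_def algebra_simps)
      also have "... = x * v1 * (2 * g1) - x * v2 * (2 * g2)"
        using second_difference_inverse[of "t + c1"] second_difference_inverse[of "t + c2"] t c
        by (simp add: P_def g1_def g2_def)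
      finally show ?thesis by (simp add: algebra_simps)
    qed
    \<comment> \<open>Split v1 g1 - v2 g2 into w g1, the value for equal shifts, and v2 (g1 - g2).
      The latter is at most half of the former, so the sign \<open>s\<close> of w is the sign of the
      second difference.\<close>
    have "s * (v1 * g1 - v2 * g2) = \<bar>w\<bar> * g1 + s * (v2 * (g1 - g2))"
      unfolding s(2)[symmetric] by (simp add: w_def algebra_simps)
    moreover have "\<bar>s * (v2 * (g1 - g2))\<bar> = v2 * \<bar>g1 - g2\<bar>" using s(1) v2 by (auto simp: abs_mult)
    ultimately have sb: "\<bar>w\<bar> * g1 / 2 \<le> s * (v1 * g1 - v2 * g2)" "s * (v1 * g1 - v2 * g2) \<le> 3 / 2 * (\<bar>w\<bar> * g1)"
      using pert by linarith+
    have t3: "t ^ 3 \<le> (4 * N) ^ 3" "N ^ 3 \<le> t ^ 3"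
      using power_mono[of t "4 * N" 3] power_mono[of N t 3] t Npos by simp_all
    have "1 / (512 * N ^ 3) \<le> g1" "g1 \<le> 1 / N ^ 3"
      using g1 t3 Npos t frac_le[of 1 1 "8 * t ^ 3" "512 * N ^ 3"] frac_le[of 1 1 "N ^ 3" "t ^ 3"]
      by (auto simp: power_mult_distrib)
    then have wg: "\<bar>w\<bar> * (1 / (512 * N ^ 3)) \<le> \<bar>w\<bar> * g1" "\<bar>w\<bar> * g1 \<le> \<bar>w\<bar> * (1 / N ^ 3)"
      by (intro mult_left_mono; simp)+
    have "\<bar>w\<bar> * (1 / (512 * N ^ 3)) / 2 \<le> s * (v1 * g1 - v2 * g2)"
      by (rule order.trans[OF divide_right_mono[OF wg(1)] sb(1)]) simp
    moreover have "s * (v1 * g1 - v2 * g2) \<le> 3 / 2 * (\<bar>w\<bar> * (1 / N ^ 3))"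
      by (rule order.trans[OF sb(2) mult_left_mono[OF wg(2)]]) simp
    ultimately have "2 * x * (\<bar>w\<bar> * (1 / (512 * N ^ 3)) / 2) \<le> 2 * x * (s * (v1 * g1 - v2 * g2))"
      "2 * x * (s * (v1 * g1 - v2 * g2)) \<le> 2 * x * (3 / 2 * (\<bar>w\<bar> * (1 / N ^ 3)))"
      using x by (intro mult_left_mono; simp)+
    then show "x * \<bar>w\<bar> / (512 * N ^ 3) \<le> s * ?d \<and> s * ?d \<le> 3 * (x * \<bar>w\<bar>) / N ^ 3"
      unfolding fd by (simp add: mult_ac)
  qed
  also have "... \<le> 24576 * sqrt (x * \<beta> / N) + 300 * (N * (4 * sqrt (M^2 * N / x)))"
  proof (intro add_mono mult_left_mono)
    show "sqrt (x * \<bar>w\<bar> / N) \<le> sqrt (x * \<beta> / N)"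
      using close x Npos by (intro real_sqrt_le_mono divide_right_mono mult_left_mono) (auto simp: w_def v1_def v2_def)
    have "N / (x * \<bar>w\<bar>) \<le> N / (x * (1 / (16 * M^2)))"
      using wlow x Npos M wpos by (intro divide_left_mono mult_left_mono) auto
    also have "... = 4^2 * (M^2 * N / x)" by simp
    finally have "sqrt (N / (x * \<bar>w\<bar>)) \<le> sqrt (4^2 * (M^2 * N / x))" by (rule real_sqrt_le_mono)
    then show "sqrt (N / (x * \<bar>w\<bar>)) \<le> 4 * sqrt (M^2 * N / x)" by (subst (asm) sqrt_square_mult) simp_all
  qed (use Npos in auto)
  also have "... \<le> 24576 * (sqrt (x * \<beta> / N) + N * sqrt (M^2 * N / x))"
    using Npos x by simp
  finally show ?thesis .
qed

text \<open>A pair of points (h1, m1), (h2, m2) is recovered from the products a = h1 m2 and b = h2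
  m1 together with the divisors h1 of a and h2 of b. Hence at most L^2 pairs of points share the
  same (a, b). \<open>T a\<close> is the set of values b allowed for a given a: a alone for the
  diagonal, its neighbours for the rest.\<close>

lemma card_close_products_le:
  fixes P :: "(nat \<times> nat) set" and L :: real and X R :: nat
  assumes P: "finite P" "\<And>h m. (h, m) \<in> P \<Longrightarrow> h > 0 \<and> m > 0"
    and X: "\<And>h m h' m'. (h, m) \<in> P \<Longrightarrow> (h', m') \<in> P \<Longrightarrow> h * m' \<le> X"
    and L: "\<And>n. 0 < n \<Longrightarrow> n \<le> X \<Longrightarrow> real (card {d. d dvd n}) \<le> L"
    and T: "\<And>a. finite (T a)" "\<And>a. card (T a) \<le> R"
  shows "real (card {(p, q). p \<in> P \<and> q \<in> P \<and> fst q * snd p \<in> T (fst p * snd q)}) \<le> L^2 * real X * real R"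
proof -
  define Q where "Q = {(p, q). p \<in> P \<and> q \<in> P \<and> fst q * snd p \<in> T (fst p * snd q)}"
  define S where "S = (SIGMA a:{1..X}. T a \<inter> {1..X})"
  define F :: "(nat \<times> nat) \<times> (nat \<times> nat) \<Rightarrow> nat \<times> nat" where "F = (\<lambda>(p, q). (fst p * snd q, fst q * snd p))"
  have finS: "finite S" unfolding S_def using T by auto
  have FQ: "F ` Q \<subseteq> S"
  proof
    fix y assume "y \<in> F ` Q"
    then obtain h m h' m' where y: "y = (h * m', h' * m)" "(h, m) \<in> P" "(h', m') \<in> P" "h' * m \<in> T (h * m')"
      by (auto simp: Q_def F_def)
    then show "y \<in> S" using P(2)[OF y(2)] P(2)[OF y(3)] X[OF y(2,3)] X[OF y(3,2)] by (auto simp: S_def Suc_le_eq)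
  qed
  have fib: "real (card {z \<in> Q. F z = s}) \<le> L^2" if "s \<in> S" for s
  proof -
    obtain a b where s0: "s = (a, b)" by (cases s) auto
    with that have s: "s = (a, b)" "1 \<le> a" "a \<le> X" "1 \<le> b" "b \<le> X" by (auto simp: S_def)
    have "card {z \<in> Q. F z = s} \<le> card ({d. d dvd a} \<times> {d. d dvd b})"
    proof (rule card_inj_on_le[of "\<lambda>(p, q). (fst p, fst q)"])
      show "inj_on (\<lambda>(p, q). (fst p, fst q)) {z \<in> Q. F z = s}"
      proof (rule inj_onI)
        fix z z' assume A: "z \<in> {z \<in> Q. F z = s}" "z' \<in> {z \<in> Q. F z = s}"
          "(case z of (p, q) \<Rightarrow> (fst p, fst q)) = (case z' of (p, q) \<Rightarrow> (fst p, fst q))"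
        obtain h1 m1 h2 m2 where z: "z = ((h1, m1), (h2, m2))" by (metis prod.exhaust)
        obtain h1' m1' h2' m2' where z': "z' = ((h1', m1'), (h2', m2'))" by (metis prod.exhaust)
        have h: "h1 > 0" "h2 > 0" "h1' = h1" "h2' = h2" using A P(2) by (auto simp: Q_def z z')
        then have "m1 = m1'" "m2 = m2'" using A by (auto simp: F_def s z z')
        with h show "z = z'" by (simp add: z z')
      qed
      show "(\<lambda>(p, q). (fst p, fst q)) ` {z \<in> Q. F z = s} \<subseteq> {d. d dvd a} \<times> {d. d dvd b}"
        by (auto simp: F_def s)
      show "finite ({d. d dvd a} \<times> {d. d dvd b})" using s by auto
    qed
    then have "real (card {z \<in> Q. F z = s}) \<le> real (card {d. d dvd a}) * real (card {d. d dvd b})"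
      by (simp add: card_cartesian_product flip: of_nat_mult)
    also have "... \<le> L * L"
      using L[of a] L[of b] s order.trans[OF of_nat_0_le_iff L[of a]] by (intro mult_mono) auto
    finally show ?thesis by (simp add: power2_eq_square)
  qed
  have finQ: "finite Q" unfolding Q_def
    by (rule finite_subset[of _ "P \<times> P"]) (use P in auto)
  have "real (card Q) = (\<Sum>z\<in>Q. 1)" by simp
  also have "... = (\<Sum>s\<in>S. \<Sum>z | z \<in> Q \<and> F z = s. 1)"
    by (rule sum.group[OF finQ finS FQ, symmetric])
  also have "... = (\<Sum>s\<in>S. real (card {z \<in> Q. F z = s}))" by simp
  also have "... \<le> (\<Sum>s\<in>S. L^2)" by (intro sum_mono fib)
  also have "... = real (card S) * L^2" by simp
  finally have Q: "real (card Q) \<le> real (card S) * L^2" .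
  have "card S = (\<Sum>a\<in>{1..X}. card (T a \<inter> {1..X}))"
    unfolding S_def by (rule card_SigmaI) (use T in auto)
  also have "... \<le> (\<Sum>a\<in>{1..X}. R)"
    by (intro sum_mono order.trans[OF card_mono T(2)]) (use T in auto)
  finally have "card S \<le> X * R" by simp
  then have "real (card S) \<le> real X * real R" by (metis of_nat_le_iff of_nat_mult)
  then have "real (card S) * L^2 \<le> real X * real R * L^2" by (intro mult_right_mono) auto
  with Q show ?thesis unfolding Q_def by (simp add: mult_ac)
qed

text \<open>The Cauchy-Schwarz step is applied to the points (h, m), grouped by the bin of width
  beta containing h/m. Diagonal pairs are bounded trivially by the length of the sum over n, all
  others by the second derivative test.\<close>

lemma type_II_bound:
  fixes x Y \<delta> M N A B L D :: real and H :: nat and Ms :: "nat set" and lo hi :: "nat \<Rightarrow> nat"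
    and c a b :: "nat \<Rightarrow> complex"
  assumes Y: "Y \<ge> 1" and x: "x = Y ^ 19" and \<delta>: "0 \<le> \<delta>" "\<delta> \<le> 1"
    and D: "D > 0" "D \<le> Y ^ 10" and H: "H \<ge> 1"
    and MN: "2 * M * N = D" and M: "M \<ge> Y^2" "M^2 \<le> D" and N: "N \<ge> 6144 * real H"
    and L: "\<And>n. 0 < n \<Longrightarrow> real n \<le> 8 * real H * M \<Longrightarrow> real (card {d. d dvd n}) \<le> L" "L \<ge> 0"
    and Ms: "finite Ms" "\<And>m. m \<in> Ms \<Longrightarrow> M \<le> real m \<and> real m \<le> 4 * M"
    and lohi: "\<And>m n. m \<in> Ms \<Longrightarrow> lo m \<le> n \<Longrightarrow> n < hi m \<Longrightarrow> N \<le> real n \<and> real n \<le> 4 * N"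
    and c: "\<And>h. norm (c h) \<le> 1" and a: "\<And>m. m \<in> Ms \<Longrightarrow> norm (a m) \<le> A"
    and b: "\<And>n. N \<le> real n \<Longrightarrow> real n \<le> 4 * N \<Longrightarrow> norm (b n) \<le> B"
    and AB: "A \<ge> 0" "B \<ge> 0"
  shows "norm (\<Sum>h\<in>{H..<2*H}. c h * (\<Sum>m\<in>Ms. a m * (\<Sum>n\<in>{lo m..<hi m}. b n * expi (real h * (x / (real (m * n) + \<delta>)))))) \<le>
      11000 * A * B * L * real H * Y ^ 9"
proof -
  have M1: "M \<ge> 1" using M(1) Y one_le_power[of Y 2] by linarith
  have H1: "real H \<ge> 1" using H by simp
  have N1: "N \<ge> 6144" using N H1 by linarith
  have xpos: "x > 0" using Y x by simp
  \<comment> \<open>this bin width for \<open>h/m\<close> balances the pairs with \<open>h\<^sub>1 m\<^sub>2 = h\<^sub>2 m\<^sub>1\<close> against the others\<close>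
  define \<beta> where "\<beta> = D^2 / (M^2 * Y ^ 18)"
  have \<beta>: "\<beta> > 0" using D(1) M1 Y by (simp add: \<beta>_def)
  define Q where "Q = real H * M * Y ^ 18 / D^2"
  \<comment> \<open>Up to a constant, Q is the number of bins H/(M beta). The hypothesis
    \<open>M >= Y^2\<close> makes it at least 1, which absorbs the rounding in 2 Q + 1 <= 3
    Q.\<close>
  have Q1: "Q \<ge> 1"
  proof -
    have "D^2 \<le> (Y ^ 10)^2" using D by (intro power_mono) auto
    also have "... = 1 * Y^2 * Y ^ 18" by (simp flip: power_add power_mult)
    also have "... \<le> real H * M * Y ^ 18" using H1 M Y by (intro mult_right_mono mult_mono) auto
    finally show ?thesis using D(1) by (simp add: Q_def)
  qed
  define P where "P = {H..<2*H} \<times> Ms"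
  define Ns where "Ns = {nat \<lceil>N\<rceil>..nat \<lfloor>4 * N\<rfloor>}"
  define I where "I p = {lo (snd p)..<hi (snd p)}" for p :: "nat \<times> nat"
  define \<phi> where "\<phi> p n = real (fst p) * (x / (real (snd p * n) + \<delta>))" for p :: "nat \<times> nat" and n :: nat
  define v where "v p = real (fst p) / real (snd p)" for p :: "nat \<times> nat"
  define key where "key p = \<lfloor>v p / \<beta>\<rfloor>" for p
  define E where "E p q = norm (\<Sum>n\<in>I p \<inter> I q. expi (\<phi> p n - \<phi> q n))" for p q
  have finP: "finite P" using Ms by (simp add: P_def)
  have Ns: "n \<in> Ns \<longleftrightarrow> N \<le> real n \<and> real n \<le> 4 * N" for n
    using N1 by (auto simp: Ns_def nat_le_iff ceiling_le_iff le_nat_floor) linarith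
  have finNs: "finite Ns" by (simp add: Ns_def)
  have cardNs: "real (card Ns) \<le> 4 * N"
  proof -
    have "card Ns = Suc (nat \<lfloor>4 * N\<rfloor>) - nat \<lceil>N\<rceil>" by (simp add: Ns_def)
    moreover have "nat \<lceil>N\<rceil> \<le> nat \<lfloor>4 * N\<rfloor>" using N1 by (intro nat_mono) linarith
    ultimately have "real (card Ns) \<le> real (nat \<lfloor>4 * N\<rfloor>) + 1 - real (nat \<lceil>N\<rceil>)" by linarith
    moreover have "real (nat \<lfloor>4 * N\<rfloor>) \<le> 4 * N" "real (nat \<lceil>N\<rceil>) \<ge> N" using N1 by linarith+
    ultimately show ?thesis using N1 by linarith
  qed
  have PD: "0 < fst p" "real (fst p) \<le> 2 * real H" "M \<le> real (snd p)" "real (snd p) \<le> 4 * M" "snd p > 0"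
    if "p \<in> P" for p
  proof -
    have "fst p \<ge> H" "fst p < 2 * H" "snd p \<in> Ms" using that by (auto simp: P_def)
    with H Ms(2)[of "snd p"] M1 show "0 < fst p" "real (fst p) \<le> 2 * real H"
      "M \<le> real (snd p)" "real (snd p) \<le> 4 * M" "snd p > 0" by (auto intro!: Nat.gr0I)
  qed
  have cardK: "real (card (key ` P)) \<le> 3 * Q"
  proof -
    have "key ` P \<subseteq> {0..\<lfloor>2 * Q\<rfloor>}"
    proof
      fix k assume "k \<in> key ` P"
      then obtain p where p: "p \<in> P" "k = key p" by auto
      have "v p \<le> 2 * real H / M" unfolding v_def using PD[OF p(1)] M1 by (intro frac_le) auto
      then have "v p / \<beta> \<le> 2 * real H / M / \<beta>" using \<beta> by (intro divide_right_mono) auto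
      also have "... = 2 * Q" using M1 D(1) Y by (simp add: \<beta>_def Q_def field_simps power2_eq_square)
      finally have "v p / \<beta> \<le> 2 * Q" .
      moreover have "v p / \<beta> \<ge> 0" using \<beta> by (simp add: v_def)
      ultimately show "k \<in> {0..\<lfloor>2 * Q\<rfloor>}" unfolding p(2) key_def by (auto intro: floor_mono)
    qed
    then have "card (key ` P) \<le> card {0..\<lfloor>2 * Q\<rfloor>}" by (intro card_mono) auto
    then have "card (key ` P) \<le> nat (\<lfloor>2 * Q\<rfloor> + 1)" by simp
    then show ?thesis using Q1 by linarith
  qed
  define PQ where "PQ = {(p, q). p \<in> P \<and> q \<in> P \<and> key p = key q}"
  define diag where "diag = {z \<in> PQ. fst (fst z) * snd (snd z) = fst (snd z) * snd (fst z)}"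
  define off where "off = {z \<in> PQ. fst (fst z) * snd (snd z) \<noteq> fst (snd z) * snd (fst z)}"
  have finPQ: "finite PQ" unfolding PQ_def by (rule finite_subset[of _ "P \<times> P"]) (use finP in auto)
  define X where "X = nat \<lfloor>8 * real H * M\<rfloor>"
  have X: "real X \<le> 8 * real H * M" unfolding X_def by (rule of_nat_floor) (use H1 M1 in simp)
  have prodX: "h * m' \<le> X" if "(h, m) \<in> P" "(h', m') \<in> P" for h m h' m'
  proof -
    have "real h * real m' \<le> (2 * real H) * (4 * M)"
      using PD[OF that(1)] PD[OF that(2)] by (intro mult_mono) auto
    then show ?thesis unfolding X_def by (intro le_nat_floor) (simp add: mult_ac)
  qed
  have LX: "real (card {d. d dvd n}) \<le> L" if "0 < n" "n \<le> X" for n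
    using L(1)[of n] that X by linarith
  have Ppos: "h > 0 \<and> m > 0" if "(h, m) \<in> P" for h m using PD[OF that] by simp
  have Xle: "L^2 * real X * r \<le> L^2 * (8 * real H * M) * r" if "r \<ge> 0" for r
    using X that by (intro mult_right_mono mult_left_mono) auto
  let ?W = "\<lambda>T. {(p, q). p \<in> P \<and> q \<in> P \<and> fst q * snd p \<in> T (fst p * snd q)}"
  have card_diag: "real (card diag) \<le> L^2 * (8 * real H * M)"
  proof -
    have "diag \<subseteq> ?W (\<lambda>n. {n})"
      by (auto simp: diag_def PQ_def)
    then have "card diag \<le> card (?W (\<lambda>n. {n}))"
      by (intro card_mono finite_subset[OF _ finite_cartesian_product[OF finP finP]]) auto
    also have "real ... \<le> L^2 * real X * real 1"
      by (rule card_close_products_le[OF finP Ppos prodX LX]) auto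
    finally show ?thesis using Xle[of 1] by simp
  qed
  define R where "R = nat \<lfloor>16 * M^2 * \<beta>\<rfloor>"
  have R: "real R \<le> 16 * M^2 * \<beta>" unfolding R_def by (rule of_nat_floor) (use \<beta> in simp)
  have close: "\<bar>v p - v q\<bar> \<le> \<beta>" if "(p, q) \<in> PQ" for p q
  proof -
    have "\<bar>v p / \<beta> - v q / \<beta>\<bar> \<le> 1" using that by (auto simp: PQ_def key_def) linarith
    then have "\<bar>v p - v q\<bar> / \<beta> \<le> 1" using \<beta> by (simp add: diff_divide_distrib [symmetric])
    then show ?thesis using \<beta> by simp
  qed
  have card_off: "real (card off) \<le> L^2 * (8 * real H * M) * (32 * M^2 * \<beta>)"
  proof -
    \<comment> \<open>Removing n itself leaves at most 2 R values instead of 2 R + 1. The count of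
      off-diagonal pairs is thus proportional to M^2 beta, without a constant term.\<close>
    define T where "T n = {n - R..n + R} - {n}" for n
    have T: "finite (T n)" "card (T n) \<le> 2 * R" for n
      by (auto simp: T_def card_Diff_singleton)
    have "off \<subseteq> ?W T"
    proof
      fix z assume z: "z \<in> off"
      obtain p q where pq: "z = (p, q)" by (cases z)
      have p: "p \<in> P" "q \<in> P" "(p, q) \<in> PQ" using z by (auto simp: pq off_def PQ_def)
      have "real (fst p) * real (snd q) - real (fst q) * real (snd p) = (v p - v q) * (real (snd p) * real (snd q))"
        using PD[OF p(1)] PD[OF p(2)] by (simp add: v_def field_simps)
      then have "\<bar>real (fst p) * real (snd q) - real (fst q) * real (snd p)\<bar> = \<bar>v p - v q\<bar> * (real (snd p) * real (snd q))"
        by (simp add: abs_mult)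
      also have "... \<le> \<beta> * ((4 * M) * (4 * M))"
        using close[OF p(3)] PD[OF p(1)] PD[OF p(2)] \<beta> M1 by (intro mult_mono) auto
      finally have le: "\<bar>real (fst p) * real (snd q) - real (fst q) * real (snd p)\<bar> \<le> 16 * M^2 * \<beta>"
        by (simp add: power2_eq_square mult_ac)
      define i j where "i = fst p * snd q" and "j = fst q * snd p"
      have "\<bar>real i - real j\<bar> \<le> 16 * M^2 * \<beta>" using le by (simp add: i_def j_def)
      then have "\<bar>int i - int j\<bar> \<le> \<lfloor>16 * M^2 * \<beta>\<rfloor>" by (simp add: le_floor_iff)
      then have "j \<in> {i - R..i + R}" unfolding R_def by auto
      moreover have "j \<noteq> i" using z by (auto simp: pq off_def i_def j_def)
      ultimately show "z \<in> ?W T"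
        using p by (auto simp: pq T_def i_def j_def)
    qed
    then have "card off \<le> card (?W T)"
      by (intro card_mono finite_subset[OF _ finite_cartesian_product[OF finP finP]]) auto
    also have "real ... \<le> L^2 * real X * real (2 * R)"
      by (rule card_close_products_le[OF finP Ppos prodX LX T]) auto
    also have "... \<le> L^2 * (8 * real H * M) * real (2 * R)" by (rule Xle) simp
    also have "... \<le> L^2 * (8 * real H * M) * (32 * M^2 * \<beta>)"
      using R H1 M1 by (intro mult_left_mono) (auto simp: mult_ac)
    finally show ?thesis by (simp add: mult_ac)
  qed
  define s1 s2 where "s1 = sqrt (x * \<beta> / N)" and "s2 = N * sqrt (M^2 * N / x)"
  let ?S = "L^2 * (8 * real H * M) * (4 * N) + L^2 * (8 * real H * M) * (32 * M^2 * \<beta>) * (24576 * (s1 + s2))"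
  have spos: "s1 \<ge> 0" "s2 \<ge> 0" using N1 xpos \<beta> by (auto simp: s1_def s2_def)
  have E_diag: "E p q \<le> 4 * N" if "(p, q) \<in> PQ" for p q
  proof -
    have "E p q \<le> (\<Sum>n\<in>I p \<inter> I q. 1)" unfolding E_def by (rule order.trans[OF norm_sum]) simp
    also have "... = real (card (I p \<inter> I q))" by simp
    also have "... \<le> real (card Ns)"
      using that lohi by (intro of_nat_mono card_mono finNs) (auto simp: I_def Ns PQ_def P_def)
    also have "... \<le> 4 * N" by (rule cardNs)
    finally show ?thesis .
  qed
  have E_off: "E p q \<le> 24576 * (s1 + s2)" if "(p, q) \<in> off" for p q
  proof -
    have p: "p \<in> P" "q \<in> P" "(p, q) \<in> PQ" "fst p * snd q \<noteq> fst q * snd p"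
      using that by (auto simp: off_def PQ_def)
    have "E p q = norm (\<Sum>n\<in>{max (lo (snd p)) (lo (snd q))..<min (hi (snd p)) (hi (snd q))}.
        expi (real (fst p) * (x / (real (snd p * n) + \<delta>)) - real (fst q) * (x / (real (snd q * n) + \<delta>))))"
      unfolding E_def I_def \<phi>_def by (intro arg_cong[of _ _ norm] sum.cong) auto
    also have "... \<le> 24576 * (sqrt (x * \<beta> / N) + N * sqrt (M^2 * N / x))"
    proof (rule type_II_pair_bound[OF xpos \<delta> H1 M1 N])
      show "\<bar>real (fst p) / real (snd p) - real (fst q) / real (snd q)\<bar> \<le> \<beta>"
        using close[OF p(3)] by (simp add: v_def)
      fix n assume "max (lo (snd p)) (lo (snd q)) \<le> n" "n < min (hi (snd p)) (hi (snd q))"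
      then show "N \<le> real n \<and> real n \<le> 4 * N" using lohi[of "snd p" n] p by (auto simp: P_def)
    qed (use PD[OF p(1)] PD[OF p(2)] p in auto)
    finally show ?thesis by (simp add: s1_def s2_def)
  qed
  have pairs: "(\<Sum>(p, q)\<in>PQ. E p q) \<le> ?S"
  proof -
    have "PQ = diag \<union> off" "diag \<inter> off = {}" by (auto simp: diag_def off_def)
    then have "(\<Sum>(p, q)\<in>PQ. E p q) = (\<Sum>(p, q)\<in>diag. E p q) + (\<Sum>(p, q)\<in>off. E p q)"
      using finPQ by (metis finite_Un sum.union_disjoint)
    also have "(\<Sum>(p, q)\<in>diag. E p q) \<le> (\<Sum>z\<in>diag. 4 * N)"
      using E_diag by (intro sum_mono) (auto simp: diag_def)
    also have "(\<Sum>(p, q)\<in>off. E p q) \<le> (\<Sum>z\<in>off. 24576 * (s1 + s2))"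
      using E_off by (intro sum_mono) auto
    also have "(\<Sum>z\<in>diag. 4 * N) \<le> L^2 * (8 * real H * M) * (4 * N)"
      using mult_right_mono[OF card_diag, of "4 * N"] N1 by simp
    also have "(\<Sum>z\<in>off. 24576 * (s1 + s2)) \<le> L^2 * (8 * real H * M) * (32 * M^2 * \<beta>) * (24576 * (s1 + s2))"
      using mult_right_mono[OF card_off, of "24576 * (s1 + s2)"] spos by simp
    finally show ?thesis by simp
  qed
  have MY: "M \<le> Y ^ 5"
  proof -
    have "M^2 \<le> (Y ^ 5)^2" using M(2) D(2) by (simp flip: power_mult)
    then show ?thesis using Y by (intro power2_le_imp_le[of M "Y ^ 5"]) auto
  qed
  have Nd: "N = D / (2 * M)" using MN M1 by (simp add: field_simps)
  have D3: "D ^ 3 \<le> Y ^ 30" "D ^ 5 \<le> Y ^ 50"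
    using power_mono[OF D(2), of 3] power_mono[OF D(2), of 5] D(1) by (simp_all flip: power_mult)
  \<comment> \<open>For D = Y^10 and M = Y^5 this is sharp up to the constant; it is the critical
    inequality for the exponent.\<close>
  have s1: "M * D * s1 \<le> 2 * Y ^ 18"
  proof -
    have "M * D * s1 = sqrt ((M * D)^2 * (x * \<beta> / N))"
      unfolding s1_def by (rule sqrt_square_mult [symmetric]) (use M1 D(1) in simp)
    also have "(M * D)^2 * (x * \<beta> / N) = 2 * (D ^ 3 * Y * M)"
      using Y M1 D(1) by (simp add: \<beta>_def x Nd field_simps power_numeral_reduce)
    also have "D ^ 3 * Y * M \<le> Y ^ 30 * Y * Y ^ 5"
      using D3 MY Y M1 by (intro mult_mono) auto
    also have "2 * (Y ^ 30 * Y * Y ^ 5) \<le> (2 * Y ^ 18)^2"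
      by (simp add: power_mult_distrib flip: power_mult power_Suc2 power_add)
    finally have "M * D * s1 \<le> sqrt ((2 * Y ^ 18)^2)" by (simp add: mult_left_mono)
    then show ?thesis using Y by (simp only: real_sqrt_abs) simp
  qed
  have s2: "M * D * s2 \<le> Y ^ 18"
  proof -
    have "M * D * s2 = sqrt ((M * D * N)^2 * (M^2 * N / x))"
      unfolding s2_def by (subst sqrt_square_mult) (use M1 N1 D(1) in auto)
    also have "(M * D * N)^2 * (M^2 * N / x) = D ^ 5 * M / (8 * Y ^ 19)"
      using Y M1 D(1) by (simp add: x Nd field_simps power_numeral_reduce)
    also have "D ^ 5 * M / (8 * Y ^ 19) \<le> Y ^ 50 * Y ^ 5 / (1 * Y ^ 19)"
      using D3 MY Y M1 by (intro frac_le mult_mono) auto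
    also have "... = (Y ^ 18)^2"
      using Y by (simp add: field_simps flip: power_mult power_add)
    finally have "M * D * s2 \<le> sqrt ((Y ^ 18)^2)" by simp
    then show ?thesis using Y by (simp only: real_sqrt_abs) simp
  qed
  \<comment> \<open>\<open>a1\<close> is the diagonal contribution and \<open>a2\<close> the factor
    of the off-diagonal one. The constant 11000 is chosen because 11000^2 exceeds 96 + 3 *
    37748736.\<close>
  have final: "4 * N * (3 * Q) * ?S \<le> (11000 * L * real H * Y ^ 9)^2"
  proof -
    have a1: "N * Q * (real H * M * N) = (real H)^2 * Y ^ 18 / 4"
      using M1 D(1) by (simp add: Q_def Nd field_simps power2_eq_square)
    have a2: "N * Q * (real H * M * (M^2 * \<beta>)) = (real H)^2 * (M * D) / 2"
      using M1 D(1) Y by (simp add: Q_def \<beta>_def Nd field_simps power2_eq_square)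
    have "4 * N * (3 * Q) * ?S =
        L^2 * (384 * (N * Q * (real H * M * N)) + 75497472 * (N * Q * (real H * M * (M^2 * \<beta>))) * (s1 + s2))"
      by (simp add: algebra_simps)
    also have "... = L^2 * (real H)^2 * (96 * Y ^ 18 + 37748736 * (M * D * s1 + M * D * s2))"
      unfolding a1 a2 by (simp add: algebra_simps)
    also have "... \<le> L^2 * (real H)^2 * (96 * Y ^ 18 + 37748736 * (2 * Y ^ 18 + Y ^ 18))"
      using s1 s2 by (intro mult_left_mono add_mono) auto
    also have "... = L^2 * (real H)^2 * (113246304 * Y ^ 18)" by simp
    also have "... \<le> L^2 * (real H)^2 * (121000000 * Y ^ 18)"
      using Y by (intro mult_left_mono mult_right_mono) auto
    also have "... = (11000 * L * real H * Y ^ 9)^2"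
      by (simp add: power_mult_distrib flip: power_mult)
    finally show ?thesis .
  qed
  define T where "T = (\<Sum>p\<in>P. (c (fst p) * a (snd p)) * (\<Sum>n\<in>I p. b n * expi (\<phi> p n)))"
  have Teq: "(\<Sum>h\<in>{H..<2*H}. c h * (\<Sum>m\<in>Ms. a m * (\<Sum>n\<in>{lo m..<hi m}. b n * expi (real h * (x / (real (m * n) + \<delta>)))))) = T"
    unfolding T_def P_def I_def \<phi>_def
    by (simp add: sum_distrib_left sum.cartesian_product case_prod_unfold mult_ac)
  have "(norm T)^2 \<le> A^2 * B^2 * real (card Ns) * real (card (key ` P)) *
      (\<Sum>(p, q) | p \<in> P \<and> q \<in> P \<and> key p = key q. norm (\<Sum>n\<in>I p \<inter> I q. expi (\<phi> p n - \<phi> q n)))"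
    unfolding T_def
  proof (rule grouped_Cauchy_Schwarz[OF finP finNs])
    fix p assume p: "p \<in> P"
    show "I p \<subseteq> Ns" using p lohi by (auto simp: I_def Ns P_def)
    have "norm (c (fst p)) * norm (a (snd p)) \<le> 1 * A"
      using p c a by (intro mult_mono) (auto simp: P_def)
    then show "norm (c (fst p) * a (snd p)) \<le> A" by (simp add: norm_mult)
  qed (use b AB in \<open>auto simp: Ns\<close>)
  also have "... = A^2 * B^2 * (real (card Ns) * real (card (key ` P)) * (\<Sum>(p, q)\<in>PQ. E p q))"
    by (simp add: PQ_def E_def case_prod_unfold)
  also have "... \<le> A^2 * B^2 * (4 * N * (3 * Q) * ?S)"
  proof (intro mult_left_mono mult_mono)
    show "0 \<le> (\<Sum>(p, q)\<in>PQ. E p q)" by (intro sum_nonneg) (auto simp: E_def)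
  qed (use cardNs cardK pairs N1 Q1 in auto)
  also have "... \<le> A^2 * B^2 * (11000 * L * real H * Y ^ 9)^2"
    by (intro mult_left_mono final) auto
  also have "... = (11000 * A * B * L * real H * Y ^ 9)^2"
    by (simp add: power_mult_distrib)
  finally have "(norm T)^2 \<le> (11000 * A * B * L * real H * Y ^ 9)^2" .
  then have "norm T \<le> 11000 * A * B * L * real H * Y ^ 9"
    using AB L(2) Y by (intro power2_le_imp_le[of "norm T"]) auto
  then show ?thesis by (simp only: Teq)
qed

section \<open>Sums over prime powers\<close>

lemma harmonic_sum_le:
  assumes "n \<ge> 1"
  shows "(\<Sum>m\<in>{1..n}. 1 / real m) \<le> 1 + ln (real n)"
  using assms
proof (induction n rule: dec_induct)
  case (step n)
  have n: "real n > 0" using step by simp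
  have "ln (1 + (- (1 / (real n + 1)))) \<le> - (1 / (real n + 1))"
    using n by (intro ln_add_one_self_le_self2) simp
  moreover have "1 + (- (1 / (real n + 1))) = real n / (real n + 1)" using n by (simp add: field_simps)
  ultimately have "1 / (real n + 1) \<le> ln (real n + 1) - ln (real n)" using n by (simp add: ln_div)
  then show ?case using step by (simp add: add.commute)
qed simp

text \<open>\<open>L\<close> stands for every factor of size x^epsilon: logarithms and divisor
  counts of all integers up to Y^20, beyond any that occur. With \<open>L\<close> a fixed number,
  epsilon enters only when the locale is interpreted.\<close>

locale floor_sum_scale =
  fixes x Y L :: real
  assumes x_eq: "x = Y ^ 19" and Y_ge: "Y \<ge> 1000" and ln_le: "20 * ln Y \<le> L"
    and divisors_le: "\<And>n. 0 < n \<Longrightarrow> real n \<le> Y ^ 20 \<Longrightarrow> real (card {d. d dvd n}) \<le> L"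
begin

lemma Y1: "Y \<ge> 1" and Y0: "Y > 0"
  using Y_ge by simp_all

lemma x_pos: "x > 0"
  using Y0 by (simp add: x_eq)

lemma ln_Y_ge: "2 \<le> ln Y"
proof -
  have "exp (2::real) = exp 1 * exp 1" by (simp flip: exp_add)
  also have "... \<le> 3 * 3" by (intro mult_mono exp_le) auto
  finally have "exp 2 \<le> Y" using Y_ge by linarith
  then show ?thesis using Y0 by (simp add: ln_ge_iff)
qed

lemma L1: "L \<ge> 1" and L0: "L \<ge> 0"
  using ln_Y_ge ln_le by linarith+

lemma Y_pow_mono: "i \<le> j \<Longrightarrow> Y ^ i \<le> Y ^ j"
  using Y1 by (rule power_increasing[rotated])

lemma const_mult_Y_pow_le:
  assumes "c \<le> 1000 ^ k" "i + k \<le> j"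
  shows "c * Y ^ i \<le> Y ^ j"
proof -
  have "c * Y ^ i \<le> Y ^ k * Y ^ i"
    using assms(1) Y_ge power_mono[of 1000 Y k] Y0 by (intro mult_right_mono) auto
  also have "... = Y ^ (i + k)" by (simp add: power_add)
  also have "... \<le> Y ^ j" by (rule Y_pow_mono[OF assms(2)])
  finally show ?thesis .
qed

lemma le_Y_pow_20: "t \<le> 4 * Y ^ i \<Longrightarrow> i < 20 \<Longrightarrow> t \<le> Y ^ 20"
  using const_mult_Y_pow_le[of 4 1 i 20] by simp

lemma ln_nat_le:
  assumes "0 < n" "real n \<le> Y ^ 20"
  shows "ln (real n) \<le> L"
proof -
  have "ln (real n) \<le> ln (Y ^ 20)" using assms Y0 by simp
  also have "... = 20 * ln Y" using Y0 by (simp add: ln_realpow)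
  finally show ?thesis using ln_le by simp
qed

lemma mangoldt_le_L:
  assumes "real n \<le> Y ^ 20"
  shows "mangoldt n \<le> L"
proof (cases "n = 0")
  case False
  then show ?thesis using mangoldt_le[of n] ln_nat_le[of n] assms by force
qed (use L0 in simp)

text \<open>From ln 2 >= 2/3 the logarithm is at most 39/2 ln Y, and ln Y >= 2 leaves room for the
  additional 1 below 20 ln Y.\<close>

lemma log2_le_L:
  assumes "0 < z" "z \<le> Y ^ 13"
  shows "log 2 z + 1 \<le> L"
proof -
  have "ln z \<le> ln (Y ^ 13)" using assms Y0 by simp
  also have "... = 13 * ln Y" using Y0 by (simp add: ln_realpow)
  finally have "ln z \<le> 13 * ln Y" .
  also have "13 * ln Y \<le> 39 / 2 * ln Y * ln 2"
    using mult_left_mono[OF ln2_ge_two_thirds, of "39 / 2 * ln Y"] ln_Y_ge by simp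
  finally have "log 2 z \<le> 39 / 2 * ln Y" by (simp add: log_def divide_le_eq)
  then show ?thesis using ln_le ln_Y_ge by linarith
qed

lemma dyadic_exponent:
  assumes "1 \<le> z" "z \<le> Y ^ 13"
  obtains J where "z \<le> 2 ^ J" "2 ^ J \<le> 2 * z" "real J \<le> L"
proof
  define J where "J = nat \<lceil>log 2 z\<rceil>"
  have "0 \<le> log 2 z" using assms by simp
  then have J: "log 2 z \<le> real J" "real J \<le> log 2 z + 1" unfolding J_def by linarith+
  then have "2 powr log 2 z \<le> 2 powr real J" "2 powr real J \<le> 2 powr (log 2 z + 1)" by simp_all
  then show "z \<le> 2 ^ J" "2 ^ J \<le> 2 * z" using assms by (simp_all add: powr_realpow powr_add)
  show "real J \<le> L" using J(2) log2_le_L[of z] assms by linarith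
qed

lemma pos_of_ge_Y_pow:
  assumes "Y ^ i \<le> real D"
  shows "real D > 0" "D > 0"
  using assms zero_less_power[OF Y0, of i] by (linarith, intro Nat.gr0I, simp)

text \<open>The shorter of the two variables has to play the role of m in
  \<open>type_II_bound\<close>. For C^2 <= D this is the variable of \<open>mangoldt\<close>.
  Otherwise the roles are exchanged and k is the short variable; if its range starts below Y^2, then
  k <= 4 Y^2 <= U throughout and the coefficient vanishes.\<close>

lemma type_II_block:
  fixes D D' H C U :: nat and c :: "nat \<Rightarrow> complex"
  assumes \<delta>: "0 \<le> \<delta>" "\<delta> \<le> 1" and D: "Y ^ 9 \<le> real D" "real D \<le> Y ^ 10" "D' \<le> 2 * D"
    and H: "1 \<le> H" "real H \<le> 2 * Y^2" and C: "real C \<ge> Y^2" "real C \<le> Y ^ 15" and U: "real U \<ge> 4 * Y^2"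
    and c: "\<And>h. norm (c h) \<le> 1"
  shows "norm (\<Sum>h\<in>{H..<2*H}. c h * (\<Sum>m\<in>{C<..2*C}. mangoldt m *
      (\<Sum>k | m * k \<in> {D<..D'}. of_real (vaughan_coeff2 U k) * expi (real h * (x / (real (m * k) + \<delta>)))))) \<le>
      11000 * L ^ 3 * real H * Y ^ 9"
proof -
  let ?e = "\<lambda>h d. expi (real h * (x / (real d + \<delta>)))"
  let ?J = "\<lambda>k. {max (Suc C) (Suc (D div k))..<min (Suc (2*C)) (Suc (D' div k))}"
  let ?g = "\<lambda>k. of_real (vaughan_coeff2 U k)"
  note Dpos = pos_of_ge_Y_pow[OF D(1)] and Cpos = pos_of_ge_Y_pow[OF C(1)]
  have H1: "real H \<ge> 1" using H by simp
  \<comment> \<open>The longer variable is at least D^(1/2)/2 >= Y^(9/2)/2, which exceeds 6144 H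
    because H = O(Y^2).\<close>
  have big: "6144 * real H \<le> t" if t: "t \<ge> 0" "real D / 4 \<le> t^2" for t :: real
  proof -
    have "6144 * real H \<le> 12288 * Y^2" using H by simp
    then have "(6144 * real H)^2 \<le> (12288 * Y^2)^2" by (intro power_mono) auto
    also have "... = 150994944 * Y ^ 4" by (simp add: power_mult_distrib flip: power_mult)
    also have "... = (603979776 * Y ^ 4) / 4" by simp
    also have "... \<le> Y ^ 9 / 4" by (intro divide_right_mono const_mult_Y_pow_le[of _ 5]) auto
    also have "... \<le> t^2" using t D by simp
    finally show ?thesis by (rule power2_le_imp_le) (use t in simp)
  qed
  have tau: "norm (?g k :: complex) \<le> L" if "real k \<le> Y ^ 20" "k > 0" for k
    using abs_vaughan_coeff2_le[OF that(2), of U] divisors_le[OF that(2,1)] by simp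
  have lam: "norm (mangoldt k :: complex) \<le> L" if "real k \<le> Y ^ 20" for k
    using mangoldt_le_L[OF that] by simp
  have divs: "real (card {d. d dvd n}) \<le> L" if "0 < n" "real n \<le> 8 * real H * M" "M^2 \<le> real D" for n M
  proof (rule divisors_le[OF that(1)])
    have "M^2 \<le> (Y ^ 5)^2" using that(3) D(2) by (simp flip: power_mult)
    then have "M \<le> Y ^ 5" using Y0 by (intro power2_le_imp_le[of M]) auto
    have "real n \<le> 8 * real H * Y ^ 5"
      using that(2) mult_left_mono[OF \<open>M \<le> Y ^ 5\<close>, of "8 * real H"] by simp
    also have "... \<le> 8 * (2 * Y^2) * Y ^ 5" using H Y0 by (intro mult_right_mono) auto
    also have "... = 16 * Y ^ 7" by (simp flip: power_add)
    also have "... \<le> Y ^ 20" by (rule const_mult_Y_pow_le[of _ 1]) auto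
    finally show "real n \<le> Y ^ 20" .
  qed
  have L3: "11000 * L * L * L * real H * Y ^ 9 = 11000 * L ^ 3 * real H * Y ^ 9"
    by (simp add: power3_eq_cube)
  note interval = multiples_dyadic_range[OF _ _ D(3)]
  show ?thesis
  proof (cases "C^2 \<le> D")
    case True
    then have CD: "(real C)^2 \<le> real D" by (metis of_nat_le_iff of_nat_power)
    define N where "N = real D / (2 * real C)"
    have NC: "4 * N * real C = 2 * real D" using Cpos by (simp add: N_def)
    have N4: "4 * N \<le> Y ^ 20"
    proof -
      have "4 * N \<le> 2 * real D / 1" unfolding N_def using Cpos Dpos by (simp add: field_simps)
      also have "... \<le> 4 * Y ^ 10" using D Y0 by simp
      finally show ?thesis by (rule le_Y_pow_20) simp
    qed
    have "norm (\<Sum>h\<in>{H..<2*H}. c h * (\<Sum>m\<in>{C<..2*C}. mangoldt m *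
        (\<Sum>k\<in>{Suc (D div m)..<Suc (D' div m)}. ?g k * ?e h (m * k)))) \<le>
        11000 * L * L * L * real H * Y ^ 9"
    proof (rule type_II_bound[OF Y1 x_eq \<delta> Dpos(1) D(2) H(1), of "real C" N])
      show "2 * real C * N = real D" using Cpos by (simp add: N_def)
      show "6144 * real H \<le> N"
      proof (rule big)
        show "N \<ge> 0" by (simp add: N_def)
        have "real D * (real C)^2 \<le> real D * real D" using CD Dpos by (intro mult_left_mono) auto
        then show "real D / 4 \<le> N^2"
          using Cpos by (simp add: N_def power_divide power_mult_distrib field_simps power2_eq_square)
      qed
      show "norm (?g n :: complex) \<le> L" if "N \<le> real n" "real n \<le> 4 * N" for n
      proof (rule tau)
        have "N > 0" using Dpos Cpos by (simp add: N_def)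
        then show "n > 0" using that by (cases n) auto
      qed (use that N4 in linarith)
    next
      fix m assume m: "m \<in> {C<..2 * C}"
      then have "real m \<le> 4 * Y ^ 15" using C by auto
      then show "norm (mangoldt m :: complex) \<le> L" by (intro lam le_Y_pow_20[of _ 15]) simp_all
      show "real C \<le> real m \<and> real m \<le> 4 * real C" using m by auto
    next
      fix m n assume mn: "m \<in> {C<..2 * C}" "Suc (D div m) \<le> n" "n < Suc (D' div m)"
      then have m: "m > 0" "real C \<le> real m" "real m \<le> 2 * real C" by auto
      have "n \<in> {k. m * k \<in> {D<..D'}}" unfolding multiples_interval[OF m(1)] using mn by simp
      with interval[OF m(1), of n] have "real D / real m \<le> real n" "real n \<le> 2 * real D / real m" by auto
      moreover have "N \<le> real D / real m" unfolding N_def using m Cpos by (intro divide_left_mono) auto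
      moreover have "2 * real D / real m \<le> 2 * real D / real C" using m Cpos by (intro divide_left_mono) auto
      moreover have "2 * real D / real C = 4 * N" using Cpos by (simp add: N_def)
      ultimately show "N \<le> real n \<and> real n \<le> 4 * N" by linarith
    qed (use C CD c L0 divs[OF _ _ CD] in auto)
    also have "(\<Sum>h\<in>{H..<2*H}. c h * (\<Sum>m\<in>{C<..2*C}. mangoldt m *
        (\<Sum>k\<in>{Suc (D div m)..<Suc (D' div m)}. ?g k * ?e h (m * k)))) =
      (\<Sum>h\<in>{H..<2*H}. c h * (\<Sum>m\<in>{C<..2*C}. mangoldt m *
      (\<Sum>k | m * k \<in> {D<..D'}. ?g k * ?e h (m * k))))"
      by (intro sum.cong refl arg_cong2[where f = "(*)"] multiples_interval [symmetric]) auto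
    finally show ?thesis by (simp only: L3)
  next
    case False
    then have "D < C^2" by simp
    then have CD: "real D < (real C)^2" by (metis of_nat_less_iff of_nat_power)
    define M where "M = real D / (2 * real C)"
    have M0: "M > 0" using Dpos Cpos by (simp add: M_def)
    define Ms where "Ms = {k::nat. M \<le> real k \<and> real k \<le> 4 * M}"
    have finMs: "finite Ms" unfolding Ms_def
      by (rule finite_subset[of _ "{..nat \<lfloor>4 * M\<rfloor>}"]) (auto simp: le_nat_floor)
    have range: "k \<in> Ms" if "m \<in> {C<..2*C}" "m * k \<in> {D<..D'}" for m k
    proof -
      have m: "m > 0" "real C \<le> real m" "real m \<le> 2 * real C" using that by auto
      have "M \<le> real D / real m" unfolding M_def using m Cpos by (intro divide_left_mono) auto
      moreover have "2 * real D / real m \<le> 2 * real D / real C" using m Cpos by (intro divide_left_mono) auto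
      moreover have "2 * real D / real C = 4 * M" using Cpos by (simp add: M_def)
      ultimately show ?thesis using interval[OF m(1) that(2)] by (simp add: Ms_def)
    qed
    \<comment> \<open>After the exchange the inner variable m runs through an interval depending on
      k: the intersection of the block (C, 2C] with the condition D < k m <= D'.\<close>
    have swap: "(\<Sum>m\<in>{C<..2*C}. mangoldt m * (\<Sum>k | m * k \<in> {D<..D'}. ?g k * ?e h (m * k))) =
        (\<Sum>k\<in>Ms. ?g k * (\<Sum>m\<in>?J k.
           mangoldt m * ?e h (k * m)))" for h
    proof -
      have "(\<Sum>m\<in>{C<..2*C}. mangoldt m * (\<Sum>k | m * k \<in> {D<..D'}. ?g k * ?e h (m * k))) =
        (\<Sum>m\<in>{C<..2*C}. \<Sum>k | k \<in> Ms \<and> m * k \<in> {D<..D'}. ?g k * (mangoldt m * ?e h (k * m)))"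
        unfolding sum_distrib_left by (intro sum.cong) (auto simp: range mult_ac)
      also have "... = (\<Sum>k\<in>Ms. \<Sum>m | m \<in> {C<..2*C} \<and> m * k \<in> {D<..D'}. ?g k * (mangoldt m * ?e h (k * m)))"
        by (rule sum.swap_restrict) (use finMs in auto)
      also have "... = (\<Sum>k\<in>Ms. ?g k * (\<Sum>m\<in>?J k.
           mangoldt m * ?e h (k * m)))"
        unfolding sum_distrib_left
      proof (intro sum.cong refl)
        fix k assume "k \<in> Ms"
        then have k: "k > 0" using M0 by (cases k) (auto simp: Ms_def)
        have "{m. m \<in> {C<..2*C} \<and> m * k \<in> {D<..D'}} = {C<..2*C} \<inter> {m. k * m \<in> {D<..D'}}"
          by (auto simp: mult.commute)
        also have "... = ?J k"
          unfolding multiples_interval[OF k] by auto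
        finally show "{m. m \<in> {C<..2*C} \<and> m * k \<in> {D<..D'}} = ?J k" .
      qed
      finally show ?thesis .
    qed
    show ?thesis
    proof (cases "M \<ge> Y^2")
      case True
      have MD: "M^2 \<le> real D"
      proof -
        have "real D \<le> 4 * (real C)^2" using CD zero_le_power2[of "real C"] by linarith
        then have "real D * real D \<le> real D * (4 * (real C)^2)" using Dpos by (intro mult_left_mono) auto
        then show ?thesis using Cpos by (simp add: M_def power_divide power_mult_distrib field_simps power2_eq_square)
      qed
      have "norm (\<Sum>h\<in>{H..<2*H}. c h * (\<Sum>k\<in>Ms. ?g k *
          (\<Sum>m\<in>?J k.
           mangoldt m * ?e h (k * m)))) \<le> 11000 * L * L * L * real H * Y ^ 9"
      proof (rule type_II_bound[OF Y1 x_eq \<delta> Dpos(1) D(2) H(1), of M "real C"])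
        show "2 * M * real C = real D" using Cpos by (simp add: M_def)
        show "6144 * real H \<le> real C"
          by (rule big) (use CD Dpos in linarith)+
        show "norm (?g k :: complex) \<le> L" if "k \<in> Ms" for k
        proof (rule tau)
          show "k > 0" using M0 that by (cases k) (auto simp: Ms_def)
          have "real k \<le> 4 * M" using that by (simp add: Ms_def)
          also have "... \<le> 2 * real D / 1" unfolding M_def using Cpos Dpos by (simp add: field_simps)
          also have "... \<le> 4 * Y ^ 10" using D Y0 by simp
          finally show "real k \<le> Y ^ 20" by (rule le_Y_pow_20) simp
        qed
        show "norm (mangoldt n :: complex) \<le> L" if "real C \<le> real n" "real n \<le> 4 * real C" for n
          by (rule lam, rule le_Y_pow_20[of _ 15]) (use that C in auto)
      qed (use True MD c L0 finMs divs[OF _ _ MD] in \<open>auto simp: Ms_def\<close>)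
      then show ?thesis by (simp only: swap L3)
    next
      case False
      have "vaughan_coeff2 U k = 0" if "k \<in> Ms" for k
      proof (rule vaughan_coeff2_eq_0)
        show "k > 0" using M0 that by (cases k) (auto simp: Ms_def)
        have "real k \<le> real U" using that False U by (simp add: Ms_def)
        then show "k \<le> U" by simp
      qed
      then show ?thesis unfolding swap using L0 Y0 by simp
    qed
  qed
qed

end

section \<open>Sums over \<open>mangoldt\<close>, assembled from dyadic blocks\<close>

lemma sum_dyadic_blocks:
  fixes f :: "nat \<Rightarrow> 'a :: comm_monoid_add"
  shows "(\<Sum>m\<in>{U<..U * 2 ^ J}. f m) = (\<Sum>i<J. \<Sum>m\<in>{U * 2 ^ i<..2 * (U * 2 ^ i)}. f m)"
proof (induction J)
  case (Suc J)
  have le: "U \<le> U * 2 ^ J" by simp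
  have "{U<..U * 2 ^ Suc J} = {U<..U * 2 ^ J} \<union> {U * 2 ^ J<..2 * (U * 2 ^ J)}"
    by (auto intro: le_less_trans[OF le])
  then have "(\<Sum>m\<in>{U<..U * 2 ^ Suc J}. f m) = (\<Sum>m\<in>{U<..U * 2 ^ J}. f m) + (\<Sum>m\<in>{U * 2 ^ J<..2 * (U * 2 ^ J)}. f m)"
    by (simp only:) (rule sum.union_disjoint, auto)
  then show ?case using Suc by simp
qed simp

lemma sum_dyadic_blocks_from_1:
  fixes f :: "nat \<Rightarrow> 'a :: comm_monoid_add"
  shows "(\<Sum>h\<in>{1..2 ^ J - 1}. f h) = (\<Sum>j<J. \<Sum>h\<in>{2 ^ j..<2 * 2 ^ j}. f h)"
proof (induction J)
  case (Suc J)
  have "{1..2 ^ Suc J - 1} = {1..2 ^ J - 1} \<union> {2 ^ J..<2 * 2 ^ J :: nat}" by auto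
  then have "(\<Sum>h\<in>{1..2 ^ Suc J - 1}. f h) = (\<Sum>h\<in>{1..2 ^ J - 1}. f h) + (\<Sum>h\<in>{2 ^ J..<2 * 2 ^ J}. f h)"
    by (simp only:) (rule sum.union_disjoint, auto)
  then show ?case using Suc by simp
qed simp

lemma cnj_sgn_mult: "cnj (sgn z) * z = of_real (norm z)"
proof (cases "z = 0")
  case False
  have "cnj (sgn z) * z = (z * cnj z) / of_real (norm z)"
    by (simp add: sgn_div_norm scaleR_conv_of_real divide_simps mult_ac)
  also have "z * cnj z = of_real (norm z) * of_real (norm z)"
    by (simp only: complex_norm_square [symmetric] power2_eq_square of_real_mult)
  finally show ?thesis using False by simp
qed simp

context floor_sum_scale
begin

text \<open>Type II sums give the 1 in the last factor. In the type I sums each of about Y^4 values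
  m contributes (x h/D)^(1/2), in total Y^4 (Y^19 h/D)^(1/2) = Y^9 (Y^9 h/D)^(1/2), which is the
  square root.\<close>

lemma mangoldt_exponential_sum_bound:
  fixes D D' H :: nat
  assumes \<delta>: "0 \<le> \<delta>" "\<delta> \<le> 1" and D: "Y ^ 9 \<le> real D" "real D \<le> Y ^ 10" "D' \<le> 2 * D"
    and H: "1 \<le> H" "real H \<le> 2 * Y^2"
  shows "(\<Sum>h\<in>{H..<2*H}. norm (\<Sum>d\<in>{D<..D'}. mangoldt d * expi (real h * (x / (real d + \<delta>))))) \<le>
      4000000 * L ^ 4 * real H * Y ^ 9 * (1 + sqrt (Y ^ 9 / real D * real H))"
proof -
  note Dpos = pos_of_ge_Y_pow[OF D(1)]
  \<comment> \<open>Both parameters of Vaughan's identity are equal to U. The factor 4 is there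
    because a block of the short variable covers [M, 4 M]: a block that reaches beyond U then has M
    >= Y^2.\<close>
  define U where "U = nat \<lceil>4 * Y^2\<rceil>"
  have Y2: "Y^2 \<ge> 1" using Y1 by (rule one_le_power)
  have U: "4 * Y^2 \<le> real U" "real U \<le> 5 * Y^2" unfolding U_def using Y2 by linarith+
  have UU: "real (U * U) \<le> 25 * Y ^ 4"
  proof -
    have "real U * real U \<le> (5 * Y^2) * (5 * Y^2)" using U by (intro mult_mono) auto
    also have "... = 25 * Y ^ 4" by (simp add: power_numeral_reduce)
    finally show ?thesis by simp
  qed
  have UUD: "real (U * U) \<le> real D"
    using UU const_mult_Y_pow_le[of 25 1 4 9] D by simp
  have "U \<le> U * U" by (cases U) auto
  then have UD: "U \<le> U * U" "U * U \<le> D" using UUD by (simp_all only: of_nat_le_iff)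
  have Usub: "{1..U} \<subseteq> {1..U*U}"
    using UD(1) by (intro subsetI) (simp only: atLeastAtMost_iff, blast intro: order.trans)
  have "1 \<le> 2 * Y ^ 10" using one_le_power[OF Y1, of 10] by linarith
  moreover have "2 * Y ^ 10 \<le> Y ^ 13" by (rule const_mult_Y_pow_le[of _ 1]) auto
  \<comment> \<open>As D' <= 2 Y^10 <= 2^J, the blocks from U 2^i to U 2^(i+1) with i < J cover all
    c up to D'. The surplus values c > D' have no multiple in \<open>S\<close>.\<close>
  ultimately obtain J where J: "2 * Y ^ 10 \<le> 2 ^ J" "2 ^ J \<le> 2 * (2 * Y ^ 10)" "real J \<le> L"
    by (rule dyadic_exponent)
  define F where "F h d = expi (real h * (x / (real d + \<delta>)))" for h d :: nat
  define S where "S = {D<..D'}"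
  define E where "E h = (\<Sum>d\<in>S. mangoldt d * F h d)" for h
  define I1 where "I1 h = (\<Sum>b\<in>{1..U}. of_real (moebius_fun b) * (\<Sum>k | b * k \<in> S. of_real (ln (real k)) * F h (b * k)))" for h
  define I2 where "I2 h = (\<Sum>m\<in>{1..U*U}. of_real (vaughan_coeff1 U U m) * (\<Sum>k | m * k \<in> S. F h (m * k)))" for h
  define II where "II i h = (\<Sum>m\<in>{U * 2 ^ i<..2 * (U * 2 ^ i)}. mangoldt m * (\<Sum>k | m * k \<in> S. of_real (vaughan_coeff2 U k) * F h (m * k)))" for i h

  let ?v = "\<lambda>h c. \<Sum>k | c * k \<in> S. of_real (vaughan_coeff2 U k) * F h (c * k)"  have D'J: "real D' \<le> real (U * 2 ^ J)"
  proof -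
    have "real D' \<le> 2 * real D" using D(3) by simp
    also have "... \<le> 1 * 2 ^ J" using D(2) J(1) by simp
    also have "... \<le> real U * 2 ^ J" using U Y2 by (intro mult_right_mono) auto
    finally show ?thesis by simp
  qed
  then have D'J: "D' \<le> U * 2 ^ J" by (simp only: of_nat_le_iff)
  have decomp: "E h = I1 h - I2 h + (\<Sum>i<J. II i h)" for h
  proof -
    have "S \<subseteq> {U<..D'}" using order.trans[OF UD] by (auto simp: S_def)
    from vaughan[OF this, of "F h" U]
    have "E h = I1 h - I2 h + (\<Sum>c\<in>{U<..D'}. mangoldt c * (?v h c))"
      by (simp add: E_def I1_def I2_def)
    also have "(\<Sum>c\<in>{U<..D'}. mangoldt c * (?v h c)) =
        (\<Sum>c\<in>{U<..U * 2 ^ J}. mangoldt c * (?v h c))"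
    proof (rule sum.mono_neutral_left)
      show "\<forall>c\<in>{U<..U * 2 ^ J} - {U<..D'}. mangoldt c * (?v h c) = 0"
      proof
        fix c assume c: "c \<in> {U<..U * 2 ^ J} - {U<..D'}"
        have "c * k \<notin> S" for k
        proof (cases k)
          case (Suc k')
          have "D' < c" using c by auto
          also have "c \<le> c * k" using Suc by simp
          finally show ?thesis by (simp add: S_def)
        qed (simp add: S_def)
        then show "mangoldt c * (?v h c) = 0" by simp
      qed
    qed (use D'J in auto)
    also have "... = (\<Sum>i<J. II i h)" unfolding II_def by (rule sum_dyadic_blocks)
    finally show ?thesis .
  qed
  define z where "z = Y ^ 9 / real D * real H"
  have z: "z \<ge> 0" using Dpos Y0 by (simp add: z_def)
  \<comment> \<open>At most 25 Y^4 values m times 25000 * 2 Y^5 sqrt z, plus 300 Y^9 times the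
    harmonic sum, which is at most 2 L.\<close>
  let ?R = "(1250000 * Y ^ 9 * sqrt z + 600 * L * Y ^ 9)"
  define Bd where "Bd m h = 24576 * sqrt (x * real h / real D) + 300 * (real D / real m) * sqrt (real D / (x * real h))" for m h :: nat
  have Bd0: "0 \<le> Bd m h" for m h using x_pos by (simp add: Bd_def)
  let ?B = "\<lambda>h. \<Sum>m\<in>{1..U*U}. Bd m h"
  have partial: "norm (\<Sum>k\<in>{Suc (D div m)..<b}. F h (m * k)) \<le> Bd m h"
    if "m \<in> {1..U*U}" "b \<le> Suc (D' div m)" "h \<ge> 1" for m b h
    unfolding F_def Bd_def using that UD
    by (intro type_I_bound[OF x_pos \<delta> _ _ _ D(3)]) auto
  have inner2: "norm (\<Sum>k | m * k \<in> S. F h (m * k)) \<le> Bd m h" if "m \<in> {1..U*U}" "h \<ge> 1" for m h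
    using partial[OF that(1) order.refl that(2)] that multiples_interval[of m D D'] by (simp add: S_def)
  have inner1: "norm (\<Sum>k | m * k \<in> S. of_real (ln (real k)) * F h (m * k)) \<le> 2 * L * Bd m h"
    if m: "m \<in> {1..U*U}" and h: "h \<ge> 1" for m h
  proof -
    let ?I = "{Suc (D div m)..<Suc (D' div m)}"
    \<comment> \<open>The weight ln k increases, so it is written as the constant L minus the
      nonnegative decreasing weight L - ln k.\<close>
    have "norm (\<Sum>k\<in>?I. of_real (L - ln (real k)) * F h (m * k)) \<le> L * Bd m h"
    proof (rule norm_sum_antimono_weights_le[OF partial[OF m _ h]])
      fix k assume k: "Suc (D div m) \<le> k" "k < Suc (D' div m)"
      have "D' div m \<le> D'" by (rule div_le_dividend)
      then have "real k \<le> 4 * Y ^ 10" using k D by linarith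
      then have "real k \<le> Y ^ 20" by (rule le_Y_pow_20) simp
      then show "0 \<le> L - ln (real k) \<and> L - ln (real k) \<le> L" using k ln_nat_le[of k] by auto
    qed (use L0 in auto)
    moreover have "norm (of_real L * (\<Sum>k\<in>?I. F h (m * k))) \<le> L * Bd m h"
      using partial[OF m order.refl h] L0 by (simp add: norm_mult mult_left_mono)
    ultimately have "norm (of_real L * (\<Sum>k\<in>?I. F h (m * k)) - (\<Sum>k\<in>?I. of_real (L - ln (real k)) * F h (m * k)))
        \<le> L * Bd m h + L * Bd m h"
      by (intro order.trans[OF norm_triangle_ineq4] add_mono)
    moreover have "of_real L * (\<Sum>k\<in>?I. F h (m * k)) - (\<Sum>k\<in>?I. of_real (L - ln (real k)) * F h (m * k)) =
        (\<Sum>k\<in>?I. of_real (ln (real k)) * F h (m * k))"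
      by (simp add: sum_distrib_left left_diff_distrib sum_subtractf del: sum.op_ivl_Suc)
    ultimately show ?thesis using multiples_interval[of m D D'] m by (simp add: S_def)
  qed
  have sumBd: "(?B h) \<le> ?R" if h: "h \<in> {H..<2*H}" for h
  proof -
    have h1: "1 \<le> real h" "real h \<le> 2 * real H" using h H by auto
    have "real U > 0" using U Y2 by linarith
    then have UU1: "1 \<le> U * U" by (simp add: Suc_le_eq)
    have s1: "sqrt (x * real h / real D) \<le> 2 * Y ^ 5 * sqrt z"
    proof -
      have "x * real h / real D \<le> x * (2 * real H) / real D"
        using h1 x_pos by (intro divide_right_mono mult_left_mono) auto
      also have "... = 2 * (Y ^ 5)^2 * z" by (simp add: x_eq z_def power_numeral_reduce)
      also have "... \<le> (2 * Y ^ 5)^2 * z" using z by (intro mult_right_mono) (auto simp: power_mult_distrib)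
      finally have "sqrt (x * real h / real D) \<le> sqrt ((2 * Y ^ 5)^2 * z)" by (rule real_sqrt_le_mono)
      then show ?thesis using Y0 by (subst (asm) sqrt_square_mult) auto
    qed
    have s2: "real D * sqrt (real D / (x * real h)) \<le> Y ^ 9"
    proof -
      have "real D / (x * real h) \<le> Y ^ 10 / (x * 1)"
        using D h1 x_pos by (intro frac_le mult_left_mono) auto
      also have "... = 1 / Y ^ 9" using Y0 by (simp add: x_eq field_simps)
      also have "... \<le> 1 / Y^2" using Y_pow_mono[of 2 9] Y0 by (intro divide_left_mono) auto
      finally have "sqrt (real D / (x * real h)) \<le> sqrt ((1 / Y)^2)"
        by (intro real_sqrt_le_mono) (simp add: power_divide)
      then have "sqrt (real D / (x * real h)) \<le> 1 / Y" using Y0 by simp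
      then have "real D * sqrt (real D / (x * real h)) \<le> Y ^ 10 * (1 / Y)"
        using D x_pos by (intro mult_mono) auto
      also have "... = Y ^ 9" using Y0 by (simp add: power_numeral_reduce)
      finally show ?thesis .
    qed
    have harm: "(\<Sum>m\<in>{1..U*U}. 1 / real m) \<le> 2 * L"
    proof -
      have "real (U * U) \<le> Y ^ 20" using UU const_mult_Y_pow_le[of 25 1 4 20] by simp
      then have "ln (real (U * U)) \<le> L" using UU1 by (intro ln_nat_le) auto
      then show ?thesis using harmonic_sum_le[OF UU1] L1 by linarith
    qed
    have "(?B h) = real (U * U) * (24576 * sqrt (x * real h / real D)) +
        300 * (real D * sqrt (real D / (x * real h))) * (\<Sum>m\<in>{1..U*U}. 1 / real m)"
      by (simp add: Bd_def sum.distrib sum_distrib_left mult_ac)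
    also have "... \<le> (25 * Y ^ 4) * (25000 * (2 * Y ^ 5 * sqrt z)) + 300 * Y ^ 9 * (2 * L)"
      using UU s1 s2 harm Y0 x_pos by (intro add_mono mult_mono) (auto intro!: sum_nonneg)
    also have "... = ?R" by (simp add: power_numeral_reduce)
    finally show ?thesis .
  qed
  have typeI: "norm (I1 h) + norm (I2 h) \<le> 3 * L * ?R"
    if h: "h \<in> {H..<2*H}" for h
  proof -
    have h1: "h \<ge> 1" using h H by auto
    have "norm (I1 h) \<le> (\<Sum>b\<in>{1..U}. 2 * L * Bd b h)"
      unfolding I1_def
    proof (rule sum_norm_le)
      fix b assume b: "b \<in> {1..U}"
      then have "b \<in> {1..U*U}" using Usub by blast
      from inner1[OF this h1]
      have "\<bar>moebius_fun b\<bar> * norm (\<Sum>k | b * k \<in> S. of_real (ln (real k)) * F h (b * k)) \<le> 1 * (2 * L * Bd b h)"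
        by (intro mult_mono abs_moebius_fun_le) auto
      then show "norm (of_real (moebius_fun b) * (\<Sum>k | b * k \<in> S. of_real (ln (real k)) * F h (b * k))) \<le> 2 * L * Bd b h"
        by (simp add: norm_mult)
    qed
    also have "... \<le> (\<Sum>b\<in>{1..U*U}. 2 * L * Bd b h)"
      using Bd0 L0 by (intro sum_mono2 Usub) auto
    finally have a: "norm (I1 h) \<le> 2 * L * (?B h)" by (simp add: sum_distrib_left)
    have "norm (I2 h) \<le> (\<Sum>m\<in>{1..U*U}. L * Bd m h)"
      unfolding I2_def
    proof (rule sum_norm_le)
      fix m assume m: "m \<in> {1..U*U}"
      have "real m \<le> real (U * U)" using m by (intro of_nat_mono) auto
      also have "... \<le> Y ^ 20" using UU const_mult_Y_pow_le[of 25 1 4 20] by simp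
      finally have "\<bar>vaughan_coeff1 U U m\<bar> \<le> L"
        using m abs_vaughan_coeff1_le[of m U U] ln_nat_le[of m] by simp
      then have "\<bar>vaughan_coeff1 U U m\<bar> * norm (\<Sum>k | m * k \<in> S. F h (m * k)) \<le> L * Bd m h"
        using inner2[OF m h1] L0 by (intro mult_mono) auto
      then show "norm (of_real (vaughan_coeff1 U U m) * (\<Sum>k | m * k \<in> S. F h (m * k))) \<le> L * Bd m h"
        by (simp add: norm_mult)
    qed
    then have "norm (I2 h) \<le> L * (?B h)" by (simp add: sum_distrib_left)
    with a have "norm (I1 h) + norm (I2 h) \<le> 3 * L * (?B h)" by (simp add: algebra_simps)
    also have "... \<le> 3 * L * ?R"
      using sumBd[OF h] L0 by (intro mult_left_mono) auto
    finally show ?thesis .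
  qed
  \<comment> \<open>These phases turn the sum of norms into a linear expression in
    \<open>E h\<close>, so that the type II sums over h and m are estimated jointly and not for each
    h separately.\<close>
  define c where "c h = cnj (sgn (E h))" for h
  let ?I = "(\<Sum>h\<in>{H..<2*H}. c h * (I1 h - I2 h))"
  let ?II = "(\<Sum>i<J. \<Sum>h\<in>{H..<2*H}. c h * II i h)"
  have c: "norm (c h) \<le> 1" for h by (simp add: c_def norm_sgn)
  have typeII: "norm (\<Sum>h\<in>{H..<2*H}. c h * II i h) \<le> 11000 * L ^ 3 * real H * Y ^ 9" if "i < J" for i
    unfolding II_def F_def S_def
  proof (rule type_II_block[OF \<delta> D H _ _ U(1) c])
    have "real U * 1 \<le> real U * 2 ^ i" by (intro mult_left_mono) auto
    then have "Y^2 \<le> real U * 2 ^ i" using U Y2 by linarith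
    then show "Y^2 \<le> real (U * 2 ^ i)" by simp
    have "(2::real) ^ i \<le> 2 ^ J" using that by (intro power_increasing) auto
    then have "(2::real) ^ i \<le> 4 * Y ^ 10" using J(2) by linarith
    then have "real U * 2 ^ i \<le> (5 * Y^2) * (4 * Y ^ 10)"
      using U by (intro mult_mono) auto
    also have "... = 20 * Y ^ 12" by (simp flip: power_add)
    also have "... \<le> Y ^ 15" by (rule const_mult_Y_pow_le[of _ 1]) auto
    finally show "real (U * 2 ^ i) \<le> Y ^ 15" by simp
  qed
  have "complex_of_real (\<Sum>h\<in>{H..<2*H}. norm (E h)) = (\<Sum>h\<in>{H..<2*H}. c h * E h)"
    by (simp add: c_def cnj_sgn_mult)
  also have "... = ?I + ?II"
  proof -
    have "?II = (\<Sum>h\<in>{H..<2*H}. c h * (\<Sum>i<J. II i h))"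
      unfolding sum_distrib_left by (rule sum.swap)
    then show ?thesis by (simp add: decomp distrib_left sum.distrib)
  qed
  finally have "norm (complex_of_real (\<Sum>h\<in>{H..<2*H}. norm (E h))) \<le>
      norm ?I + norm ?II"
    by (simp only: norm_triangle_ineq)
  then have "(\<Sum>h\<in>{H..<2*H}. norm (E h)) \<le>
      norm ?I + norm ?II"
    by (simp only: norm_of_real abs_of_nonneg[OF sum_nonneg[OF norm_ge_zero]])
  also have "norm ?I \<le> (\<Sum>h\<in>{H..<2*H}. 3 * L * ?R)"
  proof (rule sum_norm_le)
    fix h assume h: "h \<in> {H..<2*H}"
    have "norm (c h * (I1 h - I2 h)) \<le> 1 * (norm (I1 h) + norm (I2 h))"
      unfolding norm_mult by (intro mult_mono c norm_triangle_ineq4) auto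
    then show "norm (c h * (I1 h - I2 h)) \<le> 3 * L * ?R"
      unfolding mult_1 by (rule order.trans[OF _ typeI[OF h]])
  qed
  also have "norm ?II \<le> (\<Sum>i<J. 11000 * L ^ 3 * real H * Y ^ 9)"
    by (rule sum_norm_le) (use typeII in auto)
  also have "(\<Sum>i<J. 11000 * L ^ 3 * real H * Y ^ 9) \<le> L * (11000 * L ^ 3 * real H * Y ^ 9)"
    using J(3) L0 Y0 mult_right_mono[of "real J" L "11000 * L ^ 3 * real H * Y ^ 9"] by simp
  also have "(\<Sum>h\<in>{H..<2*H}. 3 * L * ?R) + L * (11000 * L ^ 3 * real H * Y ^ 9) =
      (real H * Y ^ 9) * (3750000 * (L * sqrt z) + 1800 * L^2 + 11000 * L ^ 4)"
    by (simp add: algebra_simps power_numeral_reduce)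
  also have "... \<le> (real H * Y ^ 9) * (3750000 * (L ^ 4 * sqrt z) + 1800 * L ^ 4 + 11000 * L ^ 4)"
  proof -
    have "L ^ 1 \<le> L ^ 4" "L^2 \<le> L ^ 4" using L1 by (intro power_increasing; simp)+
    then show ?thesis using Y0 z by (intro mult_left_mono add_mono mult_right_mono) auto
  qed
  also have "... \<le> (real H * Y ^ 9) * (4000000 * L ^ 4 * (1 + sqrt z))"
    using Y0 z L0 by (intro mult_left_mono) (auto simp: algebra_simps)
  finally show ?thesis by (simp add: E_def F_def S_def z_def mult_ac)
qed

text \<open>The width Delta = Y^9/D makes the smoothing cost D L Delta = L Y^9, and H >= 1/Delta^2
  makes the tail 1/(Delta H) at most Delta.\<close>

lemma mangoldt_saw_sum_bound:
  fixes D D' :: nat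
  assumes \<delta>: "0 \<le> \<delta>" "\<delta> \<le> 1" and D: "Y ^ 9 \<le> real D" "real D \<le> Y ^ 10" "D' \<le> 2 * D"
  shows "\<bar>\<Sum>d\<in>{D<..D'}. mangoldt d * saw (x / (real d + \<delta>))\<bar> \<le> 10000000 * L ^ 5 * Y ^ 9"
proof -
  note Dpos = pos_of_ge_Y_pow[OF D(1)]
  define \<Delta> where "\<Delta> = Y ^ 9 / real D"
  have \<Delta>: "0 < \<Delta>" "\<Delta> \<le> 1" using D Dpos Y0 by (simp_all add: \<Delta>_def)
  \<comment> \<open>The additional 1 compensates for the last frequency being 2^J - 1, so that the
    frequencies split into complete dyadic blocks.\<close>
  define K where "K = 1 / \<Delta>^2 + 1"
  have K: "2 \<le> K" "K \<le> 2 * Y^2"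
  proof -
    have "real D \<le> Y * Y ^ 9" using D by (simp flip: power_Suc)
    then have "1 \<le> 1 / \<Delta>" "1 / \<Delta> \<le> Y" using D Dpos Y0 by (simp_all add: \<Delta>_def divide_le_eq)
    then have "1 \<le> (1 / \<Delta>)^2" "(1 / \<Delta>)^2 \<le> Y^2" using \<Delta> by (auto intro!: one_le_power power_mono)
    then show "2 \<le> K" "K \<le> 2 * Y^2" by (simp_all add: K_def power_divide)
  qed
  have "2 * Y^2 \<le> Y ^ 13" by (rule const_mult_Y_pow_le[of _ 1]) auto
  then obtain J where J: "K \<le> 2 ^ J" "2 ^ J \<le> 2 * K" "real J \<le> L"
    using dyadic_exponent[of K] K by auto
  have J2: "2 ^ j \<le> 2 * Y^2" if "j < J" for j
  proof -
    have "(2::real) ^ Suc j \<le> 2 ^ J" using that by (intro power_increasing) auto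
    then show ?thesis using J(2) K(2) by simp
  qed
  define H where "H = (2::nat) ^ J - 1"
  have realH: "real H = 2 ^ J - 1" unfolding H_def by (simp add: of_nat_diff)
  have H: "H > 0" "1 / \<Delta>^2 \<le> real H"
  proof -
    show "1 / \<Delta>^2 \<le> real H" using J(1) by (simp add: realH K_def)
    have "real H > 0" using J(1) K by (simp add: realH)
    then show "H > 0" by simp
  qed
  define E where "E h = norm (\<Sum>d\<in>{D<..D'}. complex_of_real (mangoldt d) * expi (real h * (x / (real d + \<delta>))))" for h :: nat
  define g where "g h = min (1 / real h) (1 / (\<Delta> * real h ^ 2))" for h :: nat
  have main: "\<bar>\<Sum>d\<in>{D<..D'}. mangoldt d * saw (x / (real d + \<delta>))\<bar> \<le>
      (\<Sum>d\<in>{D<..D'}. mangoldt d) * (\<Delta> + 1 / (\<Delta> * real H)) + (\<Sum>h=1..H. g h * E h)"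
    unfolding g_def E_def by (rule sum_saw_bound[OF _ _ \<Delta> H(1)]) (auto simp: mangoldt_nonneg)
  have W: "(\<Sum>d\<in>{D<..D'}. mangoldt d) * (\<Delta> + 1 / (\<Delta> * real H)) \<le> 2 * L * Y ^ 9"
  proof -
    have "(\<Sum>d\<in>{D<..D'}. mangoldt d :: real) \<le> (\<Sum>d\<in>{D<..D'}. L)"
    proof (rule sum_mono, rule mangoldt_le_L)
      fix d assume "d \<in> {D<..D'}"
      then have "real d \<le> 4 * Y ^ 10" using D by auto
      then show "real d \<le> Y ^ 20" by (rule le_Y_pow_20) simp
    qed
    also have "... \<le> real D * L" using D(3) L0 by (auto intro!: mult_right_mono)
    finally have a: "(\<Sum>d\<in>{D<..D'}. mangoldt d :: real) \<le> real D * L" .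
    have "1 / (\<Delta> * real H) \<le> 1 / (\<Delta> * (1 / \<Delta>^2))"
      using H \<Delta> by (intro divide_left_mono mult_left_mono) auto
    also have "... = \<Delta>" using \<Delta> by (simp add: power2_eq_square)
    finally have b: "\<Delta> + 1 / (\<Delta> * real H) \<le> 2 * \<Delta>" by simp
    have "(\<Sum>d\<in>{D<..D'}. mangoldt d) * (\<Delta> + 1 / (\<Delta> * real H)) \<le> (real D * L) * (2 * \<Delta>)"
      using a b \<Delta> L0 by (intro mult_mono) auto
    also have "... = 2 * L * Y ^ 9" using Dpos by (simp add: \<Delta>_def)
    finally show ?thesis .
  qed
  have block: "(\<Sum>h\<in>{2 ^ j..<2 * 2 ^ j}. g h * E h) \<le> 8000000 * L ^ 4 * Y ^ 9" if j: "j < J" for j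
  proof -
    define G where "G = (2::nat) ^ j"
    have G: "1 \<le> G" "real G \<le> 2 * Y^2" "0 < real G" using J2[OF j] by (simp_all add: G_def)
    define z where "z = \<Delta> * real G"
    have z: "z > 0" using \<Delta> G by (simp add: z_def)
    have gG: "g h \<le> min 1 (1 / z) / real G" if "h \<in> {G..<2*G}" for h
    proof -
      have hG: "real G \<le> real h" using that by simp
      have "1 / real h \<le> 1 / real G" using hG G by (intro divide_left_mono) auto
      moreover have "1 / (\<Delta> * real h ^ 2) \<le> 1 / (\<Delta> * real G ^ 2)"
        using hG G \<Delta> by (intro divide_left_mono mult_left_mono power_mono) auto
      moreover have "1 / (\<Delta> * real G ^ 2) = 1 / z / real G" by (simp add: z_def power2_eq_square)
      ultimately show ?thesis using G by (simp add: g_def min_def divide_right_mono)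
    qed
    have "(\<Sum>h\<in>{G..<2*G}. g h * E h) \<le> (\<Sum>h\<in>{G..<2*G}. min 1 (1 / z) / real G * E h)"
      by (intro sum_mono mult_right_mono gG) (auto simp: E_def)
    also have "... = min 1 (1 / z) / real G * (\<Sum>h\<in>{G..<2*G}. E h)" by (simp add: sum_distrib_left)
    also have "... \<le> min 1 (1 / z) / real G * (4000000 * L ^ 4 * real G * Y ^ 9 * (1 + sqrt z))"
    proof (rule mult_left_mono)
      show "(\<Sum>h\<in>{G..<2*G}. E h) \<le> 4000000 * L ^ 4 * real G * Y ^ 9 * (1 + sqrt z)"
        using mangoldt_exponential_sum_bound[OF \<delta> D G(1,2)] by (simp add: E_def z_def \<Delta>_def)
      show "0 \<le> min 1 (1 / z) / real G" using z by (simp add: min_def)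
    qed
    also have "... = 4000000 * L ^ 4 * Y ^ 9 * (min 1 (1 / z) * (1 + sqrt z))"
      using G by simp
    also have "... \<le> 4000000 * L ^ 4 * Y ^ 9 * 2"
    proof (rule mult_left_mono)
      \<comment> \<open>Beyond z = 1 the decay 1/z of the Fourier coefficients outweighs the loss
        sqrt z of the type I sums.\<close>
      show "min 1 (1 / z) * (1 + sqrt z) \<le> 2"
      proof (cases "z \<le> 1")
        case True
        then have "min 1 (1 / z) * (1 + sqrt z) \<le> 1 * (1 + 1)" using z by (intro mult_mono) auto
        then show ?thesis by simp
      next
        case False
        then have "sqrt z \<le> sqrt (z^2)" by (intro real_sqrt_le_mono) (simp add: power2_eq_square)
        then have "sqrt z \<le> z" using z by simp
        then have "min 1 (1 / z) * (1 + sqrt z) \<le> (1 / z) * (z + z)" using False z by (intro mult_mono) auto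
        then show ?thesis using z by simp
      qed
    qed (use L0 Y0 in auto)
    finally show ?thesis by (simp add: G_def)
  qed
  have "(\<Sum>h=1..H. g h * E h) = (\<Sum>j<J. \<Sum>h\<in>{2 ^ j..<2 * 2 ^ j}. g h * E h)"
    unfolding H_def by (rule sum_dyadic_blocks_from_1)
  also have "... \<le> (\<Sum>j<J. 8000000 * L ^ 4 * Y ^ 9)" by (intro sum_mono block) auto
  also have "... = real J * (8000000 * L ^ 4 * Y ^ 9)" by simp
  also have "... \<le> L * (8000000 * L ^ 4 * Y ^ 9)" using J(3) L0 Y0 by (intro mult_right_mono) auto
  also have "... = 8000000 * L ^ 5 * Y ^ 9" by (simp add: power_numeral_reduce)
  finally have "\<bar>\<Sum>d\<in>{D<..D'}. mangoldt d * saw (x / (real d + \<delta>))\<bar> \<le> 2 * L * Y ^ 9 + 8000000 * L ^ 5 * Y ^ 9"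
    using main W by linarith
  also have "2 * L * Y ^ 9 \<le> 2 * L ^ 5 * Y ^ 9"
    using power_increasing[of 1 5 L] L1 Y0 by (intro mult_right_mono mult_left_mono) auto
  also have "2 * L ^ 5 * Y ^ 9 + 8000000 * L ^ 5 * Y ^ 9 \<le> 10000000 * L ^ 5 * Y ^ 9"
    using L0 Y0 by (simp add: algebra_simps)
  finally show ?thesis by simp
qed

end

section \<open>The floor sums\<close>

lemma abs_saw_le: "\<bar>saw t\<bar> \<le> 1/2"
  unfolding saw_def using frac_ge_0[of t] frac_lt_1[of t] by linarith

lemma sum_inverse_pronic_le:
  assumes "finite F" "F \<subseteq> {K<..}"
  shows "(\<Sum>d\<in>F. 1 / (real d * (real d + 1))) \<le> 1 / (real K + 1)"
proof -
  have tele: "(\<Sum>d\<in>{K<..K + j}. 1 / (real d * (real d + 1))) = 1 / (real K + 1) - 1 / (real (K + j) + 1)" for j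
  proof (induction j)
    case (Suc j)
    have "{K<..K + Suc j} = insert (K + Suc j) {K<..K + j}" by auto
    then have "(\<Sum>d\<in>{K<..K + Suc j}. 1 / (real d * (real d + 1))) =
        1 / (real (K + Suc j) * (real (K + Suc j) + 1)) + (1 / (real K + 1) - 1 / (real (K + j) + 1))"
      using Suc by simp
    also have "... = 1 / (real K + 1) - 1 / (real (K + Suc j) + 1)"
      by (simp add: divide_simps) (simp add: algebra_simps)?
    finally show ?case .
  qed simp
  obtain m where m: "\<forall>d\<in>F. d \<le> m" using finite_nat_set_iff_bounded_le[of F] assms(1) by blast
  have "(\<Sum>d\<in>F. 1 / (real d * (real d + 1))) \<le> (\<Sum>d\<in>{K<..K + m}. 1 / (real d * (real d + 1)))"
    using assms m by (intro sum_mono2) (auto simp: trans_le_add2)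
  also have "... \<le> 1 / (real K + 1)" unfolding tele by simp
  finally show ?thesis .
qed

lemma pronic_tail_bounds:
  fixes S :: "nat set" and K :: nat
  defines "C \<equiv> (\<Sum>\<^sub>\<infinity>d\<in>S. 1 / (real d * (real d + 1)))"
  assumes "0 \<notin> S"
  shows "0 \<le> C - (\<Sum>d\<in>{1..K}. indicator S d * (1 / (real d * (real d + 1))))" (is "_ \<le> ?G")
    and "C - (\<Sum>d\<in>{1..K}. indicator S d * (1 / (real d * (real d + 1)))) \<le> 1 / (real K + 1)"
proof -
  define g where "g d = 1 / (real d * (real d + 1))" for d :: nat
  have sm: "g summable_on A" for A unfolding g_def by (rule summable_on_inverse_pronic)
  have "S = (S \<inter> {1..K}) \<union> (S \<inter> {K<..})" using assms(2) by (auto simp: Suc_le_eq intro!: Nat.gr0I)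
  then have "C = infsum g ((S \<inter> {1..K}) \<union> (S \<inter> {K<..}))"
    unfolding C_def g_def [abs_def] by (rule arg_cong)
  also have "... = infsum g (S \<inter> {1..K}) + infsum g (S \<inter> {K<..})"
    by (rule infsum_Un_disjoint[OF sm sm]) auto
  also have "infsum g (S \<inter> {1..K}) = (\<Sum>d\<in>S \<inter> {1..K}. g d)" by simp
  also have "... = (\<Sum>d\<in>{1..K}. indicator S d * g d)"
    by (rule sum.mono_neutral_cong_left) (auto simp: indicator_def split: if_splits)
  finally have eq: "C - (\<Sum>d\<in>{1..K}. indicator S d * g d) = infsum g (S \<inter> {K<..})" by simp
  show "0 \<le> ?G"
    using eq infsum_nonneg[of "S \<inter> {K<..}" g] by (simp add: g_def)
  have "infsum g (S \<inter> {K<..}) \<le> 1 / (real K + 1)"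
    by (rule infsum_le_finite_sums[OF sm]) (auto simp: g_def intro!: sum_inverse_pronic_le)
  then show "?G \<le> 1 / (real K + 1)"
    using eq by (simp add: g_def)
qed

lemma card_floor_quotient_eq:
  assumes x: "x > 0" and d: "d \<ge> 1"
  shows "real (card {n. n \<ge> 1 \<and> real n \<le> x \<and> nat \<lfloor>x / real n\<rfloor> = d}) =
    x * (1 / (real d * (real d + 1))) + saw (x / (real d + 1)) - saw (x / real d)"
proof -
  have d0: "real d > 0" "real d \<ge> 1" using d by simp_all
  have fl: "nat \<lfloor>y\<rfloor> < n \<longleftrightarrow> y < real n" if "y \<ge> 0" for y and n :: nat
    using that by (simp add: nat_less_iff floor_less_iff)
  have "{n. n \<ge> 1 \<and> real n \<le> x \<and> nat \<lfloor>x / real n\<rfloor> = d} = {nat \<lfloor>x / (real d + 1)\<rfloor><..nat \<lfloor>x / real d\<rfloor>}"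
  proof (intro set_eqI)
    fix n :: nat
    have a: "nat \<lfloor>x / (real d + 1)\<rfloor> < n \<longleftrightarrow> x < real n * (real d + 1)"
      using fl[of "x / (real d + 1)" n] x d0 by (simp add: divide_less_eq)
    have b: "n \<le> nat \<lfloor>x / real d\<rfloor> \<longleftrightarrow> real n * real d \<le> x"
      using fl[of "x / real d" n] x d0 by (simp add: divide_less_eq linorder_not_less [symmetric] del: linorder_not_less)
    show "n \<in> {n. n \<ge> 1 \<and> real n \<le> x \<and> nat \<lfloor>x / real n\<rfloor> = d} \<longleftrightarrow>
        n \<in> {nat \<lfloor>x / (real d + 1)\<rfloor><..nat \<lfloor>x / real d\<rfloor>}"
    proof (cases "n = 0")
      case False
      then have n: "real n > 0" by simp
      have "nat \<lfloor>x / real n\<rfloor> = d \<longleftrightarrow> \<lfloor>x / real n\<rfloor> = int d" using x n by (auto simp: nat_eq_iff)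
      also have "... \<longleftrightarrow> real d \<le> x / real n \<and> x / real n < real d + 1" by (simp add: floor_eq_iff)
      also have "... \<longleftrightarrow> real n * real d \<le> x \<and> x < real n * (real d + 1)"
        using n by (simp add: le_divide_eq divide_less_eq mult.commute)
      finally have c: "nat \<lfloor>x / real n\<rfloor> = d \<longleftrightarrow> real n * real d \<le> x \<and> x < real n * (real d + 1)" .
      have "real n \<le> x" if "real n * real d \<le> x"
        using that mult_left_mono[OF d0(2), of "real n"] by simp
      then show ?thesis using a b c False by auto
    qed simp
  qed
  then have "real (card {n. n \<ge> 1 \<and> real n \<le> x \<and> nat \<lfloor>x / real n\<rfloor> = d}) =
      real (nat \<lfloor>x / real d\<rfloor> - nat \<lfloor>x / (real d + 1)\<rfloor>)" by simp
  also have "... = real_of_int \<lfloor>x / real d\<rfloor> - real_of_int \<lfloor>x / (real d + 1)\<rfloor>"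
  proof -
    have "x / (real d + 1) \<le> x / real d" using x d0 by (intro divide_left_mono) auto
    then have "\<lfloor>x / (real d + 1)\<rfloor> \<le> \<lfloor>x / real d\<rfloor>" by (rule floor_mono)
    moreover have "0 \<le> \<lfloor>x / (real d + 1)\<rfloor>" using x d0 by simp
    ultimately have "int (nat \<lfloor>x / real d\<rfloor> - nat \<lfloor>x / (real d + 1)\<rfloor>) = \<lfloor>x / real d\<rfloor> - \<lfloor>x / (real d + 1)\<rfloor>"
      by linarith
    then show ?thesis by (metis of_int_diff of_int_of_nat_eq)
  qed
  also have "... = (x / real d - x / (real d + 1)) + saw (x / (real d + 1)) - saw (x / real d)"
    by (simp add: saw_def frac_def)
  also have "x / real d - x / (real d + 1) = x * (1 / (real d * (real d + 1)))"
    using d0 by (simp add: field_simps)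
  finally show ?thesis .
qed

context floor_sum_scale
begin

definition D0 :: nat where "D0 = nat \<lceil>Y ^ 9\<rceil>"

lemma D0_bounds: "Y ^ 9 \<le> real D0" "real D0 \<le> 2 * Y ^ 9" "3 \<le> D0"
proof -
  have "1000 * 1 \<le> Y * Y ^ 8" using Y_ge one_le_power[OF Y1, of 8] by (intro mult_mono) auto
  then have Y9: "1000 \<le> Y ^ 9" by (simp flip: power_Suc)
  then show "Y ^ 9 \<le> real D0" "real D0 \<le> 2 * Y ^ 9" unfolding D0_def by linarith+
  then have "3 \<le> real D0" using Y9 by linarith
  then show "3 \<le> D0" by linarith
qed

text \<open>All end points \<open>k\<close> are needed because the weight of \<open>mangoldt\<close>
  is later removed by partial summation. The induction peels off the topmost dyadic range. From Y^9
  to Y^10 there are O(log Y) of them, which costs one more factor L.\<close>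

lemma mangoldt_saw_initial_sum_bound:
  assumes \<delta>: "0 \<le> \<delta>" "\<delta> \<le> 1" and k: "real k \<le> Y ^ 10"
  shows "\<bar>\<Sum>d\<in>{D0<..k}. mangoldt d * saw (x / (real d + \<delta>))\<bar> \<le> 10000000 * L ^ 6 * Y ^ 9"
proof -
  define B where "B = 10000000 * L ^ 5 * Y ^ 9"
  have B: "B \<ge> 0" using L0 Y0 by (simp add: B_def)
  have step: "\<bar>\<Sum>d\<in>{D0<..k}. mangoldt d * saw (x / (real d + \<delta>))\<bar> \<le> real J * B"
    if "k \<le> D0 * 2 ^ J" "real k \<le> Y ^ 10" for J k
    using that
  proof (induction J arbitrary: k)
    case (Suc J)
    show ?case
    proof (cases "k \<le> D0 * 2 ^ J")
      case True
      from Suc.IH[OF True Suc.prems(2)] show ?thesis using B by (simp add: algebra_simps)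
    next
      case False
      define D where "D = D0 * 2 ^ J"
      have "D \<le> k" "k \<le> 2 * D" using False Suc.prems by (auto simp: D_def)
      moreover from this have "real D \<le> real k" by simp
      ultimately have D: "D \<le> k" "k \<le> 2 * D" "real D \<le> Y ^ 10" using Suc.prems(2) by simp_all
      have le: "D0 \<le> D" by (simp add: D_def)
      have "real D0 \<le> real D" using le by (rule of_nat_mono)
      then have YD: "Y ^ 9 \<le> real D" using D0_bounds(1) by linarith
      have "{D0<..k} = {D0<..D} \<union> {D<..k}" using D le by auto
      then have "(\<Sum>d\<in>{D0<..k}. mangoldt d * saw (x / (real d + \<delta>))) =
          (\<Sum>d\<in>{D0<..D}. mangoldt d * saw (x / (real d + \<delta>))) + (\<Sum>d\<in>{D<..k}. mangoldt d * saw (x / (real d + \<delta>)))"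
        by (simp only:) (rule sum.union_disjoint, auto)
      moreover have "\<bar>\<Sum>d\<in>{D0<..D}. mangoldt d * saw (x / (real d + \<delta>))\<bar> \<le> real J * B"
        by (rule Suc.IH) (use D in \<open>auto simp: D_def\<close>)
      moreover have "\<bar>\<Sum>d\<in>{D<..k}. mangoldt d * saw (x / (real d + \<delta>))\<bar> \<le> B"
        unfolding B_def by (rule mangoldt_saw_sum_bound[OF \<delta> YD D(3,2)])
      ultimately show ?thesis by (simp add: algebra_simps)
    qed
  qed simp
  have "Y \<le> Y ^ 13" using Y_pow_mono[of 1 13] by simp
  with Y1 obtain J where J: "Y \<le> 2 ^ J" "2 ^ J \<le> 2 * Y" "real J \<le> L" by (rule dyadic_exponent)
  have "real k \<le> Y ^ 9 * Y" using k by (simp add: power_numeral_reduce)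
  also have "... \<le> real D0 * 2 ^ J" using D0_bounds J(1) Y0 by (intro mult_mono) auto
  finally have "real k \<le> real (D0 * 2 ^ J)" by simp
  then have "k \<le> D0 * 2 ^ J" by (simp only: of_nat_le_iff)
  from step[OF this k] have "\<bar>\<Sum>d\<in>{D0<..k}. mangoldt d * saw (x / (real d + \<delta>))\<bar> \<le> real J * B" .
  also have "... \<le> L * B" using J(3) B by (intro mult_right_mono)
  also have "... = 10000000 * L ^ 6 * Y ^ 9" by (simp add: B_def power_numeral_reduce)
  finally show ?thesis .
qed

text \<open>Such a number is p^k with k >= 2, so p <= Y^5, while 2^k <= Y^10 leaves at most L
  exponents.\<close>

lemma card_proper_prime_powers_le:
  assumes "real K \<le> Y ^ 10"
  shows "real (card {d\<in>{1..K}. primepow d \<and> \<not> prime d}) \<le> L * Y ^ 9"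
proof -
  define P where "P = nat \<lfloor>Y ^ 5\<rfloor>"
  define J where "J = nat \<lfloor>L\<rfloor>"
  have "{d\<in>{1..K}. primepow d \<and> \<not> prime d} \<subseteq> (\<lambda>(p, k). p ^ k) ` ({1..P} \<times> {1..J})"
  proof
    fix d assume d: "d \<in> {d\<in>{1..K}. primepow d \<and> \<not> prime d}"
    then obtain p k where pk: "prime p" "k > 0" "d = p ^ k" by (auto simp: primepow_def)
    have k: "k \<ge> 2" using pk d by (cases "k = 1") auto
    have p2: "p \<ge> 2" using pk by (simp add: prime_ge_2_nat)
    have "real d \<le> Y ^ 10" using d assms by auto
    then have dY: "real p ^ k \<le> Y ^ 10" by (simp add: pk(3))
    have "(real p)^2 \<le> real p ^ k" using k p2 by (intro power_increasing) auto
    also have "... \<le> (Y ^ 5)^2" using dY by (simp flip: power_mult)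
    finally have "real p \<le> Y ^ 5" using Y0 by (intro power2_le_imp_le[of "real p"]) auto
    then have "p \<le> P" unfolding P_def by (rule le_nat_floor)
    have "(2::real) ^ k \<le> real p ^ k" using p2 by (intro power_mono) auto
    also have "... \<le> Y ^ 13" using dY Y_pow_mono[of 10 13] by linarith
    finally have "log 2 (2 ^ k) + 1 \<le> L" by (intro log2_le_L) auto
    then have "real k \<le> L" by (simp add: log_nat_power)
    then have "k \<le> J" unfolding J_def by (rule le_nat_floor)
    with \<open>p \<le> P\<close> k p2 have "(p, k) \<in> {1..P} \<times> {1..J}" by simp
    then show "d \<in> (\<lambda>(p, k). p ^ k) ` ({1..P} \<times> {1..J})"
      unfolding pk(3) by (rule rev_image_eqI) simp
  qed
  then have "card {d\<in>{1..K}. primepow d \<and> \<not> prime d} \<le> card ({1..P} \<times> {1..J})"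
    by (intro surj_card_le) auto
  then have "real (card {d\<in>{1..K}. primepow d \<and> \<not> prime d}) \<le> real P * real J"
    by (simp add: card_cartesian_product flip: of_nat_mult)
  also have "... \<le> Y ^ 5 * L"
    unfolding P_def J_def using Y0 L0 by (intro mult_mono of_nat_floor) auto
  also have "... \<le> Y ^ 9 * L" using L0 by (intro mult_right_mono Y_pow_mono) auto
  finally show ?thesis by (simp add: mult.commute)
qed

text \<open>The weight Lambda(d)/ln d is 1 at primes, 0 off the prime powers, and between 0 and 1 at
  proper prime powers. It therefore differs from any set between the primes and the prime powers
  only at the few proper powers. Partial summation with the decreasing weight 1/ln d passes from
  Lambda to it.\<close>

lemma indicator_saw_sum_bound:
  fixes S :: "nat set"
  assumes S: "\<And>d. prime d \<Longrightarrow> d \<in> S" "\<And>d. d \<in> S \<Longrightarrow> primepow d"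
    and \<delta>: "0 \<le> \<delta>" "\<delta> \<le> 1" and K: "real K \<le> Y ^ 10"
  shows "\<bar>\<Sum>d\<in>{D0<..K}. indicator S d * saw (x / (real d + \<delta>))\<bar> \<le> 10000001 * L ^ 6 * Y ^ 9"
proof -
  define w where "w d = 1 / ln (real d)" for d :: nat
  define v where "v d = saw (x / (real d + \<delta>))" for d :: nat
  have ln1: "1 \<le> ln (real d)" if "D0 < d" for d
  proof -
    have "exp 1 \<le> real d" using that D0_bounds(3) exp_le by linarith
    then show ?thesis using that by (simp add: ln_ge_iff)
  qed
  have "norm (\<Sum>d\<in>{Suc D0..<Suc K}. of_real (w d) * complex_of_real (mangoldt d * v d)) \<le> 1 * (10000000 * L ^ 6 * Y ^ 9)"
  proof (rule norm_sum_antimono_weights_le)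
    fix c assume "c \<le> Suc K"
    show "norm (\<Sum>d\<in>{Suc D0..<c}. complex_of_real (mangoldt d * v d)) \<le> 10000000 * L ^ 6 * Y ^ 9"
    proof (cases c)
      case (Suc k)
      then have "real k \<le> Y ^ 10" using \<open>c \<le> Suc K\<close> K by linarith
      from mangoldt_saw_initial_sum_bound[OF \<delta> this]
      have "\<bar>\<Sum>d\<in>{Suc D0..<c}. mangoldt d * v d\<bar> \<le> 10000000 * L ^ 6 * Y ^ 9"
        by (simp add: Suc v_def atLeastLessThanSuc_atLeastAtMost atLeastSucAtMost_greaterThanAtMost)
      then show ?thesis by (simp only: of_real_sum [symmetric] norm_of_real)
    qed (use L0 Y0 in simp)
  next
    fix n assume "Suc D0 \<le> n"
    then show "0 \<le> w n \<and> w n \<le> 1" using ln1[of n] by (simp add: w_def divide_le_eq)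
  next
    fix n assume "Suc D0 \<le> n"
    then show "w (Suc n) \<le> w n"
      unfolding w_def using ln1[of n] ln1[of "Suc n"] D0_bounds(3) by (intro divide_left_mono mult_pos_pos) auto
  qed auto
  also have "(\<Sum>d\<in>{Suc D0..<Suc K}. of_real (w d) * complex_of_real (mangoldt d * v d)) =
      of_real (\<Sum>d\<in>{D0<..K}. w d * mangoldt d * v d)"
    by (simp add: atLeastLessThanSuc_atLeastAtMost atLeastSucAtMost_greaterThanAtMost mult_ac)
  finally have main: "\<bar>\<Sum>d\<in>{D0<..K}. w d * mangoldt d * v d\<bar> \<le> 10000000 * L ^ 6 * Y ^ 9"
    by (simp only: norm_of_real mult_1)
  define Z where "Z = {d\<in>{1..K}. primepow d \<and> \<not> prime d}"
  have diff: "\<bar>(indicator S d - w d * mangoldt d) * v d\<bar> \<le> indicator Z d" if d: "d \<in> {D0<..K}" for d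
  proof -
    have l: "1 \<le> ln (real d)" using ln1 d by simp
    have d0: "d > 0" using d by (intro Nat.gr0I) auto
    have v: "\<bar>v d\<bar> \<le> 1" using abs_saw_le[of "x / (real d + \<delta>)"] by (simp add: v_def)
    have wm: "0 \<le> w d * mangoldt d" "w d * mangoldt d \<le> 1"
      using l mangoldt_le[OF d0] by (auto simp: w_def mangoldt_nonneg divide_le_eq)
    consider "prime d" | "\<not> primepow d" | "primepow d" "\<not> prime d" by blast
    then show ?thesis
    proof cases
      case 1
      then have "w d * mangoldt d = 1" using l by (simp add: w_def)
      then show ?thesis using S(1)[OF 1] by (simp add: indicator_def)
    next
      case 2
      then have "mangoldt d = (0 :: real)" "d \<notin> S" using S(2) by (auto simp: mangoldt_def)
      then show ?thesis by simp
    next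
      case 3
      then have "d \<in> Z" using d d0 by (simp add: Z_def)
      moreover have "\<bar>indicator S d - w d * mangoldt d\<bar> \<le> 1" using wm by (auto simp: indicator_def)
      then have "\<bar>(indicator S d - w d * mangoldt d) * v d\<bar> \<le> 1 * 1"
        unfolding abs_mult using v by (intro mult_mono) auto
      ultimately show ?thesis by simp
    qed
  qed
  have "(\<Sum>d\<in>{D0<..K}. indicator S d * v d) =
      (\<Sum>d\<in>{D0<..K}. w d * mangoldt d * v d) + (\<Sum>d\<in>{D0<..K}. (indicator S d - w d * mangoldt d) * v d)"
    by (simp add: algebra_simps flip: sum.distrib)
  moreover have "\<bar>\<Sum>d\<in>{D0<..K}. (indicator S d - w d * mangoldt d) * v d\<bar> \<le> L * Y ^ 9"
  proof -
    have "\<bar>\<Sum>d\<in>{D0<..K}. (indicator S d - w d * mangoldt d) * v d\<bar> \<le> (\<Sum>d\<in>{D0<..K}. indicator Z d)"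
      by (rule order.trans[OF sum_abs], rule sum_mono, rule diff)
    also have "... = (\<Sum>d\<in>{D0<..K} \<inter> Z. 1)"
      by (rule sum.mono_neutral_cong_right) (auto simp: indicator_def)
    also have "... = real (card ({D0<..K} \<inter> Z))" by simp
    also have "... \<le> real (card Z)" by (intro of_nat_mono card_mono) (auto simp: Z_def)
    also have "... \<le> L * Y ^ 9" unfolding Z_def by (rule card_proper_prime_powers_le[OF K])
    finally show ?thesis .
  qed
  moreover have "L * Y ^ 9 \<le> L ^ 6 * Y ^ 9"
    using power_increasing[of 1 6 L] L1 Y0 by (intro mult_right_mono) auto
  ultimately show ?thesis using main by (simp add: v_def algebra_simps)
qed

lemma floor_sum_indicator_bound:
  fixes S :: "nat set"
  assumes S: "\<And>d. prime d \<Longrightarrow> d \<in> S" "\<And>d. d \<in> S \<Longrightarrow> primepow d"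
  defines "C \<equiv> (\<Sum>\<^sub>\<infinity>d\<in>S. 1 / (real d * (real d + 1)))"
  shows "\<bar>floor_sum (indicator S) x - C * x\<bar> \<le> 30000000 * L ^ 6 * Y ^ 9"
proof -
  define f :: "nat \<Rightarrow> real" where "f = indicator S"
  have f: "0 \<le> f d" "f d \<le> 1" for d by (auto simp: f_def indicator_def)
  define K where "K = nat \<lfloor>Y ^ 10\<rfloor>"
  have K: "real K \<le> Y ^ 10" "Y ^ 10 \<le> real K + 1"
    unfolding K_def using Y0 by (auto intro!: of_nat_floor)
  have D0K: "D0 \<le> K"
    unfolding K_def
  proof (rule le_nat_floor)
    have "2 * Y ^ 9 \<le> Y ^ 10" by (rule const_mult_Y_pow_le[of _ 1]) auto
    then show "real D0 \<le> Y ^ 10" using D0_bounds by linarith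
  qed
  define N where "N = {n::nat. n \<ge> 1 \<and> real n \<le> x}"
  define q where "q n = nat \<lfloor>x / real n\<rfloor>" for n :: nat
  have finN: "finite N" unfolding N_def by (rule finite_floor_sum_index)
  define A where "A = {n\<in>N. q n \<le> K}"
  define A' where "A' = {n\<in>N. K < q n}"
  have "floor_sum f x = (\<Sum>n\<in>N. f (q n))" by (simp add: floor_sum_def N_def q_def)
  also have "N = A \<union> A'" by (auto simp: A_def A'_def)
  also have "(\<Sum>n\<in>A \<union> A'. f (q n)) = (\<Sum>n\<in>A. f (q n)) + (\<Sum>n\<in>A'. f (q n))"
    by (rule sum.union_disjoint) (use finN in \<open>auto simp: A_def A'_def\<close>)
  finally have split: "floor_sum f x = (\<Sum>n\<in>A. f (q n)) + (\<Sum>n\<in>A'. f (q n))" .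
  have small: "0 \<le> (\<Sum>n\<in>A'. f (q n))" "(\<Sum>n\<in>A'. f (q n)) \<le> Y ^ 9"
  proof -
    show "0 \<le> (\<Sum>n\<in>A'. f (q n))" by (intro sum_nonneg f)
    have "A' \<subseteq> {1..nat \<lfloor>Y ^ 9\<rfloor>}"
    proof
      fix n assume n: "n \<in> A'"
      then have n1: "n \<ge> 1" "real n > 0" by (auto simp: A'_def N_def)
      \<comment> \<open>Since K is the integer part of Y^10, q n > K means q n >= K + 1 >= Y^10, and
        n <= x/Y^10 = Y^9 follows.\<close>
      have "real K + 1 \<le> real (q n)" using n by (auto simp: A'_def)
      also have "... \<le> x / real n" unfolding q_def by (rule of_nat_floor) (use x_pos in simp)
      finally have "Y ^ 10 \<le> x / real n" using K by linarith
      then have "real n * Y ^ 10 \<le> x" using n1 by (simp add: field_simps)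
      also have "x = Y ^ 9 * Y ^ 10" by (simp add: x_eq flip: power_add)
      finally have "real n \<le> Y ^ 9" by (rule mult_right_le_imp_le) (use Y0 in simp)
      then show "n \<in> {1..nat \<lfloor>Y ^ 9\<rfloor>}" using n1 by (auto intro: le_nat_floor)
    qed
    then have "card A' \<le> nat \<lfloor>Y ^ 9\<rfloor>" using card_mono[of "{1..nat \<lfloor>Y ^ 9\<rfloor>}" A'] by simp
    moreover have "real (nat \<lfloor>Y ^ 9\<rfloor>) \<le> Y ^ 9" by (rule of_nat_floor) (use Y0 in simp)
    moreover have "(\<Sum>n\<in>A'. f (q n)) \<le> real (card A')"
      using sum_bounded_above[of A' "\<lambda>n. f (q n)" 1] f by simp
    ultimately show "(\<Sum>n\<in>A'. f (q n)) \<le> Y ^ 9" by linarith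
  qed
  define R where "R d = saw (x / (real d + 1)) - saw (x / real d)" for d :: nat
  have "(\<Sum>n\<in>A. f (q n)) = (\<Sum>d\<in>{1..K}. \<Sum>n | n \<in> A \<and> q n = d. f (q n))"
  proof (rule sum.group [symmetric])
    show "q ` A \<subseteq> {1..K}"
    proof
      fix d assume "d \<in> q ` A"
      then obtain n where n: "n \<in> N" "q n \<le> K" "d = q n" by (auto simp: A_def)
      have "1 \<le> x / real n" using n by (auto simp: N_def le_divide_eq)
      then have "1 \<le> q n" unfolding q_def by (intro le_nat_floor) simp
      with n show "d \<in> {1..K}" by simp
    qed
  qed (use finN in \<open>auto simp: A_def\<close>)
  also have "... = (\<Sum>d\<in>{1..K}. f d * (x * (1 / (real d * (real d + 1))) + R d))"
  proof (rule sum.cong[OF refl])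
    fix d assume d: "d \<in> {1..K}"
    have set: "{n. n \<in> A \<and> q n = d} = {n. n \<ge> 1 \<and> real n \<le> x \<and> nat \<lfloor>x / real n\<rfloor> = d}"
      using d by (auto simp: A_def N_def q_def)
    have "(\<Sum>n | n \<in> A \<and> q n = d. f (q n)) = f d * real (card {n. n \<in> A \<and> q n = d})" by simp
    also have "... = f d * (x * (1 / (real d * (real d + 1))) + R d)"
      unfolding set using card_floor_quotient_eq[OF x_pos, of d] d by (simp add: R_def)
    finally show "(\<Sum>n | n \<in> A \<and> q n = d. f (q n)) = f d * (x * (1 / (real d * (real d + 1))) + R d)" .
  qed
  also have "... = x * (\<Sum>d\<in>{1..K}. f d * (1 / (real d * (real d + 1)))) + (\<Sum>d\<in>{1..K}. f d * R d)"
    by (simp add: distrib_left sum.distrib sum_distrib_left mult_ac)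
  finally have large: "(\<Sum>n\<in>A. f (q n)) = x * (\<Sum>d\<in>{1..K}. f d * (1 / (real d * (real d + 1)))) + (\<Sum>d\<in>{1..K}. f d * R d)" .
  have S0: "0 \<notin> S" using S(2)[of 0] by auto
  \<comment> \<open>\<open>G\<close> is the tail of the series beyond K. It is at most 1/(K + 1) by
    telescoping, so completing the series costs x/Y^10 = Y^9, the same as the values n with large
    quotient.\<close>
  define G where "G = C - (\<Sum>d\<in>{1..K}. f d * (1 / (real d * (real d + 1))))"
  have G: "0 \<le> G" "G \<le> 1 / (real K + 1)"
    unfolding G_def C_def f_def by (rule pronic_tail_bounds[OF S0])+
  have Gx: "0 \<le> x * G" "x * G \<le> Y ^ 9"
  proof -
    show "0 \<le> x * G" using G x_pos by simp
    have "1 / (real K + 1) \<le> 1 / Y ^ 10" using K Y0 by (intro divide_left_mono) auto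
    then have "x * G \<le> x * (1 / Y ^ 10)" using G x_pos by (intro mult_left_mono) auto
    also have "... = Y ^ 9" using Y0 by (simp add: x_eq field_simps flip: power_add)
    finally show "x * G \<le> Y ^ 9" .
  qed
  have err: "\<bar>\<Sum>d\<in>{1..K}. f d * R d\<bar> \<le> 2 * Y ^ 9 + 2 * (10000001 * L ^ 6 * Y ^ 9)"
  proof -
    have "{1..K} = {1..D0} \<union> {D0<..K}" using D0K by auto
    then have "(\<Sum>d\<in>{1..K}. f d * R d) = (\<Sum>d\<in>{1..D0}. f d * R d) + (\<Sum>d\<in>{D0<..K}. f d * R d)"
      by (simp only:) (rule sum.union_disjoint, auto)
    moreover have "\<bar>\<Sum>d\<in>{1..D0}. f d * R d\<bar> \<le> 2 * Y ^ 9"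
    proof -
      have "\<bar>\<Sum>d\<in>{1..D0}. f d * R d\<bar> \<le> (\<Sum>d\<in>{1..D0}. 1)"
      proof (rule order.trans[OF sum_abs], rule sum_mono)
        fix d
        have "\<bar>R d\<bar> \<le> 1" using abs_saw_le[of "x / (real d + 1)"] abs_saw_le[of "x / real d"]
          unfolding R_def by linarith
        then have "\<bar>f d\<bar> * \<bar>R d\<bar> \<le> 1 * 1" using f by (intro mult_mono) auto
        then show "\<bar>f d * R d\<bar> \<le> 1" by (simp add: abs_mult)
      qed
      then show ?thesis using D0_bounds by simp
    qed
    moreover have "(\<Sum>d\<in>{D0<..K}. f d * R d) =
        (\<Sum>d\<in>{D0<..K}. f d * saw (x / (real d + 1))) - (\<Sum>d\<in>{D0<..K}. f d * saw (x / (real d + 0)))"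
      by (simp add: R_def right_diff_distrib sum_subtractf)
    moreover have "\<bar>\<Sum>d\<in>{D0<..K}. f d * saw (x / (real d + 1))\<bar> \<le> 10000001 * L ^ 6 * Y ^ 9"
      "\<bar>\<Sum>d\<in>{D0<..K}. f d * saw (x / (real d + 0))\<bar> \<le> 10000001 * L ^ 6 * Y ^ 9"
      unfolding f_def by (rule indicator_saw_sum_bound[OF S]; use K in simp)+
    ultimately show ?thesis by linarith
  qed
  have "floor_sum f x - C * x = (\<Sum>n\<in>A'. f (q n)) + (\<Sum>d\<in>{1..K}. f d * R d) - x * G"
    unfolding split large G_def by (simp add: algebra_simps)
  then have "\<bar>floor_sum f x - C * x\<bar> \<le> Y ^ 9 + Y ^ 9 + (2 * Y ^ 9 + 2 * (10000001 * L ^ 6 * Y ^ 9))"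
    using small err Gx by linarith
  also have "... = 4 * (1 * Y ^ 9) + 20000002 * (L ^ 6 * Y ^ 9)" by simp
  also have "... \<le> 4 * (L ^ 6 * Y ^ 9) + 20000002 * (L ^ 6 * Y ^ 9)"
    using one_le_power[OF L1, of 6] Y0 by (intro add_right_mono mult_left_mono mult_right_mono) auto
  also have "... \<le> 30000000 * L ^ 6 * Y ^ 9" using Y0 L0 by simp
  finally show ?thesis by (simp add: f_def)
qed

end

lemma floor_sum_asymptotics:
  fixes \<epsilon> :: real and S :: "nat set"
  assumes \<epsilon>: "\<epsilon> > 0" and S: "\<And>d. prime d \<Longrightarrow> d \<in> S" "\<And>d. d \<in> S \<Longrightarrow> primepow d"
  shows "(\<lambda>x. floor_sum (indicator S) x - (\<Sum>\<^sub>\<infinity>d\<in>S. 1 / (real d * (real d + 1))) * x)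
           \<in> O[at_top](\<lambda>x. x powr (9 / 19 + \<epsilon>))"
proof -
  \<comment> \<open>With L a multiple of Y^a, the factor L^6 becomes Y^(6 a) = x^(6 a/19) =
    x^epsilon.\<close>
  define a where "a = 19 * \<epsilon> / 6"
  have a: "a > 0" using \<epsilon> by (simp add: a_def)
  \<comment> \<open>The divisor bound is applied to n <= Y^20, where n^(a/20) <= Y^a.\<close>
  then have "a / 20 > 0" by simp
  then obtain c where c: "c \<ge> 1" "\<And>n. n > 0 \<Longrightarrow> real (card {d. d dvd n}) \<le> c * real n powr (a / 20)"
    using divisor_bound by blast
  \<comment> \<open>The alternative 20/a ensures 20 ln Y = (20/a) ln (Y^a) <= (20/a) Y^a <=
    L.\<close>
  define c' where "c' = max c (20 / a)"
  have c': "c \<le> c'" "20 / a \<le> c'" "c' \<ge> 0" using c by (auto simp: c'_def)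
  show ?thesis
  proof (rule bigoI[of _ "30000000 * c' ^ 6"])
    show "eventually (\<lambda>x. norm (floor_sum (indicator S) x - (\<Sum>\<^sub>\<infinity>d\<in>S. 1 / (real d * (real d + 1))) * x) \<le>
        30000000 * c' ^ 6 * norm (x powr (9 / 19 + \<epsilon>))) at_top"
      using eventually_ge_at_top[of "1000 ^ 19"]
    proof eventually_elim
      case (elim x)
      then have x0: "x > 0" by (rule less_le_trans[rotated]) simp
      define Y where "Y = x powr (1 / 19)"
      define L where "L = c' * Y powr a"
      have Y0: "Y > 0" using x0 by (simp add: Y_def)
      have xY: "x = Y ^ 19"
        using x0 by (simp add: Y_def powr_power)
      have Y1000: "Y \<ge> 1000"
      proof (rule power_mono_iff[THEN iffD1])
        show "1000 ^ 19 \<le> Y ^ 19" using elim xY by (simp only:)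
      qed (use Y0 in auto)
      interpret floor_sum_scale x Y L
      proof
        have "a * ln Y = ln (Y powr a)" using Y0 by (simp add: ln_powr)
        also have "... \<le> Y powr a" using Y0 ln_le_minus_one[of "Y powr a"] by simp
        finally have "20 / a * (a * ln Y) \<le> 20 / a * Y powr a" using a by (intro mult_left_mono) auto
        also have "... \<le> L" unfolding L_def using c' by (intro mult_right_mono) auto
        finally show "20 * ln Y \<le> L" using a by simp
        fix n :: nat assume n: "0 < n" "real n \<le> Y ^ 20"
        have "real (card {d. d dvd n}) \<le> c * real n powr (a / 20)" using c(2)[OF n(1)] .
        also have "... \<le> c' * (Y ^ 20) powr (a / 20)"
          using n c c' a by (intro mult_mono powr_mono2) auto
        also have "(Y ^ 20) powr (a / 20) = Y powr a"
        proof -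
          have "Y ^ 20 = Y powr 20" using Y0 by simp
          then show ?thesis by (simp only: powr_powr) simp
        qed
        finally show "real (card {d. d dvd n}) \<le> L" by (simp add: L_def)
      qed (use xY Y1000 in auto)
      have "L ^ 6 * Y ^ 9 = c' ^ 6 * ((Y powr a) ^ 6 * Y ^ 9)" by (simp add: L_def power_mult_distrib)
      also have "(Y powr a) ^ 6 * Y ^ 9 = Y powr (6 * a + 9)"
      proof -
        have "(Y powr a) ^ 6 = Y powr (6 * a)" using Y0 by (simp add: powr_power mult.commute)
        then show ?thesis using Y0 by (simp add: powr_add)
      qed
      also have "... = x powr (9 / 19 + \<epsilon>)"
        by (simp add: Y_def powr_powr a_def add_divide_distrib add.commute)
      finally have "30000000 * L ^ 6 * Y ^ 9 = 30000000 * c' ^ 6 * x powr (9 / 19 + \<epsilon>)" by simp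
      then show ?case using floor_sum_indicator_bound[OF S] by simp
    qed
  qed
qed

text \<open>Unique factorisation makes (p, nu) -> p^nu injective, so the double series becomes a
  series over a set of integers, the form required by \<open>floor_sum_asymptotics\<close>.\<close>

lemma C_primepow_eq: "C_primepow = (\<Sum>\<^sub>\<infinity>d\<in>{q. primepow q}. 1 / (real d * (real d + 1)))"
proof -
  define A where "A = {(p::nat, \<nu>::nat). prime p \<and> \<nu> \<ge> 1}"
  define h where "h = (\<lambda>(p::nat, \<nu>::nat). p ^ \<nu>)"
  have inj: "inj_on h A"
  proof (rule inj_onI)
    fix y z assume "y \<in> A" "z \<in> A" "h y = h z"
    then show "y = z"
      using prime_power_inj''[of "fst y" "fst z" "snd y" "snd z"] by (auto simp: A_def h_def)
  qed
  have "{q. primepow q} = h ` A"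
  proof (intro equalityI subsetI)
    fix q :: nat assume "q \<in> {q. primepow q}"
    then obtain p k where "prime p" "k > 0" "q = p ^ k" by (auto simp: primepow_def)
    then show "q \<in> h ` A" by (intro image_eqI[of _ _ "(p, k)"]) (auto simp: h_def A_def)
  qed (auto simp: h_def A_def primepow_prime_power)
  then have "(\<Sum>\<^sub>\<infinity>d\<in>{q. primepow q}. 1 / (real d * (real d + 1))) = infsum ((\<lambda>d. 1 / (real d * (real d + 1))) \<circ> h) A"
    by (simp add: infsum_reindex[OF inj])
  also have "... = C_primepow"
    unfolding C_primepow_def A_def by (rule infsum_cong) (auto simp: h_def)
  finally show ?thesis ..
qed

theorem theorem2:
  fixes \<epsilon> :: real
  assumes "\<epsilon> > 0"
  shows "(\<lambda>x. floor_sum prime_ind x - C_prime * x) \<in> O[at_top](\<lambda>x. x powr (9 / 19 + \<epsilon>)) \<and>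
         (\<lambda>x. floor_sum primepow_ind x - C_primepow * x) \<in> O[at_top](\<lambda>x. x powr (9 / 19 + \<epsilon>))"
proof
  show "(\<lambda>x. floor_sum prime_ind x - C_prime * x) \<in> O[at_top](\<lambda>x. x powr (9 / 19 + \<epsilon>))"
    unfolding prime_ind_def C_prime_def
    by (rule floor_sum_asymptotics[OF assms]) (auto intro: primepow_prime)
  show "(\<lambda>x. floor_sum primepow_ind x - C_primepow * x) \<in> O[at_top](\<lambda>x. x powr (9 / 19 + \<epsilon>))"
    unfolding primepow_ind_def C_primepow_eq
    by (rule floor_sum_asymptotics[OF assms]) (auto intro: primepow_prime)
qed

end
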